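(* Suppose that $(X,T)$ is a dynamical system. (1) Let $0<\kappa<\frac{1}{2}$. If $(X,T)$ is not uniquely ergodic and is $m$-$g$-transitive with $$\liminf_{n\to+\infty}\frac{m(\varepsilon,x,y,n)+g(\varepsilon,x,y,n)}{m(\varepsilon,x,y,n)+n}<\kappa< \frac{1}{2}$$ for any $\varepsilon>0$ and any $x,y\in X$, then $\sharp \mathcal{M}_{dense}^*>1$. (2) If $(X,T)$ is not uniquely ergodic and satisfies the $m$-$g$-product property with $\liminf_{n\to+\infty}\frac{m(\varepsilon,x,y,n)+g(\varepsilon,x,y,n)}{n}=0$ for any $\varepsilon>0$ and any $x,y\in X$, then $\mathcal{M}^{e}(X,T)\subset\mathcal{M}_{dense}^*$ and thus $\sharp \mathcal{M}_{dense}^*>1$. (3) If $(X,T)$ satisfies the approximate product property and $C_T(X)=X$, then $\mathcal{M}_{dense}^*=\mathcal{M}(X,T)$ and $(X,T)$ is $m$-$g$-transitive (for some functions $m,g$) with $\lim_{n\to+\infty}\frac{m(\varepsilon,x,y,n)+g(\varepsilon,x,y,n)}{n}=0$ for any $\varepsilon>0$ and any $x,y\in X$. (4) If $(X,T)$ is minimal, then $\mathcal{M}^{e}(X,T)\subset\mathcal{M}_{dense}^*$ and for any $\varepsilon>0$ there is $m(\varepsilon)\in\mathbb{N}$ such that for any $x_1,x_2\in X$, any $n\in\mathbb{N}^{+}$ and any $\varepsilon'>0$ there are $p\in\mathbb{N}$ and $z\in X$ such that $0\leq p\leq m(\varepsilon)$, $$d(z,x_1)<\varepsilon,\quad d(T^{p+j}z,T^jx_2)<\varepsilon'\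 \text{for any}\ j\in \Lambda_n.$$ In particular, $(X,T)$ is $m$-transitive with $\lim_{n\to+\infty}\frac{m(\varepsilon)}{n}=0$.
   Context: $(X,d)$ is a compact metric space, $T:X\to X$ is continuous, and $(X,T)$ is called a dynamical system. $\mathbb{N}=\{0,1,2,\dots\}$, $\mathbb{N}^+=\{1,2,\dots\}$, $\Lambda_n=\{0,\dots,n-1\}$. $(X,T)$ is transitive if for all nonempty open $U,V\subset X$ there is $n\in\mathbb{N}$ with $U\cap T^{-n}V\ne\emptyset$. $\mathcal{M}(X,T)$ and $\mathcal{M}^e(X,T)$ are the sets of $T$-invariant and $T$-ergodic Borel probability measures. $m$-$g$-product property: let $m(\varepsilon,x,y,n)\in\mathbb{N}$ and $g(\varepsilon,x,y,n)\in\mathbb{N}$ with $g(\varepsilon,x,y,n)\le n$ be functions of $\varepsilon>0$, $x,y\in X$, $n\in\mathbb{N}^+$. $(X,T)$ has the $m$-$g$-product property if for any $\varepsilon>0$ and $x_1,x_2\in X$ there is $N(\varepsilon,x_1,x_2)\in\mathbb{N}^+$ such that for every integer $n\ge N$ there exist $z\in X$, $p\in\mathbb{N}$, $\Lambda\subseteq\Lambda_n$ with $0\le p\le m(\varepsilon,x_1,x_2,n)$, $|\Lambda_n\setminus\Lambda|\le g(\varepsilon,x_1,x_2,n)$, $d(z,x_1)<\varepsilon$, and $d(T^{p+j}z,T^jx_2)<\varepsilon$ for all $j\in\Lambda$. $(X,T)$ is $m$-$g$-transitive if it has the $m$-$g$-product property and is transitive; it is $m$-transitive if this holds with $g\equiv0$.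 Approximate product property: for any $\varepsilon>0$, $\delta_1>0$, $\delta_2>0$ there is $N(\varepsilon,\delta_1,\delta_2)\in\mathbb{N}^+$ such that for any $n\ge N$ and any sequence $\{x_i\}_{i\ge1}$ in $X$ there exist a sequence of integers $\{h_i\}_{i\ge1}$ and $x\in X$ with $h_1=0$, $n\le h_{i+1}-h_i\le n(1+\delta_2)$ and $\#\{0\le j\le n-1\mid d(T^{h_i+j}x,T^jx_i)\ge\varepsilon\}\le\delta_1n$ for all $i$. Measure center: $C_T(X)=\overline{\bigcup_{\mu\in\mathcal{M}(X,T)}S_\mu}$, where $S_\mu$ is the support of $\mu$. For $x\in X$, $V_T(x)$ is the set of weak* accumulation points of $\frac1n\sum_{i=0}^{n-1}\delta_{T^ix}$. Let $\rho(\mu_1,\mu_2)=\sum_{i\ge 1}2^{-i}|\int f_i d\mu_1-\int f_i d\mu_2|$ be a metric for the weak* topology on Borel probability measures, where $\{f_i\}\subset C(X)$ is a suitable countable set with $\|f_i\|=1$ ($C(X)$ the real continuous functions on $X$ with sup norm). $G^\mu_\varepsilon=\{x\in X\mid \inf_{\nu\in V_T(x)}\rho(\mu,\nu)\le\varepsilon\}$ and $\mathcal{M}_{dense}^*=\{\mu\in\mathcal{M}(X,T)\mid G^\mu_\varepsilon\text{ is dense in }X\text{ for any }\varepsilon>0\}$. *)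

theory Defs
  imports "HOL-Probability.Probability"
begin

text \<open>
  A dynamical system is a continuous map on a type of class \<open>metric_space\<close> whose universe is
  compact; the space \<open>C(X)\<close> with the sup norm is then the type \<open>'a \<Rightarrow>\<^sub>C real\<close>.
\<close>

definition dynamical_system :: "('a::metric_space \<Rightarrow> 'a) \<Rightarrow> bool" where
  "dynamical_system T \<longleftrightarrow> compact (UNIV :: 'a set) \<and> continuous_on UNIV T"

definition transitive :: "('a::topological_space \<Rightarrow> 'a) \<Rightarrow> bool" where
  "transitive T \<longleftrightarrow>
     (\<forall>U V. open U \<and> U \<noteq> {} \<and> open V \<and> V \<noteq> {} \<longrightarrow> (\<exists>n. U \<inter> (T ^^ n) -` V \<noteq> {}))"

definition minimal :: "('a::topological_space \<Rightarrow> 'a) \<Rightarrow> bool" where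
  "minimal T \<longleftrightarrow> (\<forall>x. closure (range (\<lambda>n. (T ^^ n) x)) = UNIV)"


subsection \<open>Invariant measures\<close>

definition borel_probs :: "'a::topological_space measure set" where
  "borel_probs = {\<mu>. sets \<mu> = sets borel \<and> prob_space \<mu>}"

definition invariant_measures :: "('a::topological_space \<Rightarrow> 'a) \<Rightarrow> 'a measure set" where
  "invariant_measures T = {\<mu> \<in> borel_probs. distr \<mu> borel T = \<mu>}"

definition ergodic_measures :: "('a::topological_space \<Rightarrow> 'a) \<Rightarrow> 'a measure set" where
  "ergodic_measures T =
     {\<mu> \<in> invariant_measures T.
        \<forall>A \<in> sets borel. T -` A = A \<longrightarrow> measure \<mu> A = 0 \<or> measure \<mu> A = 1}"

definition uniquely_ergodic :: "('a::topological_space \<Rightarrow> 'a) \<Rightarrow> bool" where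
  "uniquely_ergodic T \<longleftrightarrow> (\<exists>!\<mu>. \<mu> \<in> invariant_measures T)"

definition msupport :: "'a::topological_space measure \<Rightarrow> 'a set" where
  "msupport \<mu> = {x. \<forall>U. open U \<and> x \<in> U \<longrightarrow> emeasure \<mu> U > 0}"

definition measure_center :: "('a::topological_space \<Rightarrow> 'a) \<Rightarrow> 'a set" where
  "measure_center T = closure (\<Union>\<mu> \<in> invariant_measures T. msupport \<mu>)"


subsection \<open>The weak* topology and the set \<open>\<M>\<^sup>*\<close> of densely approximated measures\<close>

definition weak_star_topology :: "'a::topological_space measure topology" where
  "weak_star_topology =
     topology_generated_by
       {{\<mu> \<in> borel_probs. (\<integral>x. \<phi> x \<partial>\<mu>) \<in> U} | (\<phi> :: 'a \<Rightarrow>\<^sub>C real) U. open U}"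

text \<open>
  The sum is written with \<open>infsum\<close> rather than \<open>suminf\<close> because \<open>Metric_space\<close> demands
  nonnegativity for all arguments, including measures outside \<open>borel_probs\<close> for which
  the series may diverge.
\<close>

definition rho ::
  "(nat \<Rightarrow> 'a::topological_space \<Rightarrow>\<^sub>C real) \<Rightarrow> 'a measure \<Rightarrow> 'a measure \<Rightarrow> real" where
  "rho f \<mu> \<nu> = (\<Sum>\<^sub>\<infinity>i\<in>{1..}. (1 / 2) ^ i * \<bar>(\<integral>x. f i x \<partial>\<mu>) - (\<integral>x. f i x \<partial>\<nu>)\<bar>)"

definition suitable :: "(nat \<Rightarrow> 'a::topological_space \<Rightarrow>\<^sub>C real) \<Rightarrow> bool" where
  "suitable f \<longleftrightarrow>
     (\<forall>i\<ge>1. norm (f i) = 1) \<and>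
     Metric_space borel_probs (rho f) \<and>
     Metric_space.mtopology borel_probs (rho f) = weak_star_topology"

text \<open>
  The image of the uniform distribution on \<open>{0,\<dots>,n-1}\<close> is the average of the
  Dirac measures along the orbit. For \<open>n = 0\<close> it is the null measure, which lies in no weak*
  open set.
\<close>

definition empirical_measure :: "('a::topological_space \<Rightarrow> 'a) \<Rightarrow> 'a \<Rightarrow> nat \<Rightarrow> 'a measure" where
  "empirical_measure T x n = distr (uniform_count_measure {..<n}) borel (\<lambda>i. (T ^^ i) x)"

definition limit_measures :: "('a::topological_space \<Rightarrow> 'a) \<Rightarrow> 'a \<Rightarrow> 'a measure set" where
  "limit_measures T x =
     {\<nu> \<in> borel_probs. \<forall>U. openin weak_star_topology U \<and> \<nu> \<in> U \<longrightarrow>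
        (\<exists>\<^sub>F n in sequentially. empirical_measure T x n \<in> U)}"

definition G_set ::
  "(nat \<Rightarrow> 'a::topological_space \<Rightarrow>\<^sub>C real) \<Rightarrow> ('a \<Rightarrow> 'a) \<Rightarrow> 'a measure \<Rightarrow> real \<Rightarrow> 'a set" where
  "G_set f T \<mu> \<epsilon> = {x. (INF \<nu> \<in> limit_measures T x. rho f \<mu> \<nu>) \<le> \<epsilon>}"

definition M_dense ::
  "(nat \<Rightarrow> 'a::topological_space \<Rightarrow>\<^sub>C real) \<Rightarrow> ('a \<Rightarrow> 'a) \<Rightarrow> 'a measure set" where
  "M_dense f T = {\<mu> \<in> invariant_measures T. \<forall>\<epsilon>>0. closure (G_set f T \<mu> \<epsilon>) = UNIV}"


subsection \<open>Product properties\<close>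

definition mg_product_property ::
  "('a::metric_space \<Rightarrow> 'a) \<Rightarrow> (real \<Rightarrow> 'a \<Rightarrow> 'a \<Rightarrow> nat \<Rightarrow> nat) \<Rightarrow>
   (real \<Rightarrow> 'a \<Rightarrow> 'a \<Rightarrow> nat \<Rightarrow> nat) \<Rightarrow> bool" where
  "mg_product_property T m g \<longleftrightarrow>
     (\<forall>\<epsilon>>0. \<forall>x y. \<forall>n\<ge>1. g \<epsilon> x y n \<le> n) \<and>
     (\<forall>\<epsilon>>0. \<forall>x1 x2. \<exists>N\<ge>1. \<forall>n\<ge>N. \<exists>z p \<Lambda>.
        \<Lambda> \<subseteq> {..<n} \<and> p \<le> m \<epsilon> x1 x2 n \<and> card ({..<n} - \<Lambda>) \<le> g \<epsilon> x1 x2 n \<and>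
        dist z x1 < \<epsilon> \<and> (\<forall>j\<in>\<Lambda>. dist ((T ^^ (p + j)) z) ((T ^^ j) x2) < \<epsilon>))"

definition mg_transitive ::
  "('a::metric_space \<Rightarrow> 'a) \<Rightarrow> (real \<Rightarrow> 'a \<Rightarrow> 'a \<Rightarrow> nat \<Rightarrow> nat) \<Rightarrow>
   (real \<Rightarrow> 'a \<Rightarrow> 'a \<Rightarrow> nat \<Rightarrow> nat) \<Rightarrow> bool" where
  "mg_transitive T m g \<longleftrightarrow> mg_product_property T m g \<and> transitive T"

definition m_transitive ::
  "('a::metric_space \<Rightarrow> 'a) \<Rightarrow> (real \<Rightarrow> 'a \<Rightarrow> 'a \<Rightarrow> nat \<Rightarrow> nat) \<Rightarrow> bool" where
  "m_transitive T m \<longleftrightarrow> mg_transitive T m (\<lambda>_ _ _ _. 0)"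

text \<open>
  The shifts \<open>h i\<close> may be taken in \<open>nat\<close>: they start at 0 and increase. Values at index 0 of the
  sequences are irrelevant.
\<close>

definition approximate_product_property :: "('a::metric_space \<Rightarrow> 'a) \<Rightarrow> bool" where
  "approximate_product_property T \<longleftrightarrow>
     (\<forall>\<epsilon>>0. \<forall>\<delta>1>0. \<forall>\<delta>2>0. \<exists>N\<ge>1. \<forall>n\<ge>N. \<forall>xs :: nat \<Rightarrow> 'a. \<exists>(h :: nat \<Rightarrow> nat) x.
        h 1 = 0 \<and>
        (\<forall>i\<ge>1.
           real n \<le> real (h (i + 1)) - real (h i) \<and>
           real (h (i + 1)) - real (h i) \<le> real n * (1 + \<delta>2) \<and>
           real (card {j. j < n \<and> dist ((T ^^ (h i + j)) x) ((T ^^ j) (xs i)) \<ge> \<epsilon>})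
             \<le> \<delta>1 * real n))"

end

theory Submission
  imports Defs
begin

text \<open>
  Two mechanisms put measures into \<open>\<M>\<^sup>*\<close>. A point with dense orbit puts all its accumulation
  measures there, because every point of its orbit inherits them (\<open>dense_orbit_limit_measures\<close>).
  And a measure belongs to \<open>\<M>\<^sup>*\<close> as soon as every nonempty open set has a point whose empirical
  measures come close to it infinitely often (\<open>M_denseI\<close>); since this is a countable intersection
  of open conditions, Baire category reduces it to finding, near any given point, a single orbit
  segment of large length with the right averages.

  The product property supplies such segments: after a delay \<open>p\<close> the orbit of \<open>z\<close> follows a point
  \<open>y\<close> for \<open>n\<close> steps with few errors, so all averages of \<open>z\<close> over time \<open>p + n\<close> agree with those of
  \<open>y\<close> up to the lost fraction \<open>(m + g) / (m + n)\<close> (\<open>shadowing_average\<close>). If \<open>y\<close> is generic for an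
  ergodic measure and the lost fraction is arbitrarily small, that measure is in \<open>\<M>\<^sup>*\<close>. If only
  less than half is lost, a residual point shadows generic points of two different ergodic
  measures in turn; as these can be separated by one continuous function with integrals almost
  0 and almost 1, its empirical measures oscillate, and having a dense orbit it yields two elements.

  Under the approximate product property one block of the tracing orbit visits a prescribed open
  set, which is possible because the measure center is everything, and all later blocks are chosen
  greedily so that their averages converge to those of a given invariant measure
  (\<open>greedy_averaging_sequence\<close>). In a minimal system all orbits are dense and \<open>T\<close> is
  onto, so some preimage of \<open>x2\<close> of bounded order is close to \<open>x1\<close>.

  Three classical facts carry these arguments. Weak sequential compactness of the probability
  measures is obtained by coding the space by real numbers and applying Helly's selection theorem.
  The pointwise ergodic theorem for ergodic measures follows Garsia's proof of the maximal
  inequality. The existence of at least two ergodic measures outside the uniquely ergodic case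
  comes from maximising the integrals of a sequence of functions one after the other, which ends
  in an extreme point.
\<close>

section \<open>Coding a compact metric space by real numbers\<close>

text \<open>This family is used twice: as a countable base of the topology, and as the list of sets whose
  membership digits encode a point.\<close>

lemma compact_fine_cover:
  assumes "compact (UNIV :: 'a::metric_space set)"
  obtains C :: "nat \<Rightarrow> 'a::metric_space set"
  where "\<And>i. open (C i)"
    and "\<And>e. e > 0 \<Longrightarrow> \<exists>k. \<forall>x. \<exists>i<k. x \<in> C i \<and> (\<forall>y\<in>C i. \<forall>z\<in>C i. dist y z < e)"
proof -
  have "\<exists>D :: 'a set. finite D \<and> UNIV \<subseteq> (\<Union>c\<in>D. ball c (1 / Suc n))" for n
  proof -
    have "1 / real (Suc n) > 0" by simp
    then show ?thesis using assms unfolding compact_eq_totally_bounded by blast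
  qed
  then obtain D :: "nat \<Rightarrow> 'a set" where D: "\<And>n. finite (D n)"
    "\<And>n. UNIV \<subseteq> (\<Union>c\<in>D n. ball c (1 / Suc n))" by metis
  define F where "F n = (\<lambda>c. ball c (1 / Suc n)) ` D n" for n
  have finF: "finite (F n)" for n using D by (auto simp: F_def)
  have ne: "F n \<noteq> {}" for n using D(2)[of n] by (auto simp: F_def)
  define C where "C = from_nat_into (\<Union>n. F n)"
  have rC: "range C = (\<Union>n. F n)"
    unfolding C_def using ne finF by (intro range_from_nat_into) (auto intro: countable_finite)
  show thesis
  proof (rule that[of C])
    show "open (C i)" for i
    proof -
      have "C i \<in> (\<Union>n. F n)" using rC by blast
      then show ?thesis by (auto simp: F_def)
    qed
  next
    fix e :: real assume "e > 0"
    then obtain n where n: "inverse (real (Suc n)) < e / 2"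
      using reals_Archimedean[of "e/2"] by auto
    have "\<forall>B\<in>F n. \<exists>i. C i = B" using rC by (metis UN_iff UNIV_I image_iff)
    then obtain idx where idx: "\<And>B. B \<in> F n \<Longrightarrow> C (idx B) = B" by metis
    define k where "k = Suc (Max (idx ` F n))"
    have "\<exists>i<k. x \<in> C i \<and> (\<forall>y\<in>C i. \<forall>z\<in>C i. dist y z < e)" for x
    proof -
      have "x \<in> (\<Union>c\<in>D n. ball c (1 / Suc n))" using D(2) by blast
      then obtain c where c: "c \<in> D n" "x \<in> ball c (1 / Suc n)" by auto
      let ?B = "ball c (1 / Suc n)"
      have B: "?B \<in> F n" using c by (auto simp: F_def)
      have "idx ?B \<le> Max (idx ` F n)" using finF B by auto
      then have "idx ?B < k" by (simp add: k_def)
      moreover have "dist y z < e" if "y \<in> ?B" "z \<in> ?B" for y z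
      proof -
        have "dist c y < e/2" "dist c z < e/2" using that n by (auto simp: inverse_eq_divide)
        then show ?thesis using dist_triangle_half_r by blast
      qed
      ultimately show ?thesis using c idx[OF B] by (intro exI[of _ "idx ?B"]) auto
    qed
    then show "\<exists>k. \<forall>x. \<exists>i<k. x \<in> C i \<and> (\<forall>y\<in>C i. \<forall>z\<in>C i. dist y z < e)" by blast
  qed
qed

lemma summable_base3: "summable (\<lambda>i. 1 / 3 ^ i :: real)"
  using summable_geometric[of "1/3 :: real"] by (simp add: power_divide)

lemma summable_digits_base3: "summable (\<lambda>i. of_bool (a i) / 3 ^ i :: real)"
  by (rule summable_comparison_test'[OF summable_base3, of 0]) (auto simp: of_bool_def)

text \<open>Base 3 is used so that the first differing digit outweighs all later ones together: two
  expansions with digits 0 and 1 are close only if they share an initial segment.\<close>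

lemma binary_digits_base3_agree:
  fixes a b :: "nat \<Rightarrow> bool"
  assumes less: "\<bar>(\<Sum>i. of_bool (a i) / 3 ^ i) - (\<Sum>i. of_bool (b i) / 3 ^ i)\<bar> < 1 / (2 * 3 ^ k :: real)"
    and "i \<le> k"
  shows "a i = b i"
proof (rule ccontr)
  assume "a i \<noteq> b i"
  define j where "j = (LEAST j. a j \<noteq> b j)"
  have j: "a j \<noteq> b j" and jmin: "\<And>l. l < j \<Longrightarrow> a l = b l"
    using LeastI[of "\<lambda>j. a j \<noteq> b j" i] \<open>a i \<noteq> b i\<close> not_less_Least
    unfolding j_def by blast+
  have "j \<le> i" unfolding j_def by (rule Least_le) fact
  then have "j \<le> k" using \<open>i \<le> k\<close> by simp
  note sm = summable_digits_base3
  define d where "d i = (of_bool (a i) / 3 ^ i - of_bool (b i) / 3 ^ i :: real)" for i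
  have sd: "summable d" unfolding d_def by (intro summable_diff sm)
  have eq: "(\<Sum>i. of_bool (a i) / 3 ^ i) - (\<Sum>i. of_bool (b i) / 3 ^ i) = suminf d"
    unfolding d_def by (rule suminf_diff[OF sm sm])
  have d0: "d l = 0" if "l < j" for l using jmin[OF that] by (simp add: d_def)
  have dj: "\<bar>d j\<bar> = 1 / 3 ^ j" using j by (auto simp: d_def of_bool_def)
  have split: "suminf d = (\<Sum>l. d (l + Suc j)) + (\<Sum>l<Suc j. d l)"
    by (rule suminf_split_initial_segment[OF sd])
  have s1: "(\<Sum>l<Suc j. d l) = d j" using d0 by simp
  have tail: "\<bar>\<Sum>l. d (l + Suc j)\<bar> \<le> (\<Sum>l. (1 / 3 ^ Suc j) * (1/3 :: real) ^ l)"
  proof -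
    have sg: "summable (\<lambda>l. (1 / 3 ^ Suc j) * (1/3 :: real) ^ l)"
      by (intro summable_mult summable_geometric) simp
    have le: "norm (d (l + Suc j)) \<le> (1 / 3 ^ Suc j) * (1/3 :: real) ^ l" for l
      by (auto simp: d_def of_bool_def power_add power_divide field_simps)
    have sn: "summable (\<lambda>l. norm (d (l + Suc j)))"
      by (rule summable_comparison_test'[OF sg, of 0]) (use le in auto)
    have "norm (\<Sum>l. d (l + Suc j)) \<le> (\<Sum>l. norm (d (l + Suc j)))"
      by (rule summable_norm[OF sn])
    also have "\<dots> \<le> (\<Sum>l. (1 / 3 ^ Suc j) * (1/3 :: real) ^ l)"
      by (rule suminf_le[OF le sn sg])
    finally show ?thesis by simp
  qed
  also have "(\<Sum>l. (1 / 3 ^ Suc j) * (1/3 :: real) ^ l) = 1 / (2 * 3 ^ j)"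
    by (subst suminf_mult) (auto simp: suminf_geometric summable_geometric field_simps)
  finally have "\<bar>suminf d\<bar> \<ge> 1 / 3 ^ j - 1 / (2 * 3 ^ j)" using split s1 dj by linarith
  also have "(1 / 3 ^ j - 1 / (2 * 3 ^ j) :: real) = 1 / (2 * 3 ^ j)" by (simp add: field_simps)
  finally have "\<bar>suminf d\<bar> \<ge> 1 / (2 * 3 ^ j)" .
  moreover have "(1 / (2 * 3 ^ j) :: real) \<ge> 1 / (2 * 3 ^ k)"
    using \<open>j \<le> k\<close> by (simp add: field_simps power_increasing)
  ultimately show False using less eq by simp
qed

text \<open>The code of a point lists its memberships in a countable fine cover as digits. It is only
  Borel, but its inverse is uniformly continuous, which is all that is needed to pull weak limits
  on the line back to the space.\<close>

lemma compact_real_code: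
  assumes comp: "compact (UNIV :: 'a::metric_space set)"
  obtains s :: "'a::metric_space \<Rightarrow> real"
  where "s \<in> borel_measurable borel" "\<And>x. 0 \<le> s x \<and> s x \<le> 2"
    "\<And>e. e > 0 \<Longrightarrow> \<exists>d>0. \<forall>x y. \<bar>s x - s y\<bar> < d \<longrightarrow> dist x y < e"
proof -
  obtain C :: "nat \<Rightarrow> 'a set" where Co: "\<And>i. open (C i)"
    and Ce: "\<And>e. e > 0 \<Longrightarrow> \<exists>k. \<forall>x. \<exists>i<k. x \<in> C i \<and> (\<forall>y\<in>C i. \<forall>z\<in>C i. dist y z < e)"
    using compact_fine_cover[OF comp] by blast
  define s where "s x = (\<Sum>i. of_bool (x \<in> C i) / 3 ^ i :: real)" for x
  note sm = summable_digits_base3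
  show thesis
  proof (rule that[of s])
    have [measurable]: "(\<lambda>x. indicator (C i) x :: real) \<in> borel_measurable borel" for i
      using Co by (intro borel_measurable_indicator) auto
    have "(\<lambda>x. \<Sum>i. indicator (C i) x / 3 ^ i :: real) \<in> borel_measurable borel" by measurable
    then show "s \<in> borel_measurable borel"
      by (simp add: s_def[abs_def] indicator_def of_bool_def)
    show "0 \<le> s x \<and> s x \<le> 2" for x
    proof
      show "0 \<le> s x" unfolding s_def by (intro suminf_nonneg sm) auto
      have "s x \<le> (\<Sum>i. 1 / 3 ^ i)" unfolding s_def
        by (intro suminf_le sm summable_base3) (auto simp: of_bool_def)
      also have "\<dots> = 3/2" using suminf_geometric[of "1/3 :: real"] by (simp add: power_divide)
      finally show "s x \<le> 2" by simp
    qed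
    fix e :: real assume "e > 0"
    then obtain k where k: "\<And>x. \<exists>i<k. x \<in> C i \<and> (\<forall>y\<in>C i. \<forall>z\<in>C i. dist y z < e)"
      using Ce by blast
    have "dist x y < e" if "\<bar>s x - s y\<bar> < 1 / (2 * 3 ^ k)" for x y
    proof -
      obtain i where i: "i < k" "x \<in> C i" "\<forall>y\<in>C i. \<forall>z\<in>C i. dist y z < e" using k by blast
      have "(x \<in> C i) = (y \<in> C i)"
        using binary_digits_base3_agree[of "\<lambda>i. x \<in> C i" "\<lambda>i. y \<in> C i" k i] that i(1)
        by (simp add: s_def)
      then show ?thesis using i by auto
    qed
    then show "\<exists>d>0. \<forall>x y. \<bar>s x - s y\<bar> < d \<longrightarrow> dist x y < e"
      by (intro exI[of _ "1 / (2 * 3 ^ k)"]) auto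
  qed
qed

text \<open>The inverse of the code extends to the closure \<open>K\<close> of its range: by compactness, points whose
  codes converge to \<open>r\<close> accumulate somewhere, and by uniform continuity at one place only.\<close>

lemma compact_real_decode:
  assumes comp: "compact (UNIV :: 'a::metric_space set)"
  obtains s :: "'a::metric_space \<Rightarrow> real" and h :: "real \<Rightarrow> 'a::metric_space" and K :: "real set"
  where "s \<in> borel_measurable borel" "\<And>x. 0 \<le> s x \<and> s x \<le> 2"
    "closed K" "continuous_on K h" "\<And>x. s x \<in> K" "\<And>x. h (s x) = x"
proof -
  obtain s :: "'a \<Rightarrow> real" where s: "s \<in> borel_measurable borel" "\<And>x. 0 \<le> s x \<and> s x \<le> 2"
    and se: "\<And>e. e > 0 \<Longrightarrow> \<exists>d>0. \<forall>x y. \<bar>s x - s y\<bar> < d \<longrightarrow> dist x y < e"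
    using compact_real_code[OF comp] by metis
  define K where "K = closure (range s)"
  define P where "P r x \<longleftrightarrow> (\<forall>e>0. \<exists>d>0. \<forall>y. \<bar>s y - r\<bar> < d \<longrightarrow> dist x y < e)" for r x
  have ex: "\<exists>x. P r x" if "r \<in> K" for r
  proof -
    have "\<exists>t. (\<forall>n. t n \<in> range s) \<and> t \<longlonglongrightarrow> r"
      using that closure_sequential[of r "range s"] unfolding K_def by blast
    then obtain t where t: "\<And>n. t n \<in> range s" "t \<longlonglongrightarrow> r" by blast
    have "\<forall>n. \<exists>y. t n = s y" using t(1) by blast
    then obtain u where u: "\<And>n. t n = s (u n)" by metis
    have "\<forall>u :: nat \<Rightarrow> 'a. \<exists>l r. strict_mono r \<and> (u \<circ> r) \<longlonglongrightarrow> l"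
      using comp unfolding compact_eq_seq_compact_metric seq_compact_def by simp
    then obtain x r' where x: "strict_mono r'" "(u \<circ> r') \<longlonglongrightarrow> x"
      by blast
    have lim: "(\<lambda>n. s (u (r' n))) \<longlonglongrightarrow> r"
      using LIMSEQ_subseq_LIMSEQ[OF t(2) x(1)] u by (simp add: o_def)
    have "P r x" unfolding P_def
    proof (intro allI impI)
      fix e :: real assume e: "e > 0"
      obtain d where d: "d > 0" "\<And>x y. \<bar>s x - s y\<bar> < d \<Longrightarrow> dist x y < e/2"
        using se[of "e/2"] e by auto
      have "dist x y < e" if y: "\<bar>s y - r\<bar> < d/2" for y
      proof -
        have "\<forall>\<^sub>F n in sequentially. dist (s (u (r' n))) r < d/2"
          using tendstoD[OF lim, of "d/2"] d by simp
        moreover have "\<forall>\<^sub>F n in sequentially. dist ((u \<circ> r') n) x < e/2"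
          using tendstoD[OF x(2), of "e/2"] e by simp
        ultimately have "\<forall>\<^sub>F n in sequentially. dist (s (u (r' n))) r < d/2 \<and> dist ((u \<circ> r') n) x < e/2"
          by (rule eventually_conj)
        then obtain n where n: "dist (s (u (r' n))) r < d/2" "dist (u (r' n)) x < e/2"
          by (auto simp: eventually_sequentially)
        have "\<bar>s (u (r' n)) - s y\<bar> < d" using n(1) y unfolding dist_real_def by linarith
        then have "dist (u (r' n)) y < e/2" by (rule d(2))
        then show ?thesis using n(2) dist_triangle_half_r by blast
      qed
      then show "\<exists>d>0. \<forall>y. \<bar>s y - r\<bar> < d \<longrightarrow> dist x y < e"
        using d(1) by (intro exI[of _ "d/2"]) auto
    qed
    then show ?thesis by blast
  qed
  define h where "h r = (SOME x. P r x)" for r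
  have h: "P r (h r)" if "r \<in> K" for r unfolding h_def by (rule someI_ex) (rule ex[OF that])
  show thesis
  proof (rule that[of s K h])
    show "closed K" by (simp add: K_def)
    show sK: "s x \<in> K" for x unfolding K_def using closure_subset[of "range s"] by blast
    show "h (s x) = x" for x
    proof -
      have "dist (h (s x)) x < e" if "e > 0" for e
        using h[OF sK] that unfolding P_def by (metis abs_zero diff_self)
      then show ?thesis by (metis dist_nz less_irrefl)
    qed
    show "continuous_on K h"
      unfolding continuous_on_iff
    proof (intro ballI allI impI)
      fix r and e :: real assume r: "r \<in> K" and e: "e > 0"
      obtain d where d: "d > 0" "\<And>y. \<bar>s y - r\<bar> < d \<Longrightarrow> dist (h r) y < e/2"
        using h[OF r] e unfolding P_def by (meson half_gt_zero)
      have "dist (h r') (h r) < e" if r': "r' \<in> K" "dist r' r < d/2" for r'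
      proof -
        obtain d' where d': "d' > 0" "\<And>y. \<bar>s y - r'\<bar> < d' \<Longrightarrow> dist (h r') y < e/2"
          using h[OF r'(1)] e unfolding P_def by (meson half_gt_zero)
        have "min d' (d/2) > 0" using d d' by simp
        then obtain q where "q \<in> range s" "dist q r' < min d' (d/2)"
          using r'(1) unfolding K_def closure_approachable by blast
        then obtain y where y: "dist (s y) r' < min d' (d/2)" by blast
        have "dist (h r') y < e/2" using y d'(2)[of y] by (simp add: dist_real_def)
        moreover have "\<bar>s y - r\<bar> < d" using y r'(2) unfolding dist_real_def by linarith
        then have "dist (h r) y < e/2" by (rule d(2))
        ultimately show ?thesis using dist_triangle_half_l by blast
      qed
      then show "\<exists>d>0. \<forall>x'\<in>K. dist x' r < d \<longrightarrow> dist (h x') (h r) < e"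
        using d(1) by (intro exI[of _ "d/2"]) auto
    qed
  qed (use s in auto)
qed

section \<open>Weak sequential compactness of the Borel probability measures\<close>

lemma borel_probsD:
  assumes "\<mu> \<in> borel_probs"
  shows "prob_space \<mu>" "sets \<mu> = sets borel" "space \<mu> = UNIV"
  using assms sets_eq_imp_space_eq[of \<mu> borel] by (auto simp: borel_probs_def)

lemma borel_probs_measurable:
  assumes "\<mu> \<in> borel_probs" "g \<in> measurable borel N"
  shows "g \<in> measurable \<mu> N"
  using assms measurable_cong_sets[OF borel_probsD(2) refl] by blast

lemma compact_continuous_bounded:
  fixes \<phi> :: "'a::metric_space \<Rightarrow> real"
  assumes "compact (UNIV :: 'a set)" "continuous_on UNIV \<phi>"
  obtains B where "B \<ge> 0" "\<And>x. \<bar>\<phi> x\<bar> \<le> B"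
proof -
  have "bounded (range \<phi>)"
    using assms compact_continuous_image compact_imp_bounded by blast
  then obtain B where "\<forall>y\<in>range \<phi>. norm y \<le> B" unfolding bounded_iff by blast
  then have "\<bar>\<phi> x\<bar> \<le> B" for x by simp
  moreover from this have "B \<ge> 0" by (meson abs_ge_zero order_trans)
  ultimately show thesis using that by blast
qed

lemma integrable_bounded_borel:
  fixes \<phi> :: "'a::topological_space \<Rightarrow> real"
  assumes "\<mu> \<in> borel_probs" "\<phi> \<in> borel_measurable borel" "\<And>x. \<bar>\<phi> x\<bar> \<le> B"
  shows "integrable \<mu> \<phi>"
proof -
  interpret prob_space \<mu> using borel_probsD[OF assms(1)] by simp
  have "\<phi> \<in> borel_measurable \<mu>"
    by (rule borel_probs_measurable[OF assms(1,2)])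
  then show ?thesis
    using assms(3) by (intro integrable_const_bound[of _ B]) auto
qed

text \<open>Measures are coded as measures on a compact interval, where Helly's selection theorem
  applies. The decoding map is continuous on a closed set that carries the limit law, so it
  transports the limit back.\<close>

theorem borel_probs_weakly_seq_compact:
  fixes \<mu> :: "nat \<Rightarrow> 'a::metric_space measure"
  assumes comp: "compact (UNIV :: 'a set)" and \<mu>: "\<And>n. \<mu> n \<in> borel_probs"
  shows "\<exists>r. strict_mono r \<and> (\<exists>\<nu>\<in>borel_probs. \<forall>\<phi> :: 'a \<Rightarrow> real. continuous_on UNIV \<phi> \<longrightarrow>
    (\<lambda>n. \<integral>x. \<phi> x \<partial>\<mu> (r n)) \<longlonglongrightarrow> (\<integral>x. \<phi> x \<partial>\<nu>))"
proof -
  obtain s :: "'a \<Rightarrow> real" and h :: "real \<Rightarrow> 'a" and K where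
    s: "s \<in> borel_measurable borel" "\<And>x. 0 \<le> s x \<and> s x \<le> 2"
    and K: "closed K" "continuous_on K h" and sK: "\<And>x. s x \<in> K" and hs: "\<And>x. h (s x) = x"
    using compact_real_decode[OF comp] by metis
  have sm: "s \<in> measurable (\<mu> n) borel" for n
    by (rule borel_probs_measurable[OF \<mu> s(1)])
  define M where "M n = distr (\<mu> n) borel s" for n
  have rd: "real_distribution (M n)" for n
  proof -
    interpret prob_space "\<mu> n" using borel_probsD[OF \<mu>] by simp
    show ?thesis unfolding M_def by (rule real_distribution_distr[OF sm])
  qed
  have int: "(\<integral>y. \<psi> y \<partial>M n) = (\<integral>x. \<psi> (s x) \<partial>\<mu> n)" if "\<psi> \<in> borel_measurable borel"
    for \<psi> :: "real \<Rightarrow> real" and n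
    unfolding M_def by (rule integral_distr[OF sm that])
  have "tight M"
    unfolding tight_def
  proof (intro conjI allI impI rd)
    fix e :: real assume "e > 0"
    have "measure (M n) {-1<..3} = 1" for n
    proof -
      interpret prob_space "\<mu> n" using borel_probsD[OF \<mu>] by simp
      have "s -` {-1<..3} \<inter> space (\<mu> n) = space (\<mu> n)" 
      proof -
        have "-1 < s x \<and> s x \<le> 3" for x using s(2)[of x] by auto
        then show ?thesis by auto
      qed
      then show ?thesis unfolding M_def by (simp add: measure_distr[OF sm] prob_space)
    qed
    then show "\<exists>a b. a < b \<and> (\<forall>n. 1 - e < measure (M n) {a<..b})"
      using \<open>e > 0\<close> by (intro exI[of _ "-1"] exI[of _ 3]) auto
  qed
  then obtain r L where r: "strict_mono r" and L: "real_distribution L" "weak_conv_m (M \<circ> id \<circ> r) L"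
    using tight_imp_convergent_subsubsequence[of M id] by (auto simp: strict_mono_id)
  have conv: "(\<lambda>n. \<integral>y. \<psi> y \<partial>M (r n)) \<longlonglongrightarrow> (\<integral>y. \<psi> y \<partial>L)"
    if "continuous_on UNIV \<psi>" "\<And>y. \<bar>\<psi> y\<bar> \<le> B" for \<psi> :: "real \<Rightarrow> real" and B
    using weak_conv_imp_integral_bdd_continuous_conv[of "M \<circ> id \<circ> r" L \<psi> B] rd L that
    by (simp add: o_def continuous_on_eq_continuous_at)
  interpret L: real_distribution L by fact
  have "K \<noteq> {}" using sK by blast
  have AEK: "AE y in L. y \<in> K"
  proof -
    define \<psi> where "\<psi> y = min 1 (infdist y K)" for y
    have c: "continuous_on UNIV \<psi>" unfolding \<psi>_def by (intro continuous_intros)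
    have b: "\<bar>\<psi> y\<bar> \<le> 1" for y using infdist_nonneg[of y K] by (auto simp: \<psi>_def)
    have "\<psi> (s x) = 0" for x using sK by (simp add: \<psi>_def)
    then have "(\<integral>y. \<psi> y \<partial>M n) = 0" for n
      using int[OF borel_measurable_continuous_onI[OF c]] by simp
    then have "(\<integral>y. \<psi> y \<partial>L) = 0" using conv[OF c b] by (simp add: LIMSEQ_const_iff)
    moreover have "integrable L \<psi>"
      using borel_measurable_continuous_onI[OF c] b by (intro L.integrable_const_bound[of _ 1]) auto
    moreover have "\<psi> y \<ge> 0" for y using infdist_nonneg[of y K] by (auto simp: \<psi>_def)
    ultimately have "AE y in L. \<psi> y = 0"
      using integral_nonneg_eq_0_iff_AE[of L \<psi>] by simp
    then show ?thesis
    proof (eventually_elim)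
      case (elim y)
      then have "infdist y K = 0" unfolding \<psi>_def by linarith
      then show ?case using in_closed_iff_infdist_zero[OF K(1) \<open>K \<noteq> {}\<close>] by simp
    qed
  qed
  define h' where "h' y = (if y \<in> K then h y else undefined)" for y
  have h'm: "h' \<in> measurable borel borel"
    unfolding h'_def[abs_def] using K
    by (intro borel_measurable_continuous_on_if) auto
  then have h'L: "h' \<in> measurable L borel" by simp
  define \<nu> where "\<nu> = distr L borel h'"
  show ?thesis
  proof (intro exI[of _ r] conjI bexI[of _ \<nu>] allI impI)
    show "strict_mono r" by fact
    show "\<nu> \<in> borel_probs"
      unfolding borel_probs_def \<nu>_def using L.prob_space_distr[OF h'L] by simp
    fix \<phi> :: "'a \<Rightarrow> real" assume \<phi>: "continuous_on UNIV \<phi>"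
    obtain B where B: "B \<ge> 0" "\<And>x. \<bar>\<phi> x\<bar> \<le> B" using compact_continuous_bounded[OF comp \<phi>] by blast
    have "continuous_on K (\<phi> \<circ> h)"
      using K(2) \<phi> by (meson continuous_on_compose continuous_on_subset subset_UNIV)
    then obtain \<psi> where \<psi>: "continuous_on UNIV \<psi>" "\<And>y. y \<in> K \<Longrightarrow> \<psi> y = (\<phi> \<circ> h) y" "\<And>y. norm (\<psi> y) \<le> B"
      using Tietze[of K "\<phi> \<circ> h" UNIV B] K(1) B by auto
    have \<psi>m: "\<psi> \<in> borel_measurable borel" using \<psi>(1) by (rule borel_measurable_continuous_onI)
    have \<phi>m: "\<phi> \<in> borel_measurable borel" using \<phi> by (rule borel_measurable_continuous_onI)
    have "(\<lambda>n. \<integral>y. \<psi> y \<partial>M (r n)) \<longlonglongrightarrow> (\<integral>y. \<psi> y \<partial>L)"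
      using \<psi>(3) by (intro conv[OF \<psi>(1), of B]) simp
    moreover have "(\<integral>y. \<psi> y \<partial>M (r n)) = (\<integral>x. \<phi> x \<partial>\<mu> (r n))" for n
      using int[OF \<psi>m] \<psi>(2)[OF sK] hs by simp
    moreover have "(\<integral>y. \<psi> y \<partial>L) = (\<integral>x. \<phi> x \<partial>\<nu>)"
    proof -
      have "(\<integral>x. \<phi> x \<partial>\<nu>) = (\<integral>y. \<phi> (h' y) \<partial>L)"
        unfolding \<nu>_def by (rule integral_distr[OF h'L \<phi>m])
      also have "\<dots> = (\<integral>y. \<psi> y \<partial>L)"
      proof (rule integral_cong_AE)
        show "(\<lambda>y. \<phi> (h' y)) \<in> borel_measurable L" using measurable_compose[OF h'L \<phi>m] .
        show "\<psi> \<in> borel_measurable L" using \<psi>m by simp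
        show "AE y in L. \<phi> (h' y) = \<psi> y" using AEK by eventually_elim (simp add: \<psi>(2) h'_def)
      qed
      finally show ?thesis by simp
    qed
    ultimately show "(\<lambda>n. \<integral>x. \<phi> x \<partial>\<mu> (r n)) \<longlonglongrightarrow> (\<integral>x. \<phi> x \<partial>\<nu>)" by simp
  qed
qed

section \<open>Birkhoff averages and accumulation points of empirical measures\<close>

definition birkhoff_average :: "('a \<Rightarrow> 'a) \<Rightarrow> ('a \<Rightarrow> real) \<Rightarrow> nat \<Rightarrow> 'a \<Rightarrow> real" where
  "birkhoff_average T \<phi> n x = (\<Sum>i<n. \<phi> ((T ^^ i) x)) / real n"

lemma birkhoff_average_bound:
  assumes "\<And>x. \<bar>\<phi> x\<bar> \<le> B" "B \<ge> 0"
  shows "\<bar>birkhoff_average T \<phi> n x\<bar> \<le> B"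
proof -
  have "\<bar>\<Sum>i<n. \<phi> ((T ^^ i) x)\<bar> \<le> (\<Sum>i<n. \<bar>\<phi> ((T ^^ i) x)\<bar>)" by (rule sum_abs)
  also have "\<dots> \<le> (\<Sum>i<n. B)" by (intro sum_mono assms)
  finally have "\<bar>\<Sum>i<n. \<phi> ((T ^^ i) x)\<bar> \<le> real n * B" by simp
  then show ?thesis unfolding birkhoff_average_def
    using assms(2) by (cases "n = 0") (auto simp: field_simps)
qed

lemma birkhoff_average_shift:
  assumes "\<And>x. \<bar>\<phi> x\<bar> \<le> B"
  shows "\<bar>birkhoff_average T \<phi> n (T x) - birkhoff_average T \<phi> n x\<bar> \<le> 2 * B / real n"
proof -
  have "(\<Sum>i<n. \<phi> ((T ^^ i) (T x))) = (\<Sum>i<n. \<phi> ((T ^^ Suc i) x))"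
    by (simp add: funpow_swap1)
  then have "(\<Sum>i<n. \<phi> ((T ^^ i) (T x))) - (\<Sum>i<n. \<phi> ((T ^^ i) x)) = \<phi> ((T ^^ n) x) - \<phi> x"
    using sum_lessThan_telescope[of "\<lambda>i. \<phi> ((T ^^ i) x)" n] by (simp add: sum_subtractf)
  moreover have "\<bar>\<phi> ((T ^^ n) x) - \<phi> x\<bar> \<le> 2 * B"
    using assms[of "(T ^^ n) x"] assms[of x] by linarith
  ultimately show ?thesis
    unfolding birkhoff_average_def by (simp add: diff_divide_distrib[symmetric] divide_right_mono)
qed

lemma birkhoff_average_comp: "birkhoff_average T (\<lambda>x. \<phi> (T x)) n x = birkhoff_average T \<phi> n (T x)"
  by (simp add: birkhoff_average_def funpow_swap1)

lemma birkhoff_average_diff: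
  "birkhoff_average T (\<lambda>x. \<phi> x - \<psi> x) n x = birkhoff_average T \<phi> n x - birkhoff_average T \<psi> n x"
  by (simp add: birkhoff_average_def sum_subtractf diff_divide_distrib)

lemma borel_measurable_funpow:
  fixes T :: "'a::topological_space \<Rightarrow> 'a"
  assumes "T \<in> measurable borel borel"
  shows "(\<lambda>x. (T ^^ n) x) \<in> measurable borel borel"
proof (induction n)
  case (Suc n)
  then show ?case using measurable_comp[OF _ assms, of "T ^^ n" borel] by (simp add: o_def)
qed simp

text \<open>Suitability of \<open>f\<close> makes \<open>rho f\<close> a metric for the weak* topology; in particular a Borel
  probability measure is determined by the integrals of the functions \<open>f i\<close> with \<open>i \<ge> 1\<close>.\<close>

locale compact_system =
  fixes T :: "'a::metric_space \<Rightarrow> 'a" and f :: "nat \<Rightarrow> 'a \<Rightarrow>\<^sub>C real"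
  assumes dynamical: "dynamical_system T" and suitable: "suitable f"
begin

abbreviation "avg \<equiv> birkhoff_average T"
abbreviation "emp \<equiv> empirical_measure T"

lemma comp: "compact (UNIV :: 'a set)" and contT: "continuous_on UNIV T"
  using dynamical by (auto simp: dynamical_system_def)

lemma cont_iter: "continuous_on UNIV (\<lambda>x. (T ^^ n) x)"
proof (induction n)
  case (Suc n)
  then show ?case using continuous_on_compose2[OF contT Suc] by simp
qed simp

lemma measT: "T \<in> measurable borel borel"
  using contT by (rule borel_measurable_continuous_onI)

lemma cont_avg:
  assumes "continuous_on UNIV \<phi>" shows "continuous_on UNIV (avg \<phi> n)"
proof -
  have "continuous_on UNIV (\<lambda>x. \<phi> ((T ^^ i) x))" for i
    by (rule continuous_on_compose2[OF assms cont_iter]) simp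
  then show ?thesis unfolding birkhoff_average_def[abs_def] divide_inverse
    by (intro continuous_intros)
qed

lemma cont_f: "continuous_on UNIV (\<lambda>x. f i x)"
  using apply_bcontfun[of "f i"] by (auto simp: bcontfun_def)

lemma f_le1: "i \<ge> 1 \<Longrightarrow> \<bar>f i x\<bar> \<le> 1"
  using norm_bounded[of "f i" x] suitable by (auto simp: suitable_def)

lemma integrable_cont:
  assumes "\<mu> \<in> borel_probs" "continuous_on UNIV (\<phi> :: 'a \<Rightarrow> real)"
  shows "integrable \<mu> \<phi>"
proof -
  obtain B where "\<And>x. \<bar>\<phi> x\<bar> \<le> B" using compact_continuous_bounded[OF comp assms(2)] by blast
  then show ?thesis
    using integrable_bounded_borel[OF assms(1) borel_measurable_continuous_onI[OF assms(2)]] by blast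
qed

lemma integral_abs_le:
  assumes "\<mu> \<in> borel_probs" "continuous_on UNIV (\<phi> :: 'a \<Rightarrow> real)" "\<And>x. \<bar>\<phi> x\<bar> \<le> B"
  shows "\<bar>\<integral>x. \<phi> x \<partial>\<mu>\<bar> \<le> B"
proof -
  interpret prob_space \<mu> using borel_probsD[OF assms(1)] by simp
  have i: "integrable \<mu> \<phi>" by (rule integrable_cont[OF assms(1,2)])
  have "(\<integral>x. \<phi> x \<partial>\<mu>) \<le> (\<integral>x. B \<partial>\<mu>)"
    using assms(3) by (intro integral_mono i) (auto simp: abs_le_iff)
  moreover have "(\<integral>x. -B \<partial>\<mu>) \<le> (\<integral>x. \<phi> x \<partial>\<mu>)"
    using assms(3) by (intro integral_mono i) (auto simp: abs_le_iff minus_le_iff)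
  ultimately show ?thesis by (simp add: prob_space)
qed

lemma empirical_borel_prob: "n \<ge> 1 \<Longrightarrow> emp x n \<in> borel_probs"
  unfolding borel_probs_def empirical_measure_def
  by (auto intro!: prob_space.prob_space_distr prob_space_uniform_count_measure
      simp: lessThan_empty_iff)

lemma integral_empirical:
  assumes "\<phi> \<in> borel_measurable borel" "n \<ge> 1"
  shows "(\<integral>y. \<phi> y \<partial>emp x n) = avg \<phi> n x"
proof -
  have "(\<integral>y. \<phi> y \<partial>emp x n) = (\<integral>i. \<phi> ((T ^^ i) x) \<partial>uniform_count_measure {..<n})"
    unfolding empirical_measure_def by (rule integral_distr[OF _ assms(1)]) simp
  also have "\<dots> = avg \<phi> n x"
    by (subst integral_uniform_count_measure) (auto simp: birkhoff_average_def)
  finally show ?thesis .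
qed

sublocale rho: Metric_space "borel_probs :: 'a measure set" "rho f"
  using suitable by (simp add: suitable_def)

lemma openin_weak_star_iff:
  "openin weak_star_topology U \<longleftrightarrow>
    U \<subseteq> borel_probs \<and> (\<forall>\<mu>\<in>U. \<exists>d>0. \<forall>\<nu>\<in>borel_probs. rho f \<mu> \<nu> < d \<longrightarrow> \<nu> \<in> U)"
proof -
  have "weak_star_topology = rho.mtopology" using suitable by (simp add: suitable_def)
  then show ?thesis
    unfolding \<open>weak_star_topology = rho.mtopology\<close> rho.openin_mtopology by (fastforce simp: subset_iff)
qed

text \<open>Each integral is at most 1 in absolute value, so the terms beyond \<open>K\<close> add up to at most
  \<open>2 * (1/2) ^ K\<close>.\<close>

lemma rho_le:
  assumes "\<mu> \<in> borel_probs" "\<nu> \<in> borel_probs" "\<delta> \<ge> 0"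
    and close: "\<And>i. 1 \<le> i \<Longrightarrow> i \<le> K \<Longrightarrow> \<bar>(\<integral>x. f i x \<partial>\<mu>) - (\<integral>x. f i x \<partial>\<nu>)\<bar> \<le> \<delta>"
  shows "rho f \<mu> \<nu> \<le> \<delta> + 2 * (1/2) ^ K"
proof -
  define t where "t i = (1 / 2) ^ i * \<bar>(\<integral>x. f i x \<partial>\<mu>) - (\<integral>x. f i x \<partial>\<nu>)\<bar>" for i :: nat
  define u where "u j = (1/2) ^ Suc j * \<delta> + (if j \<ge> K then 2 * (1/2) ^ Suc j else 0)" for j :: nat
  have g: "(\<lambda>j. (1/2) ^ Suc j :: real) sums 1" by (rule power_half_series)
  have g2: "(\<lambda>j. 2 * (1/2) ^ Suc (j + K) :: real) sums (2 * (1/2) ^ K)"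
  proof -
    have "(\<lambda>j. 2 * (1/2) ^ K * (1/2) ^ Suc j :: real) sums (2 * (1/2) ^ K * 1)"
      by (rule sums_mult[OF g])
    then show ?thesis by (simp add: power_add mult.assoc mult.commute)
  qed
  have "(\<lambda>j. if j \<ge> K then 2 * (1/2) ^ Suc j else 0 :: real) sums (2 * (1/2) ^ K)"
    using g2 by (subst sums_iff_shift'[of _ K, symmetric]) auto
  then have us: "u sums (\<delta> + 2 * (1/2) ^ K)"
    unfolding u_def using sums_add[OF sums_mult2[OF g, of \<delta>]] by simp
  have le: "t (Suc j) \<le> u j" for j
  proof (cases "j < K")
    case True
    then have "\<bar>(\<integral>x. f (Suc j) x \<partial>\<mu>) - (\<integral>x. f (Suc j) x \<partial>\<nu>)\<bar> \<le> \<delta>" by (intro close) auto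
    then show ?thesis unfolding t_def u_def using True by (simp add: mult_left_mono)
  next
    case False
    have "\<bar>\<integral>x. f (Suc j) x \<partial>\<mu>\<bar> \<le> 1" "\<bar>\<integral>x. f (Suc j) x \<partial>\<nu>\<bar> \<le> 1"
      by (intro integral_abs_le assms cont_f f_le1; simp)+
    then have "\<bar>(\<integral>x. f (Suc j) x \<partial>\<mu>) - (\<integral>x. f (Suc j) x \<partial>\<nu>)\<bar> \<le> 2" by linarith
    then have "t (Suc j) \<le> (1/2) ^ Suc j * 2" unfolding t_def by (intro mult_left_mono) auto
    then show ?thesis unfolding u_def using False assms(3) by (simp add: add_increasing)
  qed
  have tnn: "t i \<ge> 0" for i by (simp add: t_def)
  have ts: "summable (\<lambda>j. t (Suc j))"
  proof (rule summable_comparison_test'[OF sums_summable[OF us]])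
    show "norm (t (Suc j)) \<le> u j" for j using le[of j] tnn[of "Suc j"] by (metis abs_of_nonneg real_norm_def)
  qed
  have hs: "((\<lambda>j. t (Suc j)) has_sum (\<Sum>j. t (Suc j))) UNIV"
    by (rule sums_nonneg_imp_has_sum[OF summable_sums[OF ts] tnn])
  have "{1..} = range Suc"
  proof -
    have "i \<in> range Suc" if "1 \<le> i" for i using that by (cases i) auto
    then show ?thesis by auto
  qed
  then have "rho f \<mu> \<nu> = infsum t (range Suc)" by (simp add: rho_def t_def[abs_def])
  also have "\<dots> = infsum (\<lambda>j. t (Suc j)) UNIV" by (subst infsum_reindex) (auto simp: o_def)
  also have "\<dots> = (\<Sum>j. t (Suc j))" by (rule infsumI[OF hs])
  also have "\<dots> \<le> suminf u" by (rule suminf_le[OF le ts sums_summable[OF us]])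
  also have "suminf u = \<delta> + 2 * (1/2) ^ K" using us by (rule sums_unique[symmetric])
  finally show ?thesis .
qed

definition tests_control_rho :: "nat \<Rightarrow> real \<Rightarrow> real \<Rightarrow> bool" where
  "tests_control_rho K \<delta> \<epsilon> \<longleftrightarrow> (\<forall>\<mu>\<in>borel_probs. \<forall>\<nu>\<in>borel_probs.
    (\<forall>i. 1 \<le> i \<and> i \<le> K \<longrightarrow> \<bar>(\<integral>x. f i x \<partial>\<mu>) - (\<integral>x. f i x \<partial>\<nu>)\<bar> \<le> \<delta>) \<longrightarrow> rho f \<mu> \<nu> < \<epsilon>)"

text \<open>Hence finitely many test integrals control the metric up to any prescribed error.\<close>

lemma rho_small:
  assumes "\<epsilon> > 0"
  shows "\<exists>K. \<exists>\<delta>>0. tests_control_rho K \<delta> \<epsilon>"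
proof -
  obtain K where K: "(1/2::real) ^ K < \<epsilon> / 4"
    using real_arch_pow_inv[of "\<epsilon>/4" "1/2"] assms by auto
  have "rho f \<mu> \<nu> < \<epsilon>" if "\<mu> \<in> borel_probs" "\<nu> \<in> borel_probs"
    "\<forall>i. 1 \<le> i \<and> i \<le> K \<longrightarrow> \<bar>(\<integral>x. f i x \<partial>\<mu>) - (\<integral>x. f i x \<partial>\<nu>)\<bar> \<le> \<epsilon>/4" for \<mu> \<nu>
  proof -
    have "rho f \<mu> \<nu> \<le> \<epsilon>/4 + 2 * (1/2) ^ K" using that assms by (intro rho_le) auto
    also have "\<dots> < \<epsilon>/4 + 2 * (\<epsilon>/4)" using K by (intro add_strict_left_mono mult_strict_left_mono) auto
    finally show ?thesis using assms by linarith
  qed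
  then show ?thesis using assms by (intro exI[of _ K] exI[of _ "\<epsilon>/4"]) (auto simp: tests_control_rho_def)
qed

lemma measure_eqI_f:
  assumes "\<mu> \<in> borel_probs" "\<nu> \<in> borel_probs"
    "\<And>i. 1 \<le> i \<Longrightarrow> (\<integral>x. f i x \<partial>\<mu>) = (\<integral>x. f i x \<partial>\<nu>)"
  shows "\<mu> = \<nu>"
proof -
  have "rho f \<mu> \<nu> < e" if e: "e > 0" for e
  proof -
    obtain K \<delta> where \<delta>: "\<delta> > 0" and ctl: "tests_control_rho K \<delta> e"
      using rho_small[OF e] by blast
    note * = ctl[unfolded tests_control_rho_def]
    then show ?thesis using assms \<delta> by simp
  qed
  from this[of "rho f \<mu> \<nu>"] have "rho f \<mu> \<nu> = 0"
    using rho.nonneg[of \<mu> \<nu>] by (cases "rho f \<mu> \<nu> > 0") (simp, linarith)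
  then show ?thesis using rho.zero[OF assms(1,2)] by simp
qed

lemma invariant_measuresI_f:
  assumes \<nu>: "\<nu> \<in> borel_probs" and eq: "\<And>i. (\<integral>x. f i (T x) \<partial>\<nu>) = (\<integral>x. f i x \<partial>\<nu>)"
  shows "\<nu> \<in> invariant_measures T"
proof -
  have Tm: "T \<in> measurable \<nu> borel"
    by (rule borel_probs_measurable[OF \<nu> measT])
  have "(\<integral>x. f i x \<partial>distr \<nu> borel T) = (\<integral>x. f i x \<partial>\<nu>)" for i
    using integral_distr[OF Tm borel_measurable_continuous_onI[OF cont_f]] eq by simp
  moreover have "distr \<nu> borel T \<in> borel_probs"
    using prob_space.prob_space_distr[OF borel_probsD(1)[OF \<nu>] Tm] by (simp add: borel_probs_def)
  ultimately show ?thesis using measure_eqI_f \<nu> by (simp add: invariant_measures_def)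
qed

lemma rho_tendsto_0:
  assumes \<nu>: "\<nu> \<in> borel_probs" and \<mu>: "\<And>n. \<mu> n \<in> borel_probs"
    and lim: "\<And>i. i \<ge> 1 \<Longrightarrow> (\<lambda>n. \<integral>x. f i x \<partial>\<mu> n) \<longlonglongrightarrow> (\<integral>x. f i x \<partial>\<nu>)"
    and "\<epsilon> > 0"
  shows "\<forall>\<^sub>F n in sequentially. rho f \<nu> (\<mu> n) < \<epsilon>"
proof -
  obtain K \<delta> where \<delta>: "\<delta> > 0" and ctl: "tests_control_rho K \<delta> \<epsilon>"
      using rho_small[OF \<open>\<epsilon> > 0\<close>] by blast
    note * = ctl[unfolded tests_control_rho_def]
  have "\<forall>\<^sub>F n in sequentially. \<forall>i\<in>{1..K}. \<bar>(\<integral>x. f i x \<partial>\<nu>) - (\<integral>x. f i x \<partial>\<mu> n)\<bar> < \<delta>"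
  proof (intro eventually_ball_finite ballI)
    fix i assume "i \<in> {1..K}"
    then have "\<forall>\<^sub>F n in sequentially. dist (\<integral>x. f i x \<partial>\<mu> n) (\<integral>x. f i x \<partial>\<nu>) < \<delta>"
      using tendstoD[OF lim \<delta>] by auto
    then show "\<forall>\<^sub>F n in sequentially. \<bar>(\<integral>x. f i x \<partial>\<nu>) - (\<integral>x. f i x \<partial>\<mu> n)\<bar> < \<delta>"
      by (simp add: dist_real_def abs_minus_commute)
  qed simp
  then show ?thesis
  proof eventually_elim
    case (elim n)
    then show ?case using *[rule_format, OF \<nu> \<mu>] by force
  qed
qed

text \<open>Conversely, by the agreement of the two topologies, closeness in the metric controls the
  integral of every continuous function and not only of the functions \<open>f i\<close>.\<close>

lemma rho_controls_integral:
  assumes "\<nu> \<in> borel_probs" "continuous_on UNIV (\<phi> :: 'a \<Rightarrow> real)" "\<epsilon> > 0"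
  shows "\<exists>\<delta>>0. \<forall>\<mu>\<in>borel_probs. rho f \<nu> \<mu> < \<delta> \<longrightarrow>
     \<bar>(\<integral>x. \<phi> x \<partial>\<mu>) - (\<integral>x. \<phi> x \<partial>\<nu>)\<bar> < \<epsilon>"
proof -
  obtain B where "\<And>x. \<bar>\<phi> x\<bar> \<le> B" using compact_continuous_bounded[OF comp assms(2)] by blast
  then have "\<phi> \<in> bcontfun" using assms(2) by (intro bcontfun_normI[of _ B]) auto
  then have \<phi>: "apply_bcontfun (Bcontfun \<phi>) = \<phi>" by (rule Bcontfun_inverse)
  define c where "c = (\<integral>x. \<phi> x \<partial>\<nu>)"
  define U where "U = {\<mu> \<in> borel_probs. (\<integral>x. Bcontfun \<phi> x \<partial>\<mu>) \<in> ball c \<epsilon>}"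
  have "openin weak_star_topology U"
    unfolding weak_star_topology_def U_def
    by (rule topology_generated_by_Basis) (use open_ball in blast)
  moreover have "\<nu> \<in> U" using assms by (simp add: U_def \<phi> c_def)
  ultimately obtain \<delta> where "\<delta> > 0" "\<And>\<mu>. \<mu> \<in> borel_probs \<Longrightarrow> rho f \<nu> \<mu> < \<delta> \<Longrightarrow> \<mu> \<in> U"
    unfolding openin_weak_star_iff by blast
  then show ?thesis
    by (intro exI[of _ \<delta>]) (auto simp: U_def \<phi> c_def dist_real_def abs_minus_commute)
qed

lemma limit_measures_iff:
  "\<nu> \<in> limit_measures T x \<longleftrightarrow>
    \<nu> \<in> borel_probs \<and> (\<forall>\<delta>>0. \<exists>\<^sub>F n in sequentially. n \<ge> 1 \<and> rho f \<nu> (emp x n) < \<delta>)"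
proof (intro iffI conjI allI impI)
  assume a: "\<nu> \<in> limit_measures T x"
  then show \<nu>: "\<nu> \<in> borel_probs" by (simp add: limit_measures_def)
  fix \<delta> :: real assume "\<delta> > 0"
  have "openin weak_star_topology (rho.mball \<nu> \<delta>)"
    using suitable rho.openin_mball by (simp add: suitable_def)
  moreover have "\<nu> \<in> rho.mball \<nu> \<delta>" using \<nu> \<open>\<delta> > 0\<close> by simp
  ultimately have "\<exists>\<^sub>F n in sequentially. emp x n \<in> rho.mball \<nu> \<delta>"
    using a unfolding limit_measures_def by blast
  then show "\<exists>\<^sub>F n in sequentially. n \<ge> 1 \<and> rho f \<nu> (emp x n) < \<delta>"
    using eventually_ge_at_top[of 1]
    by (rule frequently_rev_mp[OF frequently_eventually_frequently]) (auto simp: rho.in_mball)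
next
  assume a: "\<nu> \<in> borel_probs \<and> (\<forall>\<delta>>0. \<exists>\<^sub>F n in sequentially. n \<ge> 1 \<and> rho f \<nu> (emp x n) < \<delta>)"
  have "\<exists>\<^sub>F n in sequentially. emp x n \<in> U" if U: "openin weak_star_topology U" "\<nu> \<in> U" for U
  proof -
    obtain d where d: "d > 0" "\<And>\<mu>. \<mu> \<in> borel_probs \<Longrightarrow> rho f \<nu> \<mu> < d \<Longrightarrow> \<mu> \<in> U"
      using U unfolding openin_weak_star_iff by blast
    have "\<exists>\<^sub>F n in sequentially. n \<ge> 1 \<and> rho f \<nu> (emp x n) < d" using a d(1) by blast
    then show ?thesis
      by (rule frequently_elim1) (use d(2) empirical_borel_prob in blast)
  qed
  then show "\<nu> \<in> limit_measures T x" using a by (simp add: limit_measures_def)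
qed

lemma frequently_subseq:
  assumes "\<exists>\<^sub>F n in sequentially. P n"
  shows "\<exists>r :: nat \<Rightarrow> nat. strict_mono r \<and> (\<forall>k. P (r k))"
proof -
  have inf: "infinite {n. P n}"
    using assms by (simp add: frequently_cofinite[symmetric] cofinite_eq_sequentially)
  show ?thesis
    using strict_mono_enumerate[OF inf] enumerate_in_set[OF inf]
    by (intro exI[of _ "enumerate {n. P n}"]) auto
qed

text \<open>Infinitely many prescribed times always carry an accumulation point, by weak sequential
  compactness.\<close>

lemma limit_measure_along:
  assumes "\<exists>\<^sub>F n in sequentially. P n"
  shows "\<exists>\<nu>\<in>limit_measures T x. \<exists>r. strict_mono r \<and> (\<forall>k. P (r k) \<and> r k \<ge> 1) \<and>
    (\<forall>\<phi>. continuous_on UNIV \<phi> \<longrightarrow> (\<lambda>k. avg \<phi> (r k) x) \<longlonglongrightarrow> (\<integral>y. \<phi> y \<partial>\<nu>))"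
proof -
  have "\<exists>\<^sub>F n in sequentially. P n \<and> n \<ge> 1"
    using frequently_eventually_frequently[OF assms eventually_ge_at_top[of 1]] .
  then obtain r :: "nat \<Rightarrow> nat" where r: "strict_mono r" and rP: "\<forall>k. P (r k) \<and> r k \<ge> 1"
    using frequently_subseq[of "\<lambda>n. P n \<and> n \<ge> 1"] by blast
  have r1: "r k \<ge> 1" for k using rP by blast
  obtain s \<nu> where s: "strict_mono s" "\<nu> \<in> borel_probs" and lim: "\<And>\<phi> :: 'a \<Rightarrow> real. continuous_on UNIV \<phi> \<Longrightarrow>
      (\<lambda>n. \<integral>y. \<phi> y \<partial>emp x (r (s n))) \<longlonglongrightarrow> (\<integral>y. \<phi> y \<partial>\<nu>)"
    using borel_probs_weakly_seq_compact[OF comp, of "\<lambda>k. emp x (r k)"] empirical_borel_prob[OF r1]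
    by blast
  have sm: "strict_mono (r \<circ> s)" using r s(1) by (rule strict_mono_o)
  have rs1: "(r \<circ> s) k \<ge> 1" for k using r1 by simp
  have "\<exists>\<^sub>F n in sequentially. n \<ge> 1 \<and> rho f \<nu> (emp x n) < \<delta>" if "\<delta> > 0" for \<delta>
  proof -
    have "\<forall>\<^sub>F k in sequentially. rho f \<nu> (emp x ((r \<circ> s) k)) < \<delta>"
      using lim[OF cont_f] empirical_borel_prob[OF rs1]
      by (intro rho_tendsto_0[OF s(2) _ _ that]) auto
    then obtain k0 where k0: "\<And>k. k \<ge> k0 \<Longrightarrow> rho f \<nu> (emp x ((r \<circ> s) k)) < \<delta>"
      by (auto simp: eventually_sequentially)
    show ?thesis unfolding frequently_sequentially
    proof
      fix m
      have "m \<le> (r \<circ> s) (max m k0)" using seq_suble[OF sm, of "max m k0"] by simp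
      then show "\<exists>n\<ge>m. n \<ge> 1 \<and> rho f \<nu> (emp x n) < \<delta>"
        using k0[of "max m k0"] rs1 by (intro exI[of _ "(r \<circ> s) (max m k0)"]) auto
    qed
  qed
  then have "\<nu> \<in> limit_measures T x" using s(2) limit_measures_iff by blast
  moreover have "(\<lambda>k. avg \<phi> ((r \<circ> s) k) x) \<longlonglongrightarrow> (\<integral>y. \<phi> y \<partial>\<nu>)" if "continuous_on UNIV \<phi>" for \<phi>
    using lim[OF that] integral_empirical[OF borel_measurable_continuous_onI[OF that] r1] by simp
  ultimately show ?thesis
    using sm rP rs1 by (intro bexI[of _ \<nu>] exI[of _ "r \<circ> s"]) auto
qed

lemma limit_measures_nonempty: "limit_measures T x \<noteq> {}"
proof -
  have "\<exists>\<^sub>F n in sequentially. True" by simp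
  then show ?thesis using limit_measure_along[of "\<lambda>_. True" x] by blast
qed

text \<open>Averages of \<open>\<phi> \<circ> T - \<phi>\<close> telescope to something of order \<open>1/n\<close>, hence integrate to 0 in the
  limit.\<close>

lemma limit_measure_invariant:
  assumes \<nu>: "\<nu> \<in> limit_measures T x"
  shows "\<nu> \<in> invariant_measures T"
proof -
  have bp: "\<nu> \<in> borel_probs" using \<nu> by (simp add: limit_measures_iff)
  have "(\<integral>y. \<phi> (T y) \<partial>\<nu>) = (\<integral>y. \<phi> y \<partial>\<nu>)" if \<phi>: "continuous_on UNIV \<phi>" for \<phi> :: "'a \<Rightarrow> real"
  proof -
    obtain B where B: "\<And>x. \<bar>\<phi> x\<bar> \<le> B" "B \<ge> 0" using compact_continuous_bounded[OF comp \<phi>] by blast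
    have cT: "continuous_on UNIV (\<lambda>y. \<phi> (T y))" by (rule continuous_on_compose2[OF \<phi> contT]) simp
    define \<psi> where "\<psi> y = \<phi> (T y) - \<phi> y" for y
    have c\<psi>: "continuous_on UNIV \<psi>" unfolding \<psi>_def by (intro continuous_intros cT \<phi>)
    have "\<bar>\<integral>y. \<psi> y \<partial>\<nu>\<bar> < e" if "e > 0" for e
    proof -
      obtain \<delta> where \<delta>: "\<delta> > 0" "\<forall>\<mu>\<in>borel_probs. rho f \<nu> \<mu> < \<delta> \<longrightarrow>
         \<bar>(\<integral>x. \<psi> x \<partial>\<mu>) - (\<integral>x. \<psi> x \<partial>\<nu>)\<bar> < e/2"
        using rho_controls_integral[OF bp c\<psi>, of "e/2"] \<open>e > 0\<close> by auto
      have "\<exists>\<^sub>F n in sequentially. n \<ge> 1 \<and> rho f \<nu> (emp x n) < \<delta>"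
        using \<nu> \<delta>(1) limit_measures_iff by blast
      then obtain n where n: "n \<ge> max 1 (nat \<lceil>4 * B / e\<rceil> + 1)" "n \<ge> 1" "rho f \<nu> (emp x n) < \<delta>"
        unfolding frequently_sequentially by blast
      have "\<bar>avg \<psi> n x - (\<integral>x. \<psi> x \<partial>\<nu>)\<bar> < e/2"
        using \<delta>(2)[rule_format, OF empirical_borel_prob[OF n(2)] n(3)]
          integral_empirical[OF borel_measurable_continuous_onI[OF c\<psi>] n(2)] by simp
      moreover have "\<bar>avg \<psi> n x\<bar> \<le> 2 * B / real n"
        unfolding \<psi>_def birkhoff_average_diff birkhoff_average_comp
        by (rule birkhoff_average_shift[OF B(1)])
      moreover have "2 * B / real n \<le> e/2"
      proof -
        have "4 * B / e \<le> real n" using n(1) by linarith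
        then show ?thesis using \<open>e > 0\<close> n(2) by (simp add: field_simps)
      qed
      ultimately show ?thesis by linarith
    qed
    then have "(\<integral>y. \<psi> y \<partial>\<nu>) = 0" by (metis abs_le_zero_iff less_irrefl not_le)
    then show ?thesis unfolding \<psi>_def
      using integrable_cont[OF bp \<phi>] integrable_cont[OF bp cT] by simp
  qed
  then show ?thesis using cont_f by (intro invariant_measuresI_f bp) auto
qed

text \<open>The empirical measures of a point and of its image differ by at most \<open>2/n\<close> on each test
  function, so accumulation points are inherited along orbits.\<close>

lemma limit_measures_image: "limit_measures T x \<subseteq> limit_measures T (T x)"
proof
  fix \<nu> assume \<nu>: "\<nu> \<in> limit_measures T x"
  then have bp: "\<nu> \<in> borel_probs" by (simp add: limit_measures_iff)
  have "\<exists>\<^sub>F n in sequentially. n \<ge> 1 \<and> rho f \<nu> (emp (T x) n) < \<epsilon>" if "\<epsilon> > 0" for \<epsilon>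
  proof -
    have "\<epsilon>/2 > 0" using that by simp
    obtain K \<delta> where \<delta>: "\<delta> > 0" and ctl: "tests_control_rho K \<delta> (\<epsilon>/2)"
      using rho_small[OF \<open>\<epsilon>/2 > 0\<close>] by blast
    note * = ctl[unfolded tests_control_rho_def]
    have freq: "\<exists>\<^sub>F n in sequentially. n \<ge> 1 \<and> rho f \<nu> (emp x n) < \<epsilon>/2"
      using \<nu> \<open>\<epsilon>/2 > 0\<close> limit_measures_iff by blast
    have ev: "\<forall>\<^sub>F n in sequentially. n \<ge> nat \<lceil>2 / \<delta>\<rceil> + 1"
      by (rule eventually_ge_at_top)
    show ?thesis
    proof (rule frequently_elim1[OF frequently_eventually_frequently[OF freq ev]])
      fix n assume n: "(n \<ge> 1 \<and> rho f \<nu> (emp x n) < \<epsilon>/2) \<and> n \<ge> nat \<lceil>2 / \<delta>\<rceil> + 1"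
      have "2 / \<delta> \<le> real n" using n by linarith
      then have "2 * 1 / real n \<le> \<delta>" using \<delta> n by (simp add: field_simps)
      moreover have "\<bar>avg (f i) n (T x) - avg (f i) n x\<bar> \<le> 2 * 1 / real n" if "1 \<le> i" for i
        by (rule birkhoff_average_shift[OF f_le1[OF that]])
      ultimately have "rho f (emp x n) (emp (T x) n) < \<epsilon>/2"
        using n by (intro *[rule_format]) (auto simp: empirical_borel_prob integral_empirical
          borel_measurable_continuous_onI[OF cont_f] abs_minus_commute intro: order_trans)
      moreover have "rho f \<nu> (emp (T x) n) \<le> rho f \<nu> (emp x n) + rho f (emp x n) (emp (T x) n)"
        using n by (intro rho.triangle bp empirical_borel_prob) auto
      ultimately show "n \<ge> 1 \<and> rho f \<nu> (emp (T x) n) < \<epsilon>" using n by linarith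
    qed
  qed
  then show "\<nu> \<in> limit_measures T (T x)" using limit_measures_iff bp by blast
qed

lemma limit_measures_orbit: "limit_measures T x \<subseteq> limit_measures T ((T ^^ n) x)"
  by (induction n) (use limit_measures_image in auto)

lemma G_setI:
  assumes "\<nu> \<in> limit_measures T x" "rho f \<mu> \<nu> \<le> \<epsilon>"
  shows "x \<in> G_set f T \<mu> \<epsilon>"
proof -
  have "(INF \<nu> \<in> limit_measures T x. rho f \<mu> \<nu>) \<le> rho f \<mu> \<nu>"
    by (rule cINF_lower[OF _ assms(1)]) (auto intro: bdd_belowI2[of _ 0])
  then show ?thesis using assms(2) by (simp add: G_set_def)
qed

lemma closure_eq_UNIV_iff:
  "closure S = (UNIV :: 'a set) \<longleftrightarrow> (\<forall>U. open U \<and> U \<noteq> {} \<longrightarrow> S \<inter> U \<noteq> {})"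
proof
  assume a: "closure S = UNIV"
  show "\<forall>U. open U \<and> U \<noteq> {} \<longrightarrow> S \<inter> U \<noteq> {}"
    using a open_Int_closure_eq_empty by (metis Int_UNIV_right Int_commute)
next
  assume a: "\<forall>U. open U \<and> U \<noteq> {} \<longrightarrow> S \<inter> U \<noteq> {}"
  have "- closure S = {}"
    using a[rule_format, of "- closure S"] closure_subset[of S] by auto
  then show "closure S = UNIV" by blast
qed

text \<open>A point with dense orbit puts all its accumulation points into \<open>M_dense f T\<close>, because
  they are accumulation points for every point of its orbit.\<close>

lemma dense_orbit_limit_measures:
  assumes dense: "closure (range (\<lambda>n. (T ^^ n) x)) = UNIV"
  shows "limit_measures T x \<subseteq> M_dense f T"
proof
  fix \<nu> assume \<nu>: "\<nu> \<in> limit_measures T x"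
  have bp: "\<nu> \<in> borel_probs" using \<nu> by (simp add: limit_measures_iff)
  have "closure (G_set f T \<nu> \<epsilon>) = UNIV" if "\<epsilon> > 0" for \<epsilon>
  proof -
    have "(T ^^ n) x \<in> G_set f T \<nu> \<epsilon>" for n
      using G_setI[of \<nu> "(T ^^ n) x" \<nu> \<epsilon>] limit_measures_orbit \<nu> bp that by auto
    then have "range (\<lambda>n. (T ^^ n) x) \<subseteq> G_set f T \<nu> \<epsilon>" by blast
    then show ?thesis using dense closure_mono by blast
  qed
  then show "\<nu> \<in> M_dense f T"
    using limit_measure_invariant[OF \<nu>] by (simp add: M_dense_def)
qed

text \<open>It suffices to approximate at infinitely many times: compactness turns them into an
  accumulation point.\<close>

lemma M_denseI:
  assumes inv: "\<mu> \<in> invariant_measures T"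
    and freq: "\<And>\<epsilon> U. \<epsilon> > 0 \<Longrightarrow> open U \<Longrightarrow> U \<noteq> {} \<Longrightarrow>
      \<exists>x\<in>U. \<exists>\<^sub>F n in sequentially. n \<ge> 1 \<and> rho f \<mu> (emp x n) < \<epsilon>"
  shows "\<mu> \<in> M_dense f T"
proof -
  have bp: "\<mu> \<in> borel_probs" using inv by (simp add: invariant_measures_def)
  have "closure (G_set f T \<mu> \<epsilon>) = UNIV" if eps: "\<epsilon> > 0" for \<epsilon>
    unfolding closure_eq_UNIV_iff
  proof (intro allI impI)
    fix U :: "'a set" assume U: "open U \<and> U \<noteq> {}"
    obtain x where x: "x \<in> U" "\<exists>\<^sub>F n in sequentially. n \<ge> 1 \<and> rho f \<mu> (emp x n) < \<epsilon>/2"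
      using freq[of "\<epsilon>/2" U] U eps by auto
    obtain \<nu> r where \<nu>: "\<nu> \<in> limit_measures T x" and r: "strict_mono r"
      "\<And>k. r k \<ge> 1 \<and> rho f \<mu> (emp x (r k)) < \<epsilon>/2"
      and lim: "\<And>\<phi>. continuous_on UNIV \<phi> \<Longrightarrow> (\<lambda>k. avg \<phi> (r k) x) \<longlonglongrightarrow> (\<integral>y. \<phi> y \<partial>\<nu>)"
      using limit_measure_along[OF x(2)] by blast
    have \<nu>bp: "\<nu> \<in> borel_probs" using \<nu> by (simp add: limit_measures_iff)
    have ebp: "emp x (r k) \<in> borel_probs" for k using r by (intro empirical_borel_prob) auto
    have "\<forall>\<^sub>F k in sequentially. rho f \<nu> (emp x (r k)) < \<epsilon>/2"
    proof (rule rho_tendsto_0[OF \<nu>bp ebp])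
      fix i :: nat
      have "(\<integral>y. f i y \<partial>emp x (r k)) = avg (f i) (r k) x" for k
        using r by (intro integral_empirical borel_measurable_continuous_onI cont_f) auto
      then show "(\<lambda>n. \<integral>y. f i y \<partial>emp x (r n)) \<longlonglongrightarrow> (\<integral>y. f i y \<partial>\<nu>)" using lim[OF cont_f] by simp
    qed (use eps in auto)
    then obtain k where k: "rho f \<nu> (emp x (r k)) < \<epsilon>/2" by (auto simp: eventually_sequentially)
    have "rho f \<mu> \<nu> \<le> rho f \<mu> (emp x (r k)) + rho f (emp x (r k)) \<nu>"
      by (intro rho.triangle bp \<nu>bp ebp)
    also have "\<dots> \<le> \<epsilon>" using k r(2)[of k] rho.commute[of \<nu>] by fastforce
    finally have "x \<in> G_set f T \<mu> \<epsilon>" using G_setI[OF \<nu>] by blast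
    then show "G_set f T \<mu> \<epsilon> \<inter> U \<noteq> {}" using x by blast
  qed
  then show ?thesis using inv by (simp add: M_dense_def)
qed

end

section \<open>Baire category and points with dense orbit\<close>

lemma Baire_compact:
  fixes U :: "nat \<Rightarrow> 'a::metric_space set"
  assumes "compact (UNIV :: 'a set)" "\<And>n. open (U n)" "\<And>n. closure (U n) = UNIV"
  shows "closure (\<Inter>n. U n) = UNIV"
proof -
  have "compact_space (euclidean :: 'a topology)"
    using assms(1) by (simp add: compact_space_def)
  then have "locally_compact_space (euclidean :: 'a topology) \<and> regular_space (euclidean :: 'a topology)"
    using compact_imp_locally_compact_space metrizable_imp_regular_space metrizable_space_euclidean by blast
  then have "euclidean closure_of \<Inter>(range U) = topspace euclidean"
  proof (intro Baire_category disjI2)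
    show "openin euclidean V \<and> euclidean closure_of V = topspace euclidean" if V: "V \<in> range U" for V
    proof -
      obtain n where "V = U n" using V by blast
      then show ?thesis using assms(2,3) by simp
    qed
  qed auto
  then show ?thesis by simp
qed

context compact_system
begin

text \<open>Density of the orbit of \<open>x\<close> is expressed by countably many conditions, one for each member
  of a countable base; transitivity says that each holds on a dense open set.\<close>

lemma transitive_residual_dense_orbit:
  assumes "transitive T"
  shows "\<exists>D :: nat \<Rightarrow> 'a set. (\<forall>i. open (D i) \<and> closure (D i) = UNIV) \<and>
    (\<forall>x. (\<forall>i. x \<in> D i) \<longrightarrow> closure (range (\<lambda>n. (T ^^ n) x)) = UNIV)"
proof -
  obtain C :: "nat \<Rightarrow> 'a set" where Co: "\<And>i. open (C i)"
    and Ce: "\<And>e. e > 0 \<Longrightarrow> \<exists>k. \<forall>x. \<exists>i<k. x \<in> C i \<and> (\<forall>y\<in>C i. \<forall>z\<in>C i. dist y z < e)"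
    using compact_fine_cover[OF comp] by blast
  define D where "D i = (if C i = {} then UNIV else (\<Union>n. (T ^^ n) -` C i))" for i
  have "open ((T ^^ n) -` C i)" for n i
    using cont_iter[of n] Co[of i] by (simp add: continuous_on_open_vimage open_vimage)
  then have "open (D i)" for i unfolding D_def by auto
  moreover have "closure (D i) = UNIV" for i
    unfolding closure_eq_UNIV_iff
  proof (intro allI impI)
    fix V :: "'a set" assume V: "open V \<and> V \<noteq> {}"
    show "D i \<inter> V \<noteq> {}"
    proof (cases "C i = {}")
      case False
      then obtain n where "V \<inter> (T ^^ n) -` C i \<noteq> {}"
        using assms V Co[of i] unfolding transitive_def by blast
      then show ?thesis unfolding D_def using False by auto
    qed (use V in \<open>auto simp: D_def\<close>)
  qed
  moreover have "closure (range (\<lambda>n. (T ^^ n) x)) = UNIV" if x: "\<forall>i. x \<in> D i" for x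
    unfolding closure_eq_UNIV_iff
  proof (intro allI impI)
    fix V :: "'a set" assume V: "open V \<and> V \<noteq> {}"
    then obtain v e where v: "v \<in> V" "e > 0" "ball v e \<subseteq> V" by (meson all_not_in_conv openE)
    then obtain i where i: "v \<in> C i" "\<forall>y\<in>C i. \<forall>z\<in>C i. dist y z < e" using Ce by blast
    have "C i \<subseteq> V" using i v by fastforce
    moreover obtain n where "(T ^^ n) x \<in> C i"
      using x[rule_format, of i] i(1) by (auto simp: D_def split: if_splits)
    ultimately show "range (\<lambda>n. (T ^^ n) x) \<inter> V \<noteq> {}" by blast
  qed
  ultimately show ?thesis by blast
qed

end

section \<open>The pointwise ergodic theorem for ergodic measures\<close>

lemma borel_measurable_birkhoff_average:
  fixes T :: "'a::topological_space \<Rightarrow> 'a"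
  assumes "T \<in> measurable borel borel" "\<phi> \<in> borel_measurable borel"
  shows "birkhoff_average T \<phi> n \<in> borel_measurable borel"
proof -
  have "(\<lambda>x. \<phi> ((T ^^ i) x)) \<in> borel_measurable borel" for i
    using measurable_compose[OF borel_measurable_funpow[OF assms(1)] assms(2)] .
  then show ?thesis unfolding birkhoff_average_def[abs_def] by measurable
qed

lemma invariant_integral:
  fixes T :: "'a::topological_space \<Rightarrow> 'a" and \<phi> :: "'a \<Rightarrow> real"
  assumes "\<mu> \<in> invariant_measures T" "T \<in> measurable borel borel" "\<phi> \<in> borel_measurable borel"
  shows "(\<integral>x. \<phi> (T x) \<partial>\<mu>) = (\<integral>x. \<phi> x \<partial>\<mu>)"
proof -
  have bp: "\<mu> \<in> borel_probs" and d: "distr \<mu> borel T = \<mu>"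
    using assms by (auto simp: invariant_measures_def)
  have "T \<in> measurable \<mu> borel"
    by (rule borel_probs_measurable[OF bp assms(2)])
  from integral_distr[OF this assms(3)] show ?thesis using d by simp
qed

text \<open>At index \<open>N\<close> this is \<open>max {S\<^sub>n x | n \<le> N}\<close> for the Birkhoff sums \<open>S\<^sub>n\<close> of \<open>\<psi>\<close> (with \<open>S\<^sub>0 = 0\<close>);
  the recursion is the form in which Garsia's argument uses it.\<close>

primrec max_birkhoff_sum :: "('a \<Rightarrow> 'a) \<Rightarrow> ('a \<Rightarrow> real) \<Rightarrow> nat \<Rightarrow> 'a \<Rightarrow> real" where
  "max_birkhoff_sum T \<psi> 0 = (\<lambda>x. 0)"
| "max_birkhoff_sum T \<psi> (Suc n) = (\<lambda>x. max 0 (\<psi> x + max_birkhoff_sum T \<psi> n (T x)))"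

lemma max_birkhoff_sum_nonneg: "max_birkhoff_sum T \<psi> n x \<ge> 0"
  by (cases n) auto

lemma max_birkhoff_sum_Suc_ge: "max_birkhoff_sum T \<psi> n x \<le> max_birkhoff_sum T \<psi> (Suc n) x"
proof (induction n arbitrary: x)
  case (Suc n)
  show ?case using Suc[of "T x"] by (simp only: max_birkhoff_sum.simps)
qed (simp add: max_birkhoff_sum_nonneg)

lemma max_birkhoff_sum_mono: "m \<le> n \<Longrightarrow> max_birkhoff_sum T \<psi> m x \<le> max_birkhoff_sum T \<psi> n x"
  using lift_Suc_mono_le[of "\<lambda>n. max_birkhoff_sum T \<psi> n x" m n] max_birkhoff_sum_Suc_ge by metis

lemma birkhoff_sum_le_max: "(\<Sum>i<n. \<psi> ((T ^^ i) x)) \<le> max_birkhoff_sum T \<psi> n x"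
proof (induction n arbitrary: x)
  case (Suc n)
  have "(\<Sum>i<Suc n. \<psi> ((T ^^ i) x)) = \<psi> x + (\<Sum>i<n. \<psi> ((T ^^ i) (T x)))"
    by (simp only: sum.lessThan_Suc_shift funpow_Suc_right o_apply funpow_0)
  then show ?case using Suc[of "T x"] by simp
qed simp

lemma max_birkhoff_sum_bound:
  assumes "\<And>x. \<bar>\<psi> x\<bar> \<le> B"
  shows "max_birkhoff_sum T \<psi> n x \<le> real n * B"
proof (induction n arbitrary: x)
  case (Suc n)
  have "B \<ge> 0" using assms[of x] by linarith
  then have "0 \<le> real n * B" by simp
  then show ?case using Suc[of "T x"] assms[of x] by (simp add: algebra_simps abs_le_iff)
qed simp

lemma borel_measurable_max_birkhoff_sum:
  fixes T :: "'a::topological_space \<Rightarrow> 'a"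
  assumes "T \<in> measurable borel borel" "\<psi> \<in> borel_measurable borel"
  shows "max_birkhoff_sum T \<psi> n \<in> borel_measurable borel"
proof (induction n)
  case (Suc n)
  have [measurable]: "(\<lambda>x. max_birkhoff_sum T \<psi> n (T x)) \<in> borel_measurable borel"
    using measurable_compose[OF assms(1) Suc] .
  note assms(2)[measurable]
  show ?case by simp
qed simp

text \<open>Where \<open>M = max_birkhoff_sum T \<psi> n\<close> is positive one has \<open>\<psi> \<ge> M - M \<circ> T\<close>, and elsewhere
  \<open>0 \<ge> M - M \<circ> T\<close>; integrating the difference against an invariant measure gives 0.\<close>

lemma maximal_ergodic_inequality:
  fixes T :: "'a::topological_space \<Rightarrow> 'a"
  assumes \<mu>: "\<mu> \<in> invariant_measures T" and T: "T \<in> measurable borel borel"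
    and \<psi>: "\<psi> \<in> borel_measurable borel" "\<And>x. \<bar>\<psi> x\<bar> \<le> B"
  shows "0 \<le> (\<integral>x. (if max_birkhoff_sum T \<psi> n x > 0 then \<psi> x else 0) \<partial>\<mu>)"
proof -
  have bp: "\<mu> \<in> borel_probs" using \<mu> by (simp add: invariant_measures_def)
  define M where "M = max_birkhoff_sum T \<psi> n"
  have Mm [measurable]: "M \<in> borel_measurable borel"
    unfolding M_def by (rule borel_measurable_max_birkhoff_sum[OF T \<psi>(1)])
  have Mb: "\<bar>M x\<bar> \<le> real n * B" for x
    using max_birkhoff_sum_bound[OF \<psi>(2)] max_birkhoff_sum_nonneg[of T \<psi> n x] by (simp add: M_def)
  have MT [measurable]: "(\<lambda>x. M (T x)) \<in> borel_measurable borel" using measurable_compose[OF T Mm] .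
  note \<psi>(1)[measurable]
  have iM: "integrable \<mu> M" by (rule integrable_bounded_borel[OF bp Mm Mb])
  have iMT: "integrable \<mu> (\<lambda>x. M (T x))" by (rule integrable_bounded_borel[OF bp MT Mb])
  have "0 = (\<integral>x. M x - M (T x) \<partial>\<mu>)"
    using iM iMT invariant_integral[OF \<mu> T Mm] by simp
  also have "\<dots> \<le> (\<integral>x. (if M x > 0 then \<psi> x else 0) \<partial>\<mu>)"
  proof (rule integral_mono)
    show "integrable \<mu> (\<lambda>x. M x - M (T x))" using iM iMT by simp
    show "integrable \<mu> (\<lambda>x. if M x > 0 then \<psi> x else 0)"
    proof (rule integrable_bounded_borel[OF bp])
      show "(\<lambda>x. if M x > 0 then \<psi> x else 0) \<in> borel_measurable borel" by measurable
      show "\<bar>if M x > 0 then \<psi> x else 0\<bar> \<le> B" for x using \<psi>(2)[of x] by auto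
    qed
    show "M x - M (T x) \<le> (if M x > 0 then \<psi> x else 0)" for x
    proof (cases "M x > 0")
      case True
      then obtain k where k: "n = Suc k" unfolding M_def by (cases n) auto
      have "M x = \<psi> x + max_birkhoff_sum T \<psi> k (T x)" using True by (simp add: M_def k max_def split: if_splits)
      also have "\<dots> \<le> \<psi> x + M (T x)" using max_birkhoff_sum_Suc_ge[of T \<psi> k "T x"] by (simp only: M_def k)
      finally show ?thesis using True by simp
    next
      case False
      then show ?thesis using max_birkhoff_sum_nonneg[of T \<psi> n "T x"] by (simp add: M_def)
    qed
  qed
  finally show ?thesis by (simp add: M_def)
qed

text \<open>The set where the averages exceed \<open>c\<close> by a fixed amount infinitely often is invariant, so
  by ergodicity it is null or conull. In the second case almost every point has a positive Birkhoff
  sum of \<open>\<phi> - c\<close>, and the maximal inequality would give \<open>\<integral>\<phi> \<ge> c\<close> in the limit.\<close>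

lemma ergodic_average_upper:
  fixes T :: "'a::topological_space \<Rightarrow> 'a"
  assumes \<mu>: "\<mu> \<in> ergodic_measures T" and T: "T \<in> measurable borel borel"
    and \<phi>: "\<phi> \<in> borel_measurable borel" "\<And>x. \<bar>\<phi> x\<bar> \<le> B"
    and c: "(\<integral>x. \<phi> x \<partial>\<mu>) < c"
  shows "AE x in \<mu>. \<forall>k::nat. \<forall>\<^sub>F n in sequentially. birkhoff_average T \<phi> n x \<le> c + 1 / Suc k"
proof -
  have inv: "\<mu> \<in> invariant_measures T" using \<mu> by (simp add: ergodic_measures_def)
  have bp: "\<mu> \<in> borel_probs" using inv by (simp add: invariant_measures_def)
  interpret prob_space \<mu> using borel_probsD[OF bp] by simp
  have sets: "sets \<mu> = sets borel" and space: "space \<mu> = UNIV" using borel_probsD[OF bp] by auto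
  define a where "a n x = birkhoff_average T \<phi> n x" for n x
  have am: "a n \<in> borel_measurable borel" for n
    unfolding a_def using borel_measurable_birkhoff_average[OF T \<phi>(1)] .
  define A where "A = {x. \<exists>k::nat. \<forall>m. \<exists>n\<ge>m. a n x > c + 1 / Suc k}"
  have shift: "\<exists>k::nat. \<forall>m. \<exists>n\<ge>m. a n y > c + 1 / Suc k"
    if x: "\<exists>k::nat. \<forall>m. \<exists>n\<ge>m. a n x > c + 1 / Suc k" and d: "\<And>n. \<bar>a n y - a n x\<bar> \<le> 2 * B / real n" for x y
  proof -
    obtain k :: nat where k: "\<forall>m. \<exists>n\<ge>m. a n x > c + 1 / Suc k" using x by blast
    define e where "e = 1 / real (Suc k) - 1 / real (Suc (Suc k))"
    have e: "e > 0" unfolding e_def by (simp add: frac_less2)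
    have "\<exists>n\<ge>m. a n y > c + 1 / Suc (Suc k)" for m
    proof -
      obtain n where n: "n \<ge> max m (nat \<lceil>2 * B / e\<rceil> + 1)" "a n x > c + 1 / Suc k" using k by blast
      have "2 * B / e \<le> real n" "n > 0" using n(1) by linarith+
      then have "2 * B / real n \<le> e" using e by (simp add: field_simps)
      then have "a n y > c + 1 / Suc (Suc k)" using d[of n] n(2) unfolding e_def by linarith
      then show ?thesis using n(1) by auto
    qed
    then show ?thesis by blast
  qed
  have "T -` A = A"
  proof -
    have d: "\<bar>a n (T x) - a n x\<bar> \<le> 2 * B / real n" for n x
      unfolding a_def by (rule birkhoff_average_shift[OF \<phi>(2)])
    have "T x \<in> A \<longleftrightarrow> x \<in> A" for x
      using shift[of x "T x"] shift[of "T x" x] d[of _ x] d[of _ x, unfolded abs_minus_commute[of "a _ (T x)"]]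
      unfolding A_def by blast
    then show ?thesis by auto
  qed
  moreover have A: "A \<in> sets borel"
  proof -
    note am[measurable]
    have "Measurable.pred borel (\<lambda>x. \<exists>k::nat. \<forall>m. \<exists>n. n \<ge> m \<and> a n x > c + 1 / Suc k)" by measurable
    then show ?thesis unfolding A_def by (simp add: pred_def)
  qed
  ultimately consider "prob A = 0" | "prob A = 1" using \<mu> by (auto simp: ergodic_measures_def)
  then show ?thesis
  proof cases
    case 1
    then have "AE x in \<mu>. x \<notin> A" using A sets by (intro AE_not_in) (auto simp: null_sets_def emeasure_eq_measure)
    then show ?thesis
      by eventually_elim (auto simp: A_def a_def eventually_sequentially not_less)
  next
    case 2
    then have AE_A: "AE x in \<mu>. x \<in> A" using A sets AE_in_set_eq_1 by auto
    define \<psi> where "\<psi> x = \<phi> x - c" for x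
    have \<psi>m: "\<psi> \<in> borel_measurable borel" unfolding \<psi>_def[abs_def] using \<phi>(1) by measurable
    have \<psi>b: "\<bar>\<psi> x\<bar> \<le> B + \<bar>c\<bar>" for x using \<phi>(2)[of x] unfolding \<psi>_def by linarith
    let ?M = "max_birkhoff_sum T \<psi>"
    have pos: "\<exists>N. \<forall>n\<ge>N. ?M n x > 0" if x: "x \<in> A" for x
    proof -
      obtain k :: nat and n where n: "n \<ge> 1" "a n x > c + 1 / Suc k" using x unfolding A_def by blast
      have "c < a n x" using n(2) by (smt (verit) divide_pos_pos of_nat_0_less_iff zero_less_Suc)
      then have "real n * c < (\<Sum>i<n. \<phi> ((T ^^ i) x))"
        using n(1) unfolding a_def birkhoff_average_def by (simp add: field_simps)
      then have "0 < (\<Sum>i<n. \<psi> ((T ^^ i) x))" by (simp add: \<psi>_def sum_subtractf)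
      then have "?M n x > 0" using birkhoff_sum_le_max[of \<psi> T x n] by linarith
      then show ?thesis using max_birkhoff_sum_mono less_le_trans by metis
    qed
    note \<psi>m[measurable] borel_measurable_max_birkhoff_sum[OF T \<psi>m, measurable]
    have toM: "g \<in> borel_measurable \<mu>" if "g \<in> borel_measurable borel" for g :: "'a \<Rightarrow> real"
      using that by (rule borel_probs_measurable[OF bp])
    have "(\<lambda>n. \<integral>x. (if ?M n x > 0 then \<psi> x else 0) \<partial>\<mu>) \<longlonglongrightarrow> (\<integral>x. \<psi> x \<partial>\<mu>)"
    proof (rule integral_dominated_convergence[where w = "\<lambda>x. B + \<bar>c\<bar>"])
      show "\<psi> \<in> borel_measurable \<mu>" by (rule toM[OF \<psi>m])
      show "(\<lambda>x. if ?M n x > 0 then \<psi> x else 0) \<in> borel_measurable \<mu>" for n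
        by (rule toM) measurable
      show "AE x in \<mu>. (\<lambda>n. if ?M n x > 0 then \<psi> x else 0) \<longlonglongrightarrow> \<psi> x"
        using AE_A
      proof eventually_elim
        case (elim x)
        then obtain N where "\<forall>n\<ge>N. ?M n x > 0" using pos by blast
        then show ?case by (intro tendsto_eventually) (auto simp: eventually_sequentially)
      qed
      show "AE x in \<mu>. norm (if ?M n x > 0 then \<psi> x else 0) \<le> B + \<bar>c\<bar>" for n
      proof (rule AE_I2)
        show "norm (if ?M n x > 0 then \<psi> x else 0) \<le> B + \<bar>c\<bar>" for x
          using \<psi>b[of x] by (auto intro: order_trans[OF abs_ge_zero])
      qed
    qed simp
    then have "0 \<le> (\<integral>x. \<psi> x \<partial>\<mu>)"
      using maximal_ergodic_inequality[OF inv T \<psi>m \<psi>b] by (intro LIMSEQ_le_const) auto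
    moreover have "(\<integral>x. \<psi> x \<partial>\<mu>) = (\<integral>x. \<phi> x \<partial>\<mu>) - c"
      unfolding \<psi>_def using integrable_bounded_borel[OF bp \<phi>] by (simp add: prob_space)
    ultimately show ?thesis using c by simp
  qed
qed

text \<open>The upper bound applied to \<open>\<phi>\<close> and to \<open>- \<phi>\<close>.\<close>

theorem ergodic_average_tendsto:
  fixes T :: "'a::topological_space \<Rightarrow> 'a"
  assumes \<mu>: "\<mu> \<in> ergodic_measures T" and T: "T \<in> measurable borel borel"
    and \<phi>: "\<phi> \<in> borel_measurable borel" "\<And>x. \<bar>\<phi> x\<bar> \<le> B"
  shows "AE x in \<mu>. (\<lambda>n. birkhoff_average T \<phi> n x) \<longlonglongrightarrow> (\<integral>x. \<phi> x \<partial>\<mu>)"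
proof -
  define c where "c = (\<integral>x. \<phi> x \<partial>\<mu>)"
  have upper: "AE x in \<mu>. \<forall>j. \<forall>k::nat. \<forall>\<^sub>F n in sequentially.
      birkhoff_average T \<psi> n x \<le> (\<integral>x. \<psi> x \<partial>\<mu>) + 1 / Suc j + 1 / Suc k"
    if \<psi>: "\<psi> \<in> borel_measurable borel" "\<And>x. \<bar>\<psi> x\<bar> \<le> B" for \<psi>
    by (rule iffD2[OF AE_all_countable], rule allI, rule ergodic_average_upper[OF \<mu> T \<psi>]) simp
  note upper[OF \<phi>]
  moreover have "AE x in \<mu>. \<forall>j. \<forall>k::nat. \<forall>\<^sub>F n in sequentially.
      birkhoff_average T (\<lambda>x. - \<phi> x) n x \<le> (\<integral>x. - \<phi> x \<partial>\<mu>) + 1 / Suc j + 1 / Suc k"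
    using \<phi> by (intro upper) auto
  ultimately show ?thesis
  proof eventually_elim
    case (elim x)
    show ?case unfolding c_def[symmetric]
    proof (rule tendstoI)
      fix e :: real assume "e > 0"
      then obtain j where j: "inverse (real (Suc j)) < e/2" using reals_Archimedean[of "e/2"] by auto
      have "\<forall>\<^sub>F n in sequentially. birkhoff_average T \<phi> n x \<le> c + 1 / Suc j + 1 / Suc j"
        using elim(1) unfolding c_def by blast
      moreover have "\<forall>\<^sub>F n in sequentially. birkhoff_average T (\<lambda>x. - \<phi> x) n x \<le> - c + 1 / Suc j + 1 / Suc j"
        using elim(2) unfolding c_def Bochner_Integration.integral_minus by blast
      ultimately show "\<forall>\<^sub>F n in sequentially. dist (birkhoff_average T \<phi> n x) c < e"
      proof eventually_elim
        case (elim n)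
        have "birkhoff_average T (\<lambda>x. - \<phi> x) n x = - birkhoff_average T \<phi> n x"
          by (simp add: birkhoff_average_def sum_negf)
        then show ?case using elim j unfolding dist_real_def inverse_eq_divide by linarith
      qed
    qed
  qed
qed

section \<open>Ergodic measures as lexicographic maximisers\<close>

lemma invariant_measuresI:
  assumes "\<mu> \<in> borel_probs" "T \<in> measurable borel borel"
    "\<And>B. B \<in> sets borel \<Longrightarrow> emeasure \<mu> (T -` B) = emeasure \<mu> B"
  shows "\<mu> \<in> invariant_measures T"
proof -
  have T: "T \<in> measurable \<mu> borel"
    by (rule borel_probs_measurable[OF assms(1,2)])
  have "distr \<mu> borel T = \<mu>"
  proof (rule measure_eqI)
    show "sets (distr \<mu> borel T) = sets \<mu>" using borel_probsD[OF assms(1)] by simp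
    show "emeasure (distr \<mu> borel T) B = emeasure \<mu> B" if "B \<in> sets (distr \<mu> borel T)" for B
      using that assms(3) T borel_probsD(3)[OF assms(1)] by (simp add: emeasure_distr)
  qed
  then show ?thesis using assms(1) by (simp add: invariant_measures_def)
qed

lemma invariant_emeasure_vimage:
  fixes T :: "'a::topological_space \<Rightarrow> 'a"
  assumes "\<mu> \<in> invariant_measures T" "T \<in> measurable borel borel" "B \<in> sets borel"
  shows "emeasure \<mu> (T -` B) = emeasure \<mu> B"
proof -
  have bp: "\<mu> \<in> borel_probs" and d: "distr \<mu> borel T = \<mu>"
    using assms by (auto simp: invariant_measures_def)
  have "T \<in> measurable \<mu> borel"
    by (rule borel_probs_measurable[OF bp assms(2)])
  from emeasure_distr[OF this assms(3)] show ?thesis using d borel_probsD(3)[OF bp] by simp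
qed

lemma uniform_measure_borel_prob:
  assumes "\<mu> \<in> borel_probs" "A \<in> sets borel" "measure \<mu> A > 0"
  shows "uniform_measure \<mu> A \<in> borel_probs"
proof -
  interpret prob_space \<mu> using borel_probsD[OF assms(1)] by simp
  have "prob_space (uniform_measure \<mu> A)"
    using assms by (intro prob_space_uniform_measure) (auto simp: emeasure_eq_measure)
  then show ?thesis using borel_probsD(2)[OF assms(1)] by (simp add: borel_probs_def)
qed

lemma uniform_measure_invariant:
  fixes T :: "'a::topological_space \<Rightarrow> 'a"
  assumes \<mu>: "\<mu> \<in> invariant_measures T" and T: "T \<in> measurable borel borel"
    and A: "A \<in> sets borel" "T -` A = A" "measure \<mu> A > 0"
  shows "uniform_measure \<mu> A \<in> invariant_measures T"
proof (rule invariant_measuresI[OF _ T])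
  have bp: "\<mu> \<in> borel_probs" using \<mu> by (simp add: invariant_measures_def)
  show "uniform_measure \<mu> A \<in> borel_probs" by (rule uniform_measure_borel_prob[OF bp A(1,3)])
  fix B :: "'a set" assume B: "B \<in> sets borel"
  have TB: "T -` B \<in> sets borel" using measurable_sets[OF T B] by simp
  have "A \<inter> T -` B = T -` (A \<inter> B)" using A(2) by auto
  then have "emeasure \<mu> (A \<inter> T -` B) = emeasure \<mu> (A \<inter> B)"
    using invariant_emeasure_vimage[OF \<mu> T, of "A \<inter> B"] A(1) B by auto
  then show "emeasure (uniform_measure \<mu> A) (T -` B) = emeasure (uniform_measure \<mu> A) B"
    using A(1) B TB borel_probsD(2)[OF bp] by simp
qed

lemma integral_uniform_measure:
  fixes \<phi> :: "'a::topological_space \<Rightarrow> real"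
  assumes \<mu>: "\<mu> \<in> borel_probs" and A: "A \<in> sets borel" "measure \<mu> A > 0"
    and \<phi>: "\<phi> \<in> borel_measurable borel"
  shows "measure \<mu> A * (\<integral>x. \<phi> x \<partial>uniform_measure \<mu> A) = (\<integral>x. indicator A x * \<phi> x \<partial>\<mu>)"
proof -
  interpret prob_space \<mu> using borel_probsD[OF \<mu>] by simp
  have sets: "sets \<mu> = sets borel" using borel_probsD[OF \<mu>] by simp
  have A': "A \<in> sets \<mu>" using A sets by simp
  have \<phi>': "\<phi> \<in> borel_measurable \<mu>" by (rule borel_probs_measurable[OF \<mu> \<phi>])
  have "uniform_measure \<mu> A = density \<mu> (\<lambda>x. ennreal (indicator A x / prob A))"
    unfolding uniform_measure_def
    by (rule arg_cong[of _ _ "density \<mu>"])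
      (use A in \<open>auto simp: fun_eq_iff indicator_def emeasure_eq_measure divide_ennreal[symmetric]\<close>)
  then have "(\<integral>x. \<phi> x \<partial>uniform_measure \<mu> A) = (\<integral>x. (indicator A x / prob A) *\<^sub>R \<phi> x \<partial>\<mu>)"
    using A' \<phi>' by (simp add: integral_density)
  also have "\<dots> = (\<integral>x. (indicator A x * \<phi> x) / prob A \<partial>\<mu>)" by simp
  also have "\<dots> = (\<integral>x. indicator A x * \<phi> x \<partial>\<mu>) / prob A" by (rule integral_divide_zero)
  finally show ?thesis using A(2) by simp
qed

context compact_system
begin

lemma invariant_measures_weakly_closed:
  assumes \<mu>: "\<And>n. \<mu> n \<in> invariant_measures T" and \<nu>: "\<nu> \<in> borel_probs"
    and lim: "\<And>\<phi> :: 'a \<Rightarrow> real. continuous_on UNIV \<phi> \<Longrightarrow> (\<lambda>n. \<integral>x. \<phi> x \<partial>\<mu> n) \<longlonglongrightarrow> (\<integral>x. \<phi> x \<partial>\<nu>)"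
  shows "\<nu> \<in> invariant_measures T"
proof -
  have "(\<integral>x. f i (T x) \<partial>\<nu>) = (\<integral>x. f i x \<partial>\<nu>)" for i
  proof -
    have "continuous_on UNIV (\<lambda>x. f i (T x))" by (rule continuous_on_compose2[OF cont_f contT]) simp
    from lim[OF this] have "(\<lambda>n. \<integral>x. f i x \<partial>\<mu> n) \<longlonglongrightarrow> (\<integral>x. f i (T x) \<partial>\<nu>)"
      using invariant_integral[OF \<mu> measT borel_measurable_continuous_onI[OF cont_f]] by simp
    then show ?thesis using lim[OF cont_f] LIMSEQ_unique by blast
  qed
  then show ?thesis by (intro invariant_measuresI_f \<nu>)
qed

lemma invariant_measures_nonempty: "invariant_measures T \<noteq> {}"
  using limit_measures_nonempty[of undefined] limit_measure_invariant by blast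

primrec lex_maximisers :: "(nat \<Rightarrow> 'a \<Rightarrow> real) \<Rightarrow> nat \<Rightarrow> 'a measure set" where
  "lex_maximisers \<phi> 0 = invariant_measures T"
| "lex_maximisers \<phi> (Suc k) =
    {\<mu> \<in> lex_maximisers \<phi> k. \<forall>\<nu>\<in>lex_maximisers \<phi> k. (\<integral>x. \<phi> k x \<partial>\<nu>) \<le> (\<integral>x. \<phi> k x \<partial>\<mu>)}"

lemma lex_maximisers_decreasing: "j \<le> k \<Longrightarrow> lex_maximisers \<phi> k \<subseteq> lex_maximisers \<phi> j"
  by (induction k) (auto simp: le_Suc_eq)

lemma lex_maximisers_subset: "lex_maximisers \<phi> k \<subseteq> invariant_measures T"
  using lex_maximisers_decreasing[of 0 k \<phi>] by simp

lemma lex_maximisers_weakly_closed: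
  assumes \<phi>: "\<And>k. continuous_on UNIV (\<phi> k)"
    and \<mu>: "\<And>n. \<mu> n \<in> lex_maximisers \<phi> k" and \<nu>: "\<nu> \<in> borel_probs"
    and lim: "\<And>\<phi> :: 'a \<Rightarrow> real. continuous_on UNIV \<phi> \<Longrightarrow> (\<lambda>n. \<integral>x. \<phi> x \<partial>\<mu> n) \<longlonglongrightarrow> (\<integral>x. \<phi> x \<partial>\<nu>)"
  shows "\<nu> \<in> lex_maximisers \<phi> k"
  using \<mu>
proof (induction k)
  case 0
  then show ?case using invariant_measures_weakly_closed[OF _ \<nu> lim] by simp
next
  case (Suc k)
  have "\<nu> \<in> lex_maximisers \<phi> k" using Suc by simp
  moreover have "(\<integral>x. \<phi> k x \<partial>\<nu>') \<le> (\<integral>x. \<phi> k x \<partial>\<nu>)" if "\<nu>' \<in> lex_maximisers \<phi> k" for \<nu>'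
    using Suc.prems that by (intro LIMSEQ_le_const[OF lim[OF \<phi>]]) auto
  ultimately show ?case by simp
qed

lemma lex_maximisers_nonempty:
  assumes \<phi>: "\<And>k. continuous_on UNIV (\<phi> k)"
  shows "lex_maximisers \<phi> k \<noteq> {}"
proof (induction k)
  case 0
  then show ?case using invariant_measures_nonempty by simp
next
  case (Suc k)
  let ?S = "lex_maximisers \<phi> k"
  have bp: "?S \<subseteq> borel_probs" using lex_maximisers_subset by (auto simp: invariant_measures_def)
  obtain B where B: "\<And>x. \<bar>\<phi> k x\<bar> \<le> B" using compact_continuous_bounded[OF comp \<phi>[of k]] by blast
  define s where "s = (SUP \<mu>\<in>?S. \<integral>x. \<phi> k x \<partial>\<mu>)"
  have bdd: "bdd_above ((\<lambda>\<mu>. \<integral>x. \<phi> k x \<partial>\<mu>) ` ?S)"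
    using integral_abs_le[OF _ \<phi> B] bp by (intro bdd_aboveI2[of _ _ B]) (auto simp: abs_le_iff)
  have "\<exists>\<mu>\<in>?S. s - 1 / real (Suc n) < (\<integral>x. \<phi> k x \<partial>\<mu>)" for n
    using less_cSUP_iff[OF Suc bdd, of "s - 1 / real (Suc n)"] by (simp add: s_def)
  then obtain \<mu> where \<mu>: "\<And>n. \<mu> n \<in> ?S" "\<And>n. s - 1 / real (Suc n) < (\<integral>x. \<phi> k x \<partial>\<mu> n)" by metis
  have \<mu>bp: "\<mu> n \<in> borel_probs" for n using \<mu>(1) bp by blast
  obtain r \<nu> where r: "strict_mono r" and \<nu>: "\<nu> \<in> borel_probs"
    and "\<forall>\<phi> :: 'a \<Rightarrow> real. continuous_on UNIV \<phi> \<longrightarrow> (\<lambda>n. \<integral>x. \<phi> x \<partial>\<mu> (r n)) \<longlonglongrightarrow> (\<integral>x. \<phi> x \<partial>\<nu>)"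
    using borel_probs_weakly_seq_compact[OF comp, of \<mu>, OF \<mu>bp] by blast
  then have lim: "continuous_on UNIV \<psi> \<Longrightarrow> (\<lambda>n. \<integral>x. \<psi> x \<partial>\<mu> (r n)) \<longlonglongrightarrow> (\<integral>x. \<psi> x \<partial>\<nu>)" for \<psi> :: "'a \<Rightarrow> real"
    by simp
  have "\<nu> \<in> ?S" by (rule lex_maximisers_weakly_closed[OF \<phi> \<mu>(1) \<nu> lim])
  moreover have "s \<le> (\<integral>x. \<phi> k x \<partial>\<nu>)"
  proof (rule LIMSEQ_le[OF _ lim[OF \<phi>]])
    show "(\<lambda>n. s - 1 / real (Suc (r n))) \<longlonglongrightarrow> s"
    proof -
      have "(\<lambda>n. s - 1 / real (Suc n)) \<longlonglongrightarrow> s - 0" by (intro tendsto_intros lim_1_over_real_power) (use LIMSEQ_inverse_real_of_nat in \<open>simp add: inverse_eq_divide\<close>)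
      from LIMSEQ_subseq_LIMSEQ[OF this r] show ?thesis by (simp add: o_def)
    qed
    show "\<exists>N. \<forall>n\<ge>N. s - 1 / real (Suc (r n)) \<le> (\<integral>x. \<phi> k x \<partial>\<mu> (r n))"
      using \<mu>(2) by (intro exI[of _ 0] allI impI less_imp_le)
  qed
  moreover have "(\<integral>x. \<phi> k x \<partial>\<nu>') \<le> s" if "\<nu>' \<in> ?S" for \<nu>'
    unfolding s_def using that bdd by (rule cSUP_upper)
  ultimately have "\<nu> \<in> lex_maximisers \<phi> (Suc k)" by (auto intro: order_trans)
  then show ?case by blast
qed

text \<open>The two conditional measures of \<open>\<mu>\<close> on an invariant set and its complement average to
  \<open>\<mu>\<close>, so neither can beat \<open>\<mu>\<close> and both must reach the same maximum: the set of maximisers is a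
  face.\<close>

lemma lex_maximisers_face:
  assumes \<phi>: "\<And>k. continuous_on UNIV (\<phi> k)"
    and "\<mu> \<in> lex_maximisers \<phi> k" "A \<in> sets borel" "T -` A = A" "0 < measure \<mu> A" "measure \<mu> A < 1"
  shows "uniform_measure \<mu> A \<in> lex_maximisers \<phi> k"
  using assms(2-6)
proof (induction k arbitrary: A)
  case 0
  then show ?case using uniform_measure_invariant[OF _ measT] by simp
next
  case (Suc k)
  have inv: "\<mu> \<in> invariant_measures T" using Suc.prems(1) lex_maximisers_subset by blast
  then have bp: "\<mu> \<in> borel_probs" by (simp add: invariant_measures_def)
  interpret prob_space \<mu> using borel_probsD[OF bp] by simp
  have sets: "sets \<mu> = sets borel" and space: "space \<mu> = UNIV" using borel_probsD[OF bp] by auto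
  have mem: "\<mu> \<in> lex_maximisers \<phi> k" and max: "\<And>\<nu>. \<nu> \<in> lex_maximisers \<phi> k \<Longrightarrow> (\<integral>x. \<phi> k x \<partial>\<nu>) \<le> (\<integral>x. \<phi> k x \<partial>\<mu>)"
    using Suc.prems(1) by auto
  have pc: "prob (- A) = 1 - prob A"
    using prob_compl[of A] Suc.prems(2) sets space by (simp add: Compl_eq_Diff_UNIV)
  have c1: "uniform_measure \<mu> A \<in> lex_maximisers \<phi> k"
    using Suc.IH[OF mem Suc.prems(2-5)] .
  have c2: "uniform_measure \<mu> (- A) \<in> lex_maximisers \<phi> k"
    using Suc.prems pc by (intro Suc.IH[OF mem]) auto
  have \<phi>m: "\<phi> k \<in> borel_measurable borel" using \<phi> by (rule borel_measurable_continuous_onI)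
  obtain B where B: "\<And>x. \<bar>\<phi> k x\<bar> \<le> B" using compact_continuous_bounded[OF comp \<phi>[of k]] by blast
  have int: "integrable \<mu> (\<lambda>x. indicator C x * \<phi> k x)" if "C \<in> sets borel" for C
  proof (rule integrable_bounded_borel[OF bp])
    note \<phi>m[measurable] that[measurable]
    show "(\<lambda>x. indicator C x * \<phi> k x) \<in> borel_measurable borel" by measurable
    show "\<bar>indicator C x * \<phi> k x\<bar> \<le> B" for x
      using B[of x] by (auto simp: indicator_def intro: order_trans[OF abs_ge_zero])
  qed
  let ?a = "\<integral>x. \<phi> k x \<partial>uniform_measure \<mu> A" and ?b = "\<integral>x. \<phi> k x \<partial>uniform_measure \<mu> (- A)"
    and ?m = "\<integral>x. \<phi> k x \<partial>\<mu>"
  have "prob A * ?a + prob (- A) * ?b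
     = (\<integral>x. indicator A x * \<phi> k x \<partial>\<mu>) + (\<integral>x. indicator (- A) x * \<phi> k x \<partial>\<mu>)"
    using Suc.prems pc integral_uniform_measure[OF bp _ _ \<phi>m, of A]
      integral_uniform_measure[OF bp _ _ \<phi>m, of "- A"] by simp
  also have "\<dots> = (\<integral>x. indicator A x * \<phi> k x + indicator (- A) x * \<phi> k x \<partial>\<mu>)"
    using Suc.prems by (intro Bochner_Integration.integral_add[symmetric] int) auto
  also have "\<dots> = ?m" by (intro Bochner_Integration.integral_cong) (auto simp: indicator_def)
  finally have sum: "prob A * ?a + (1 - prob A) * ?b = ?m" by (simp add: pc)
  have "(1 - prob A) * ?b \<le> (1 - prob A) * ?m"
    using max[OF c2] Suc.prems by (intro mult_left_mono) auto
  then have "prob A * ?m \<le> prob A * ?a" using sum by (simp add: algebra_simps)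
  then have "?m \<le> ?a" using Suc.prems by simp
  then show ?case using c1 max by (auto intro: order_trans)
qed

text \<open>Maximise \<open>\<phi>\<close> first and then all \<open>f i\<close> in turn. A common member of these nested compact faces
  is extreme: conditioning it on an invariant set stays in every face, so does not change any
  integral of an \<open>f i\<close> and hence does not change the measure.\<close>

theorem ergodic_maximiser:
  assumes \<phi>: "continuous_on UNIV (\<phi> :: 'a \<Rightarrow> real)"
  shows "\<exists>\<mu>\<in>ergodic_measures T. \<forall>\<nu>\<in>invariant_measures T. (\<integral>x. \<phi> x \<partial>\<nu>) \<le> (\<integral>x. \<phi> x \<partial>\<mu>)"
proof -
  define \<Phi> where "\<Phi> k = (case k of 0 \<Rightarrow> \<phi> | Suc i \<Rightarrow> (\<lambda>x. f i x))" for k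
  have \<Phi>c: "continuous_on UNIV (\<Phi> k)" for k using \<phi> cont_f by (cases k) (auto simp: \<Phi>_def)
  let ?S = "lex_maximisers \<Phi>"
  have "\<forall>k. \<exists>\<mu>. \<mu> \<in> ?S k" using lex_maximisers_nonempty[of \<Phi>, OF \<Phi>c] by blast
  then obtain \<mu> where \<mu>: "\<And>k. \<mu> k \<in> ?S k" by metis
  have \<mu>bp: "\<mu> k \<in> borel_probs" for k
    using \<mu>[of k] lex_maximisers_subset[of \<Phi> k] by (auto simp: invariant_measures_def)
  obtain r \<nu> where r: "strict_mono r" and \<nu>: "\<nu> \<in> borel_probs"
    and "\<forall>\<phi> :: 'a \<Rightarrow> real. continuous_on UNIV \<phi> \<longrightarrow> (\<lambda>n. \<integral>x. \<phi> x \<partial>\<mu> (r n)) \<longlonglongrightarrow> (\<integral>x. \<phi> x \<partial>\<nu>)"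
    using borel_probs_weakly_seq_compact[OF comp, of \<mu>, OF \<mu>bp] by blast
  then have lim: "continuous_on UNIV \<psi> \<Longrightarrow> (\<lambda>n. \<integral>x. \<psi> x \<partial>\<mu> (r n)) \<longlonglongrightarrow> (\<integral>x. \<psi> x \<partial>\<nu>)" for \<psi> :: "'a \<Rightarrow> real"
    by simp
  have \<nu>S: "\<nu> \<in> ?S k" for k
  proof (rule lex_maximisers_weakly_closed[of \<Phi>, OF \<Phi>c _ \<nu>])
    show "\<mu> (r (n + k)) \<in> ?S k" for n
      using \<mu> lex_maximisers_decreasing[of k "r (n + k)" \<Phi>] seq_suble[OF r, of "n + k"] by auto
    show "(\<lambda>n. \<integral>x. \<psi> x \<partial>\<mu> (r (n + k))) \<longlonglongrightarrow> (\<integral>x. \<psi> x \<partial>\<nu>)" if "continuous_on UNIV \<psi>" for \<psi> :: "'a \<Rightarrow> real"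
      using LIMSEQ_ignore_initial_segment[OF lim[OF that]] .
  qed
  have inv: "\<nu> \<in> invariant_measures T" using \<nu>S[of 0] by simp
  interpret prob_space \<nu> using borel_probsD[OF \<nu>] by simp
  have "prob A = 0 \<or> prob A = 1" if A: "A \<in> sets borel" "T -` A = A" for A
  proof (rule ccontr)
    assume "\<not> (prob A = 0 \<or> prob A = 1)"
    then have p: "0 < prob A" "prob A < 1" using prob_le_1[of A] measure_nonneg[of \<nu> A] by linarith+
    let ?c = "uniform_measure \<nu> A"
    have cS: "?c \<in> ?S k" for k by (rule lex_maximisers_face[of \<Phi>, OF \<Phi>c \<nu>S A p])
    have "(\<integral>x. f i x \<partial>?c) = (\<integral>x. f i x \<partial>\<nu>)" for i
    proof (rule antisym)
      have "(\<integral>x. \<Phi> (Suc i) x \<partial>?c) \<le> (\<integral>x. \<Phi> (Suc i) x \<partial>\<nu>)"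
        using cS[of "Suc i"] \<nu>S[of "Suc (Suc i)"] by simp
      then show "(\<integral>x. f i x \<partial>?c) \<le> (\<integral>x. f i x \<partial>\<nu>)" by (simp add: \<Phi>_def)
      have "(\<integral>x. \<Phi> (Suc i) x \<partial>\<nu>) \<le> (\<integral>x. \<Phi> (Suc i) x \<partial>?c)"
        using \<nu>S[of "Suc i"] cS[of "Suc (Suc i)"] by simp
      then show "(\<integral>x. f i x \<partial>\<nu>) \<le> (\<integral>x. f i x \<partial>?c)" by (simp add: \<Phi>_def)
    qed
    then have "?c = \<nu>"
      by (intro measure_eqI_f \<nu> uniform_measure_borel_prob A p)
    moreover have "measure ?c A = 1"
      using p A borel_probsD(2)[OF \<nu>] by (simp add: emeasure_eq_measure)
    ultimately show False using p by simp
  qed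
  then have "\<nu> \<in> ergodic_measures T" using inv by (simp add: ergodic_measures_def)
  moreover have "\<forall>\<nu>'\<in>invariant_measures T. (\<integral>x. \<phi> x \<partial>\<nu>') \<le> (\<integral>x. \<phi> x \<partial>\<nu>)"
    using \<nu>S[of "Suc 0"] by (simp add: \<Phi>_def)
  ultimately show ?thesis by blast
qed

corollary not_uniquely_ergodic_two_ergodic:
  assumes "\<not> uniquely_ergodic T"
  shows "\<exists>\<mu>\<in>ergodic_measures T. \<exists>\<nu>\<in>ergodic_measures T. \<exists>i. (\<integral>x. f i x \<partial>\<mu>) < (\<integral>x. f i x \<partial>\<nu>)"
proof -
  obtain \<mu> \<nu> where mn: "\<mu> \<in> invariant_measures T" "\<nu> \<in> invariant_measures T" "\<mu> \<noteq> \<nu>"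
    using assms invariant_measures_nonempty unfolding uniquely_ergodic_def by blast
  then obtain i where i: "i \<ge> 1" "(\<integral>x. f i x \<partial>\<mu>) \<noteq> (\<integral>x. f i x \<partial>\<nu>)"
    using measure_eqI_f[of \<mu> \<nu>] by (auto simp: invariant_measures_def)
  obtain e1 where e1: "e1 \<in> ergodic_measures T" "\<forall>\<nu>\<in>invariant_measures T. (\<integral>x. f i x \<partial>\<nu>) \<le> (\<integral>x. f i x \<partial>e1)"
    using ergodic_maximiser[OF cont_f] by blast
  have "continuous_on UNIV (\<lambda>x. - f i x)" by (intro continuous_intros cont_f)
  then obtain e2 where e2: "e2 \<in> ergodic_measures T" "\<forall>\<nu>\<in>invariant_measures T. (\<integral>x. - f i x \<partial>\<nu>) \<le> (\<integral>x. - f i x \<partial>e2)"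
    using ergodic_maximiser by blast
  have "(\<integral>x. f i x \<partial>e2) < (\<integral>x. f i x \<partial>e1)"
    using e1(2)[rule_format, OF mn(1)] e1(2)[rule_format, OF mn(2)]
      e2(2)[rule_format, OF mn(1)] e2(2)[rule_format, OF mn(2)] i(2) by auto
  then show ?thesis using e1(1) e2(1) by blast
qed

end

section \<open>Shadowing a generic point after a short delay\<close>

lemma frequently_less_of_liminf_less:
  fixes u :: "nat \<Rightarrow> real"
  assumes "liminf (\<lambda>n. ereal (u n)) < ereal \<kappa>"
  shows "\<exists>\<^sub>F n in sequentially. u n < \<kappa>"
proof (rule ccontr)
  assume "\<not> ?thesis"
  then have "\<forall>\<^sub>F n in sequentially. ereal \<kappa> \<le> ereal (u n)"
    by (simp add: not_frequently not_less)
  then have "ereal \<kappa> \<le> liminf (\<lambda>n. ereal (u n))" by (rule Liminf_bounded)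
  then show False using assms by simp
qed

context compact_system
begin

text \<open>Waiting \<open>p\<close> steps and then following the orbit of \<open>y\<close> for \<open>n\<close> steps outside a set of
  \<open>c\<close> times costs at most the fraction \<open>(p + c) / (p + n)\<close> of the average.\<close>

lemma shadowing_average:
  assumes \<phi>: "continuous_on UNIV (\<phi> :: 'a \<Rightarrow> real)" "\<And>x. 0 \<le> \<phi> x \<and> \<phi> x \<le> 1" and "\<omega> > 0"
  shows "\<exists>\<epsilon>>0. \<forall>n p z y \<Lambda>. n \<ge> 1 \<and> \<Lambda> \<subseteq> {..<n} \<and> (\<forall>j\<in>\<Lambda>. dist ((T ^^ (p + j)) z) ((T ^^ j) y) < \<epsilon>)
    \<longrightarrow> avg \<phi> n y - \<omega> - real (p + card ({..<n} - \<Lambda>)) / real (p + n) \<le> avg \<phi> (p + n) z"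
proof -
  have "uniformly_continuous_on UNIV \<phi>"
    using compact_uniformly_continuous[OF \<phi>(1) comp] .
  then obtain \<epsilon> where \<epsilon>: "\<epsilon> > 0" "\<And>a b. dist a b < \<epsilon> \<Longrightarrow> dist (\<phi> a) (\<phi> b) < \<omega>"
    using \<open>\<omega> > 0\<close> unfolding uniformly_continuous_on_def by (metis UNIV_I)
  have "avg \<phi> n y - \<omega> - real (p + card ({..<n} - \<Lambda>)) / real (p + n) \<le> avg \<phi> (p + n) z"
    if n: "n \<ge> 1" and \<Lambda>: "\<Lambda> \<subseteq> {..<n}" and d: "\<And>j. j \<in> \<Lambda> \<Longrightarrow> dist ((T ^^ (p + j)) z) ((T ^^ j) y) < \<epsilon>"
    for n p z y \<Lambda>
  proof -
    define c where "c = card ({..<n} - \<Lambda>)"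
    have fin: "finite \<Lambda>" using \<Lambda> finite_subset by blast
    define A where "A = avg \<phi> n y"
    have A1: "A \<le> 1"
      using birkhoff_average_bound[of \<phi> 1 T n y] \<phi>(2) unfolding A_def by (simp add: abs_le_iff)
    have nA: "(\<Sum>j<n. \<phi> ((T ^^ j) y)) = real n * A"
      using n by (simp add: A_def birkhoff_average_def)
    have "(\<Sum>j<n. \<phi> ((T ^^ j) y)) = (\<Sum>j\<in>\<Lambda>. \<phi> ((T ^^ j) y)) + (\<Sum>j\<in>{..<n} - \<Lambda>. \<phi> ((T ^^ j) y))"
      using sum.subset_diff[OF \<Lambda>, of "\<lambda>j. \<phi> ((T ^^ j) y)"] by (simp add: add.commute)
    moreover have "(\<Sum>j\<in>{..<n} - \<Lambda>. \<phi> ((T ^^ j) y)) \<le> real c"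
      unfolding c_def using sum_bounded_above[of "{..<n} - \<Lambda>" "\<lambda>j. \<phi> ((T ^^ j) y)" 1] \<phi>(2) by simp
    moreover have "(\<Sum>j\<in>\<Lambda>. \<phi> ((T ^^ j) y)) \<le> (\<Sum>j\<in>\<Lambda>. \<phi> ((T ^^ (p + j)) z)) + real n * \<omega>"
    proof -
      have "(\<Sum>j\<in>\<Lambda>. \<phi> ((T ^^ j) y)) \<le> (\<Sum>j\<in>\<Lambda>. \<phi> ((T ^^ (p + j)) z) + \<omega>)"
      proof (rule sum_mono)
        fix j assume "j \<in> \<Lambda>"
        from \<epsilon>(2)[OF d[OF this]] show "\<phi> ((T ^^ j) y) \<le> \<phi> ((T ^^ (p + j)) z) + \<omega>"
          unfolding dist_real_def by linarith
      qed
      also have "\<dots> = (\<Sum>j\<in>\<Lambda>. \<phi> ((T ^^ (p + j)) z)) + real (card \<Lambda>) * \<omega>" by (simp add: sum.distrib)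
      also have "real (card \<Lambda>) * \<omega> \<le> real n * \<omega>"
        using card_mono[OF _ \<Lambda>] \<open>\<omega> > 0\<close> by (intro mult_right_mono) auto
      finally show ?thesis by simp
    qed
    moreover have "(\<Sum>j\<in>\<Lambda>. \<phi> ((T ^^ (p + j)) z)) \<le> (\<Sum>i<p+n. \<phi> ((T ^^ i) z))"
    proof -
      have "(\<Sum>j\<in>\<Lambda>. \<phi> ((T ^^ (p + j)) z)) = (\<Sum>i\<in>(\<lambda>j. p + j) ` \<Lambda>. \<phi> ((T ^^ i) z))"
        by (subst sum.reindex) (auto simp: inj_on_def)
      also have "\<dots> \<le> (\<Sum>i<p+n. \<phi> ((T ^^ i) z))"
        using \<Lambda> \<phi>(2) by (intro sum_mono2) auto
      finally show ?thesis .
    qed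
    ultimately have "real n * A \<le> (\<Sum>i<p+n. \<phi> ((T ^^ i) z)) + real n * \<omega> + real c"
      using nA by linarith
    moreover have "real p * A \<le> real p" using A1 mult_left_mono[of A 1 "real p"] by simp
    moreover have "real p * \<omega> \<ge> 0" using \<open>\<omega> > 0\<close> by simp
    ultimately have "(A - \<omega>) * real (p + n) - real (p + c) \<le> (\<Sum>i<p+n. \<phi> ((T ^^ i) z))"
      by (simp add: algebra_simps)
    then have "((A - \<omega>) * real (p + n) - real (p + c)) / real (p + n) \<le> (\<Sum>i<p+n. \<phi> ((T ^^ i) z)) / real (p + n)"
      by (rule divide_right_mono) simp
    then show ?thesis using n unfolding A_def c_def birkhoff_average_def[of T \<phi> "p + n"]
      by (simp add: diff_divide_distrib)
  qed
  then show ?thesis using \<epsilon>(1) by (intro exI[of _ \<epsilon>] conjI allI impI) auto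
qed

text \<open>Shadowing \<open>y\<close> from a point near any given one yields a time beyond \<open>N\<close> at which all
  averages are those of \<open>y\<close>, up to the lost fraction \<open>\<kappa>\<close>. Stating lower bounds suffices, since
  upper bounds for \<open>\<phi>\<close> are lower bounds for \<open>1 - \<phi>\<close>.\<close>

lemma mg_product_open_dense:
  fixes N :: nat
  assumes mg: "mg_product_property T m g"
    and lim: "\<And>\<epsilon> x y. \<epsilon> > 0 \<Longrightarrow>
      \<exists>\<^sub>F n in sequentially. real (m \<epsilon> x y n + g \<epsilon> x y n) / real (m \<epsilon> x y n + n) < \<kappa>"
    and I: "finite I" and \<phi>: "\<And>k. k \<in> I \<Longrightarrow> continuous_on UNIV (\<phi> k :: 'a \<Rightarrow> real)"
      "\<And>k x. k \<in> I \<Longrightarrow> 0 \<le> \<phi> k x \<and> \<phi> k x \<le> 1"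
    and a: "\<And>k. k \<in> I \<Longrightarrow> \<forall>\<^sub>F n in sequentially. a k \<le> avg (\<phi> k) n y" and "\<omega> > 0"
  defines "D \<equiv> {z. \<exists>n\<ge>N. \<forall>k\<in>I. a k - \<kappa> - \<omega> < avg (\<phi> k) n z}"
  shows "open D" "closure D = UNIV"
proof -
  have "open (\<Union>n\<in>{N..}. \<Inter>k\<in>I. {z. a k - \<kappa> - \<omega> < avg (\<phi> k) n z})"
    using I \<phi>(1) by (intro open_UN ballI open_INT open_Collect_less cont_avg continuous_on_const) auto
  also have "(\<Union>n\<in>{N..}. \<Inter>k\<in>I. {z. a k - \<kappa> - \<omega> < avg (\<phi> k) n z}) = D" unfolding D_def by auto
  finally show "open D" .
  have "\<forall>k\<in>I. \<exists>\<epsilon>>0. \<forall>n p z y \<Lambda>. n \<ge> 1 \<and> \<Lambda> \<subseteq> {..<n} \<and> (\<forall>j\<in>\<Lambda>. dist ((T ^^ (p + j)) z) ((T ^^ j) y) < \<epsilon>)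
    \<longrightarrow> avg (\<phi> k) n y - \<omega> - real (p + card ({..<n} - \<Lambda>)) / real (p + n) \<le> avg (\<phi> k) (p + n) z"
    by (intro ballI shadowing_average \<phi> \<open>\<omega> > 0\<close>)
  then obtain e where e: "\<And>k. k \<in> I \<Longrightarrow> e k > 0" and
    sh: "\<And>k n p z y \<Lambda>. k \<in> I \<Longrightarrow> n \<ge> 1 \<Longrightarrow> \<Lambda> \<subseteq> {..<n} \<Longrightarrow> (\<forall>j\<in>\<Lambda>. dist ((T ^^ (p + j)) z) ((T ^^ j) y) < e k)
    \<Longrightarrow> avg (\<phi> k) n y - \<omega> - real (p + card ({..<n} - \<Lambda>)) / real (p + n) \<le> avg (\<phi> k) (p + n) z"
    by metis
  show "closure D = UNIV" unfolding closure_eq_UNIV_iff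
  proof (intro allI impI)
    fix V :: "'a set" assume "open V \<and> V \<noteq> {}"
    then obtain x r where x: "x \<in> V" "r > 0" "ball x r \<subseteq> V" by (meson all_not_in_conv openE)
    define \<epsilon> where "\<epsilon> = Min (insert r (e ` I))"
    have \<epsilon>: "\<epsilon> > 0" "\<epsilon> \<le> r" "\<And>k. k \<in> I \<Longrightarrow> \<epsilon> \<le> e k"
      using I e x(2) by (auto simp: \<epsilon>_def)
    obtain N' where N': "N' \<ge> 1" "\<And>n. n \<ge> N' \<Longrightarrow> \<exists>z p \<Lambda>. \<Lambda> \<subseteq> {..<n} \<and> p \<le> m \<epsilon> x y n \<and>
        card ({..<n} - \<Lambda>) \<le> g \<epsilon> x y n \<and> dist z x < \<epsilon> \<and>
        (\<forall>j\<in>\<Lambda>. dist ((T ^^ (p + j)) z) ((T ^^ j) y) < \<epsilon>)"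
      using mg \<epsilon>(1) unfolding mg_product_property_def by meson
    have g: "g \<epsilon> x y n \<le> n" if "n \<ge> 1" for n
      using mg \<epsilon>(1) that unfolding mg_product_property_def by blast
    have "\<forall>\<^sub>F n in sequentially. \<forall>k\<in>I. a k \<le> avg (\<phi> k) n y"
      using I a by (simp add: eventually_ball_finite)
    then have "\<forall>\<^sub>F n in sequentially. n \<ge> max N N' \<and> (\<forall>k\<in>I. a k \<le> avg (\<phi> k) n y)"
      using eventually_ge_at_top by (rule eventually_conj[rotated])
    from frequently_eventually_frequently[OF lim[OF \<epsilon>(1), of x y] this]
    obtain n where n: "n \<ge> N" "n \<ge> N'" "\<And>k. k \<in> I \<Longrightarrow> a k \<le> avg (\<phi> k) n y"
      and \<kappa>: "real (m \<epsilon> x y n + g \<epsilon> x y n) / real (m \<epsilon> x y n + n) < \<kappa>"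
      by (auto dest!: frequently_ex)
    obtain z p \<Lambda> where z: "\<Lambda> \<subseteq> {..<n}" "p \<le> m \<epsilon> x y n" "card ({..<n} - \<Lambda>) \<le> g \<epsilon> x y n" "dist z x < \<epsilon>"
        "\<forall>j\<in>\<Lambda>. dist ((T ^^ (p + j)) z) ((T ^^ j) y) < \<epsilon>"
      using N'(2)[OF n(2)] by blast
    have n1: "n \<ge> 1" using n(2) N'(1) by simp
    define c where "c = card ({..<n} - \<Lambda>)"
    have "real (p + c) / real (p + n) \<le> real (m \<epsilon> x y n + g \<epsilon> x y n) / real (m \<epsilon> x y n + n)"
    proof -
      \<comment> \<open>since \<open>g \<le> n\<close>, the ratio increases with the delay\<close>
      have "(real p + real c) * (real (m \<epsilon> x y n) + real n) \<le> (real p + real (g \<epsilon> x y n)) * (real (m \<epsilon> x y n) + real n)"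
        using z(3) by (intro mult_right_mono) (auto simp: c_def)
      also have "\<dots> \<le> (real (m \<epsilon> x y n) + real (g \<epsilon> x y n)) * (real p + real n)"
      proof -
        have "0 \<le> (real (m \<epsilon> x y n) - real p) * (real n - real (g \<epsilon> x y n))"
          using z(2) g[OF n1] by (intro mult_nonneg_nonneg) auto
        then show ?thesis by (simp add: algebra_simps)
      qed
      finally show ?thesis using n1 by (simp add: divide_simps)
    qed
    then have less: "real (p + c) / real (p + n) < \<kappa>" using \<kappa> by simp
    have "a k - \<kappa> - \<omega> < avg (\<phi> k) (p + n) z" if k: "k \<in> I" for k
    proof -
      have "avg (\<phi> k) n y - \<omega> - real (p + c) / real (p + n) \<le> avg (\<phi> k) (p + n) z"
        unfolding c_def using z(5) \<epsilon>(3)[OF k] by (intro sh k n1 z(1)) force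
      then show ?thesis using less n(3)[OF k] by linarith
    qed
    then have "z \<in> D" unfolding D_def using n(1) by (intro CollectI exI[of _ "p + n"]) auto
    moreover have "z \<in> V" using z(4) \<epsilon>(2) x(3) by (auto simp: dist_commute subset_iff)
    ultimately show "D \<inter> V \<noteq> {}" by blast
  qed
qed

lemma generic_point:
  assumes "\<mu> \<in> ergodic_measures T" and "\<And>i. continuous_on UNIV (\<phi> i :: 'a \<Rightarrow> real)"
  shows "\<exists>y. \<forall>i::nat. (\<lambda>n. avg (\<phi> i) n y) \<longlonglongrightarrow> (\<integral>x. \<phi> i x \<partial>\<mu>)"
proof -
  have bp: "\<mu> \<in> borel_probs" using assms(1) by (simp add: ergodic_measures_def invariant_measures_def)
  interpret prob_space \<mu> using borel_probsD[OF bp] by simp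
  have "AE y in \<mu>. \<forall>i. (\<lambda>n. avg (\<phi> i) n y) \<longlonglongrightarrow> (\<integral>x. \<phi> i x \<partial>\<mu>)"
  proof (rule iffD2[OF AE_all_countable], rule allI)
    fix i
    obtain B where "\<And>x. \<bar>\<phi> i x\<bar> \<le> B" using compact_continuous_bounded[OF comp assms(2)[of i]] by blast
    then show "AE y in \<mu>. (\<lambda>n. avg (\<phi> i) n y) \<longlonglongrightarrow> (\<integral>x. \<phi> i x \<partial>\<mu>)"
      by (rule ergodic_average_tendsto[OF assms(1) measT borel_measurable_continuous_onI[OF assms(2)]])
  qed
  then show ?thesis by (rule eventually_happens'[OF ae_filter_bot])
qed

text \<open>Shadowing a generic point with an arbitrarily small lost fraction; a point in the
  intersection of the resulting dense open sets comes close to \<open>\<mu>\<close> at infinitely many times.\<close>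

theorem mg_product_ergodic_dense:
  assumes mg: "mg_product_property T m g"
    and lim: "\<And>\<epsilon> x y \<kappa>. \<epsilon> > 0 \<Longrightarrow> \<kappa> > 0 \<Longrightarrow>
      \<exists>\<^sub>F n in sequentially. real (m \<epsilon> x y n + g \<epsilon> x y n) / real (m \<epsilon> x y n + n) < \<kappa>"
  shows "ergodic_measures T \<subseteq> M_dense f T"
proof
  fix \<mu> assume \<mu>: "\<mu> \<in> ergodic_measures T"
  have inv: "\<mu> \<in> invariant_measures T" using \<mu> by (simp add: ergodic_measures_def)
  then have bp: "\<mu> \<in> borel_probs" by (simp add: invariant_measures_def)
  define \<alpha> where "\<alpha> i = (\<integral>x. f i x \<partial>\<mu>)" for i
  obtain y where y: "\<And>i. (\<lambda>n. avg (f i) n y) \<longlonglongrightarrow> \<alpha> i"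
    using generic_point[OF \<mu>, of "\<lambda>i x. f i x", OF cont_f] unfolding \<alpha>_def by blast
  show "\<mu> \<in> M_dense f T"
  proof (rule M_denseI[OF inv])
    fix \<epsilon> :: real and U :: "'a set" assume eps: "\<epsilon> > 0" and U: "open U" "U \<noteq> {}"
    obtain K \<delta> where \<delta>: "\<delta> > 0" and ctl: "tests_control_rho K \<delta> \<epsilon>"
      using rho_small[OF eps] by blast
    note * = ctl[unfolded tests_control_rho_def]
    \<comment> \<open>a two-sided bound on \<open>f i\<close> is a pair of lower bounds for the functions \<open>(1 \<plusminus> f i) / 2\<close>\<close>
    define \<phi> where "\<phi> = (\<lambda>(\<sigma>::real, i) x. (1 + \<sigma> * f i x) / 2)"
    define I where "I = {1, -1 :: real} \<times> {1..K}"
    define a where "a = (\<lambda>(\<sigma>::real, i). (1 + \<sigma> * \<alpha> i) / 2 - \<delta>/8)"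
    have I: "finite I" by (simp add: I_def)
    have c: "continuous_on UNIV (\<phi> k)" for k
      unfolding \<phi>_def by (cases k) (auto intro!: continuous_intros cont_f)
    have b: "0 \<le> \<phi> k x \<and> \<phi> k x \<le> 1" if "k \<in> I" for k x
      using that f_le1[of "snd k" x] by (auto simp: I_def \<phi>_def abs_le_iff)
    have avg\<phi>: "avg (\<phi> (\<sigma>, i)) n z = (1 + \<sigma> * avg (f i) n z) / 2" if "n \<ge> 1" for \<sigma> i n z
    proof -
      have "(\<Sum>j<n. \<phi> (\<sigma>, i) ((T ^^ j) z)) = (real n + \<sigma> * (\<Sum>j<n. f i ((T ^^ j) z))) / 2"
        by (simp add: \<phi>_def sum_divide_distrib[symmetric] sum.distrib sum_distrib_left)
      then show ?thesis using that unfolding birkhoff_average_def by (simp add: field_simps)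
    qed
    have ev: "\<forall>\<^sub>F n in sequentially. a k \<le> avg (\<phi> k) n y" if "k \<in> I" for k
    proof -
      obtain \<sigma> i where k: "k = (\<sigma>, i)" by (cases k)
      have "(\<lambda>n. (1 + \<sigma> * avg (f i) n y) / 2) \<longlonglongrightarrow> (1 + \<sigma> * \<alpha> i) / 2"
        by (intro tendsto_intros y) simp
      then have "\<forall>\<^sub>F n in sequentially. a k < (1 + \<sigma> * avg (f i) n y) / 2"
      proof (rule order_tendstoD)
        show "a k < (1 + \<sigma> * \<alpha> i) / 2" using \<delta> by (simp only: a_def k prod.case)
      qed
      then show ?thesis
        using eventually_ge_at_top[of 1] by eventually_elim (simp add: k avg\<phi>)
    qed
    define D where "D N = {z. \<exists>n\<ge>N. \<forall>k\<in>I. a k - \<delta>/8 - \<delta>/8 < avg (\<phi> k) n z}" for N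
    have D: "open (D N)" "closure (D N) = UNIV" for N
      using mg_product_open_dense[where I = I and \<phi> = \<phi> and a = a and y = y and \<kappa> = "\<delta>/8" and \<omega> = "\<delta>/8" and N = N,
          OF mg lim I c b ev] \<delta> unfolding D_def by auto
    have "closure (\<Inter>N. D N) = UNIV" by (rule Baire_compact[OF comp D])
    then have "(\<Inter>N. D N) \<inter> U \<noteq> {}" using U unfolding closure_eq_UNIV_iff by blast
    then obtain x where x: "x \<in> U" "\<And>N. x \<in> D N" by blast
    have "\<exists>\<^sub>F n in sequentially. n \<ge> 1 \<and> rho f \<mu> (emp x n) < \<epsilon>"
      unfolding frequently_sequentially
    proof
      fix N
      obtain n where n: "n \<ge> max 1 N" and nk: "\<And>k. k \<in> I \<Longrightarrow> a k - \<delta>/8 - \<delta>/8 < avg (\<phi> k) n x"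
        using x(2)[of "max 1 N"] unfolding D_def by blast
      have "\<bar>(\<integral>x. f i x \<partial>\<mu>) - (\<integral>y. f i y \<partial>emp x n)\<bar> \<le> \<delta>" if "1 \<le> i \<and> i \<le> K" for i
      proof -
        have "(1, i) \<in> I" "(-1, i) \<in> I" using that by (auto simp: I_def)
        from nk[OF this(1)] nk[OF this(2)] have "\<bar>\<alpha> i - avg (f i) n x\<bar> \<le> \<delta>"
          using n by (simp add: avg\<phi>) (simp add: a_def abs_le_iff field_simps)
        then show ?thesis
          using n integral_empirical[OF borel_measurable_continuous_onI[OF cont_f[of i]], of n x] by (simp add: \<alpha>_def)
      qed
      then have "rho f \<mu> (emp x n) < \<epsilon>" using * bp empirical_borel_prob[of n x] n by simp
      then show "\<exists>n\<ge>N. n \<ge> 1 \<and> rho f \<mu> (emp x n) < \<epsilon>" using n by auto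
    qed
    then show "\<exists>x\<in>U. \<exists>\<^sub>F n in sequentially. n \<ge> 1 \<and> rho f \<mu> (emp x n) < \<epsilon>" using x(1) by blast
  qed
qed

text \<open>Distinct ergodic measures are mutually singular; here this is realised by a continuous
  function, a long Birkhoff average of a function with different integrals, clamped to the unit
  interval.\<close>

lemma ergodic_separation:
  assumes \<mu>: "\<mu> \<in> ergodic_measures T" and \<nu>: "\<nu> \<in> ergodic_measures T"
    and \<psi>: "continuous_on UNIV (\<psi> :: 'a \<Rightarrow> real)" and less: "(\<integral>x. \<psi> x \<partial>\<mu>) < (\<integral>x. \<psi> x \<partial>\<nu>)" and "(\<eta>::real) > 0"
  shows "\<exists>\<phi> :: 'a \<Rightarrow> real. continuous_on UNIV \<phi> \<and> (\<forall>x. 0 \<le> \<phi> x \<and> \<phi> x \<le> 1) \<and>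
    (\<integral>x. \<phi> x \<partial>\<mu>) < \<eta> \<and> 1 - \<eta> < (\<integral>x. \<phi> x \<partial>\<nu>)"
proof -
  define a where "a = (\<integral>x. \<psi> x \<partial>\<nu>)"
  define b where "b = (\<integral>x. \<psi> x \<partial>\<mu>)"
  have ab: "b < a" using less by (simp add: a_def b_def)
  define C where "C t = max 0 (min 1 ((t - b) / (a - b)))" for t :: real
  have Cc: "continuous_on UNIV C" unfolding C_def divide_inverse by (intro continuous_intros)
  have Cb: "0 \<le> C t \<and> C t \<le> 1" for t by (simp add: C_def)
  have Cab: "C a = 1" "C b = 0" using ab by (simp_all add: C_def)
  define \<phi> where "\<phi> n x = C (avg \<psi> n x)" for n x
  have \<phi>c: "continuous_on UNIV (\<phi> n)" for n
    unfolding \<phi>_def by (rule continuous_on_compose2[OF Cc cont_avg[OF \<psi>]]) simp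
  have lim: "(\<lambda>n. \<integral>x. \<phi> n x \<partial>\<mu>') \<longlonglongrightarrow> C (\<integral>x. \<psi> x \<partial>\<mu>')" if \<mu>': "\<mu>' \<in> ergodic_measures T" for \<mu>'
  proof -
    have bp: "\<mu>' \<in> borel_probs" using \<mu>' by (simp add: ergodic_measures_def invariant_measures_def)
    interpret prob_space \<mu>' using borel_probsD[OF bp] by simp
    obtain B where B: "\<And>x. \<bar>\<psi> x\<bar> \<le> B" using compact_continuous_bounded[OF comp \<psi>] by blast
    have "AE x in \<mu>'. (\<lambda>n. avg \<psi> n x) \<longlonglongrightarrow> (\<integral>x. \<psi> x \<partial>\<mu>')"
      by (rule ergodic_average_tendsto[OF \<mu>' measT borel_measurable_continuous_onI[OF \<psi>] B])
    then have AE: "AE x in \<mu>'. (\<lambda>n. \<phi> n x) \<longlonglongrightarrow> C (\<integral>x. \<psi> x \<partial>\<mu>')"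
    proof eventually_elim
      case (elim x)
      show ?case unfolding \<phi>_def by (rule continuous_on_tendsto_compose[OF Cc elim]) auto
    qed
    have "(\<lambda>n. \<integral>x. \<phi> n x \<partial>\<mu>') \<longlonglongrightarrow> (\<integral>x. C (\<integral>x. \<psi> x \<partial>\<mu>') \<partial>\<mu>')"
    proof (rule integral_dominated_convergence[where w = "\<lambda>x. 1"])
      show "\<phi> n \<in> borel_measurable \<mu>'" for n
        using borel_measurable_integrable[OF integrable_cont[OF bp \<phi>c]] .
      show "AE x in \<mu>'. norm (\<phi> n x) \<le> 1" for n using Cb by (simp add: \<phi>_def)
    qed (use AE in auto)
    then show ?thesis by (simp add: prob_space)
  qed
  have "\<forall>\<^sub>F n in sequentially. (\<integral>x. \<phi> n x \<partial>\<mu>) < \<eta>"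
    using lim[OF \<mu>] Cab(2) \<open>\<eta> > 0\<close> by (intro order_tendstoD(2)) (auto simp: b_def)
  moreover have "\<forall>\<^sub>F n in sequentially. 1 - \<eta> < (\<integral>x. \<phi> n x \<partial>\<nu>)"
    using lim[OF \<nu>] Cab(1) \<open>\<eta> > 0\<close> by (intro order_tendstoD(1)) (auto simp: a_def)
  ultimately have "\<forall>\<^sub>F n in sequentially. (\<integral>x. \<phi> n x \<partial>\<mu>) < \<eta> \<and> 1 - \<eta> < (\<integral>x. \<phi> n x \<partial>\<nu>)"
    by (rule eventually_conj)
  then obtain n where "(\<integral>x. \<phi> n x \<partial>\<mu>) < \<eta> \<and> 1 - \<eta> < (\<integral>x. \<phi> n x \<partial>\<nu>)"
    by (auto simp: eventually_sequentially)
  then show ?thesis using \<phi>c Cb by (intro exI[of _ "\<phi> n"]) (auto simp: \<phi>_def)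
qed

text \<open>With less than half of the time lost, the averages of the separating function at a residual
  point exceed a number \<open>c > 1/2\<close> infinitely often, from shadowing a generic point of \<open>\<nu>\<close>, and fall
  below \<open>1 - c\<close> infinitely often, from shadowing one of \<open>\<mu>\<close>. Both resulting accumulation points
  count, since the point may be taken with dense orbit.\<close>

theorem mg_transitive_two_dense:
  assumes \<kappa>: "\<kappa> < 1/2" and nue: "\<not> uniquely_ergodic T"
    and mg: "mg_product_property T m g" and tr: "transitive T"
    and lim: "\<And>\<epsilon> x y. \<epsilon> > 0 \<Longrightarrow>
      \<exists>\<^sub>F n in sequentially. real (m \<epsilon> x y n + g \<epsilon> x y n) / real (m \<epsilon> x y n + n) < \<kappa>"
  shows "\<exists>\<mu>\<in>M_dense f T. \<exists>\<nu>\<in>M_dense f T. \<mu> \<noteq> \<nu>"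
proof -
  \<comment> \<open>small enough that \<open>1 - \<kappa> - 2 * \<eta>\<close> still exceeds \<open>1/2\<close>\<close>
  define \<eta> where "\<eta> = (1/2 - \<kappa>) / 3"
  have \<eta>: "\<eta> > 0" using \<kappa> by (simp add: \<eta>_def)
  obtain \<mu> \<nu> i where e: "\<mu> \<in> ergodic_measures T" "\<nu> \<in> ergodic_measures T" "(\<integral>x. f i x \<partial>\<mu>) < (\<integral>x. f i x \<partial>\<nu>)"
    using not_uniquely_ergodic_two_ergodic[OF nue] by blast
  obtain \<phi> where \<phi>: "continuous_on UNIV \<phi>" "\<And>x. 0 \<le> \<phi> x \<and> \<phi> x \<le> 1"
    and \<phi>i: "(\<integral>x. \<phi> x \<partial>\<mu>) < \<eta>" "1 - \<eta> < (\<integral>x. \<phi> x \<partial>\<nu>)"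
    using ergodic_separation[OF e(1,2) cont_f e(3) \<eta>] by blast
  have \<phi>'c: "continuous_on UNIV (\<lambda>x. 1 - \<phi> x)" by (intro continuous_intros \<phi>)
  have avg': "avg (\<lambda>x. 1 - \<phi> x) n x = 1 - avg \<phi> n x" if "n \<ge> 1" for n x
    using that by (simp add: birkhoff_average_def sum_subtractf field_simps)
  obtain y where y: "(\<lambda>n. avg \<phi> n y) \<longlonglongrightarrow> (\<integral>x. \<phi> x \<partial>\<nu>)"
    using generic_point[OF e(2), of "\<lambda>_. \<phi>"] \<phi>(1) by auto
  obtain y' where y': "(\<lambda>n. avg \<phi> n y') \<longlonglongrightarrow> (\<integral>x. \<phi> x \<partial>\<mu>)"
    using generic_point[OF e(1), of "\<lambda>_. \<phi>"] \<phi>(1) by auto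
  have ev: "\<forall>\<^sub>F n in sequentially. 1 - \<eta> \<le> avg \<phi> n y"
    using order_tendstoD(1)[OF y \<phi>i(2)] by eventually_elim simp
  have ev': "\<forall>\<^sub>F n in sequentially. 1 - \<eta> \<le> avg (\<lambda>x. 1 - \<phi> x) n y'"
    using order_tendstoD(2)[OF y' \<phi>i(1)] eventually_ge_at_top[of 1]
    by eventually_elim (simp add: avg')
  define D1 where "D1 N = {z. \<exists>n\<ge>N. 1 - \<eta> - \<kappa> - \<eta> < avg \<phi> n z}" for N
  define D2 where "D2 N = {z. \<exists>n\<ge>N. 1 - \<eta> - \<kappa> - \<eta> < avg (\<lambda>x. 1 - \<phi> x) n z}" for N
  have D1: "open (D1 N)" "closure (D1 N) = UNIV" for N
    using mg_product_open_dense[where I = "{()}" and \<phi> = "\<lambda>_. \<phi>" and a = "\<lambda>_. 1 - \<eta>" and y = y and \<kappa> = \<kappa> and \<omega> = \<eta> and N = N,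
        OF mg lim _ \<phi> ev \<eta>] unfolding D1_def by auto
  have D2: "open (D2 N)" "closure (D2 N) = UNIV" for N
    using mg_product_open_dense[where I = "{()}" and \<phi> = "\<lambda>_ x. 1 - \<phi> x" and a = "\<lambda>_. 1 - \<eta>" and y = y' and \<kappa> = \<kappa> and \<omega> = \<eta> and N = N,
        OF mg lim _ \<phi>'c _ ev' \<eta>] \<phi>(2) unfolding D2_def by auto
  obtain D0 :: "nat \<Rightarrow> 'a set" where D0: "\<And>i. open (D0 i)" "\<And>i. closure (D0 i) = UNIV"
    and dense: "\<And>x. (\<forall>i. x \<in> D0 i) \<Longrightarrow> closure (range (\<lambda>n. (T ^^ n) x)) = UNIV"
    using transitive_residual_dense_orbit[OF tr] by blast
  define E where "E n = (case sum_decode n of Inl i \<Rightarrow> D0 i | Inr j \<Rightarrow>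
    (case sum_decode j of Inl i \<Rightarrow> D1 i | Inr i \<Rightarrow> D2 i))" for n
  have "open (E n)" "closure (E n) = UNIV" for n
    unfolding E_def by (auto simp: D0 D1 D2 split: sum.splits)
  then have cl: "closure (\<Inter>n. E n) = UNIV" by (intro Baire_compact[OF comp])
  have "(\<Inter>n. E n) \<noteq> {}"
  proof
    assume "(\<Inter>n. E n) = {}"
    with cl show False by simp
  qed
  then obtain x where x: "\<And>n. x \<in> E n" by blast
  have x0: "x \<in> D0 i" for i using x[of "sum_encode (Inl i)"] by (simp add: E_def)
  have x1: "x \<in> D1 i" for i using x[of "sum_encode (Inr (sum_encode (Inl i)))"] by (simp add: E_def)
  have x2: "x \<in> D2 i" for i using x[of "sum_encode (Inr (sum_encode (Inr i)))"] by (simp add: E_def)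
  have sub: "limit_measures T x \<subseteq> M_dense f T"
    using x0 by (intro dense_orbit_limit_measures dense) blast
  define c where "c = 1 - \<eta> - \<kappa> - \<eta>"
  have "\<exists>\<^sub>F n in sequentially. c < avg \<phi> n x"
    using x1 unfolding frequently_sequentially D1_def c_def by blast
  then obtain \<nu>1 r1 where \<nu>1: "\<nu>1 \<in> limit_measures T x" "\<And>k. c < avg \<phi> (r1 k) x"
    "(\<lambda>k. avg \<phi> (r1 k) x) \<longlonglongrightarrow> (\<integral>y. \<phi> y \<partial>\<nu>1)"
    using limit_measure_along[of "\<lambda>n. c < avg \<phi> n x" x] \<phi>(1) by blast
  have ge: "c \<le> (\<integral>y. \<phi> y \<partial>\<nu>1)"
    using \<nu>1(2) by (intro LIMSEQ_le_const[OF \<nu>1(3)]) (auto intro: less_imp_le)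
  have "\<exists>\<^sub>F n in sequentially. c < avg (\<lambda>x. 1 - \<phi> x) n x"
    using x2 unfolding frequently_sequentially D2_def c_def by blast
  then obtain \<nu>2 r2 where \<nu>2: "\<nu>2 \<in> limit_measures T x" "\<And>k. c < avg (\<lambda>x. 1 - \<phi> x) (r2 k) x"
    "(\<lambda>k. avg (\<lambda>x. 1 - \<phi> x) (r2 k) x) \<longlonglongrightarrow> (\<integral>y. 1 - \<phi> y \<partial>\<nu>2)"
    using limit_measure_along[of "\<lambda>n. c < avg (\<lambda>x. 1 - \<phi> x) n x" x] \<phi>'c by blast
  have bp2: "\<nu>2 \<in> borel_probs" using \<nu>2(1) by (simp add: limit_measures_iff)
  interpret prob_space \<nu>2 using borel_probsD[OF bp2] by simp
  have "c \<le> (\<integral>y. 1 - \<phi> y \<partial>\<nu>2)"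
    using \<nu>2(2) by (intro LIMSEQ_le_const[OF \<nu>2(3)]) (auto intro: less_imp_le)
  also have "\<dots> = 1 - (\<integral>y. \<phi> y \<partial>\<nu>2)" using integrable_cont[OF bp2 \<phi>(1)] by (simp add: prob_space)
  finally have "(\<integral>y. \<phi> y \<partial>\<nu>2) \<le> 1 - c" by simp
  moreover have "1 - c < c" using \<kappa> unfolding c_def \<eta>_def by (simp add: field_simps)
  ultimately have "\<nu>1 \<noteq> \<nu>2" using ge by auto
  then show ?thesis using sub \<nu>1(1) \<nu>2(1) by blast
qed

end

section \<open>Choosing points whose averages follow an invariant measure\<close>

lemma invariant_integral_funpow:
  fixes T :: "'a::topological_space \<Rightarrow> 'a" and \<phi> :: "'a \<Rightarrow> real"
  assumes "\<mu> \<in> invariant_measures T" "T \<in> measurable borel borel" "\<phi> \<in> borel_measurable borel"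
  shows "(\<integral>x. \<phi> ((T ^^ j) x) \<partial>\<mu>) = (\<integral>x. \<phi> x \<partial>\<mu>)"
proof (induction j)
  case (Suc j)
  have "(\<lambda>x. \<phi> ((T ^^ j) x)) \<in> borel_measurable borel"
    using measurable_compose[OF borel_measurable_funpow[OF assms(2)] assms(3)] .
  from invariant_integral[OF assms(1,2) this] show ?case using Suc by (simp add: funpow_swap1)
qed simp

text \<open>The expected number of visits is \<open>\<mu> A * card J\<close> by invariance, and some point does at least
  as well as the mean.\<close>

lemma frequent_visits:
  fixes T :: "'a::topological_space \<Rightarrow> 'a"
  assumes \<mu>: "\<mu> \<in> invariant_measures T" and T: "T \<in> measurable borel borel"
    and A: "A \<in> sets borel" and J: "finite J"
  shows "\<exists>y. measure \<mu> A * real (card J) \<le> real (card {j\<in>J. (T ^^ j) y \<in> A})"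
proof (rule ccontr)
  assume neg: "\<not> ?thesis"
  have bp: "\<mu> \<in> borel_probs" using \<mu> by (simp add: invariant_measures_def)
  interpret prob_space \<mu> using borel_probsD[OF bp] by simp
  have sets: "sets \<mu> = sets borel" using borel_probsD[OF bp] by simp
  define X where "X y = (\<Sum>j\<in>J. indicator A ((T ^^ j) y) :: real)" for y
  have Am: "(indicator A :: 'a \<Rightarrow> real) \<in> borel_measurable borel" using A by simp
  have jm: "(\<lambda>y. indicator A ((T ^^ j) y) :: real) \<in> borel_measurable borel" for j
    using measurable_compose[OF borel_measurable_funpow[OF T] Am] .
  have ij: "integrable \<mu> (\<lambda>y. indicator A ((T ^^ j) y) :: real)" for j
    by (rule integrable_bounded_borel[OF bp jm, where B = 1]) (simp add: indicator_def)
  have iX: "integrable \<mu> X" unfolding X_def by (intro Bochner_Integration.integrable_sum ij)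
  have X: "X y = real (card {j\<in>J. (T ^^ j) y \<in> A})" for y
    using J by (simp add: X_def indicator_def sum.If_cases Int_def)
  have "expectation X = (\<Sum>j\<in>J. expectation (\<lambda>y. indicator A ((T ^^ j) y)))"
    unfolding X_def by (intro Bochner_Integration.integral_sum ij)
  also have "\<dots> = (\<Sum>j\<in>J. expectation (indicator A))"
    by (intro sum.cong refl invariant_integral_funpow[OF \<mu> T Am])
  also have "\<dots> = prob A * real (card J)" using A sets by simp
  finally have e: "expectation X = prob A * real (card J)" .
  have "expectation X < prob A * real (card J)"
    using neg X by (intro expectation_less[OF iX]) (auto simp: not_le)
  then show False using e by simp
qed

text \<open>Greedy choice: always pick a point whose deviation from the mean has nonpositive inner
  product with the deviation accumulated so far, which exists because the deviations integrate to
  0. Squared norms then grow at most linearly, so the accumulated deviation is \<open>O(\<surd>n)\<close>.\<close>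

lemma greedy_averaging_sequence:
  fixes F :: "nat \<Rightarrow> 'a::metric_space \<Rightarrow> real"
  assumes comp: "compact (UNIV :: 'a set)" and \<mu>: "\<mu> \<in> borel_probs"
    and F: "\<And>k. continuous_on UNIV (F k)" "\<And>k x. k < K \<Longrightarrow> \<bar>F k x - (\<integral>x. F k x \<partial>\<mu>)\<bar> \<le> C"
    and "e > 0"
  shows "\<exists>y. \<forall>\<^sub>F n in sequentially. \<forall>k<K. \<bar>(\<Sum>i<n. F k (y i)) - real n * (\<integral>x. F k x \<partial>\<mu>)\<bar> \<le> e * real n"
proof -
  interpret prob_space \<mu> using borel_probsD[OF \<mu>] by simp
  define G where "G k x = F k x - (\<integral>x. F k x \<partial>\<mu>)" for k x
  have iF: "integrable \<mu> (F k)" for k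
  proof -
    obtain B where "\<And>x. \<bar>F k x\<bar> \<le> B" using compact_continuous_bounded[OF comp F(1)[of k]] by blast
    then show ?thesis by (rule integrable_bounded_borel[OF \<mu> borel_measurable_continuous_onI[OF F(1)]])
  qed
  have "\<exists>x. (\<Sum>k<K. s k * G k x) \<le> 0" for s :: "nat \<Rightarrow> real"
  proof (rule ccontr)
    assume neg: "\<not> ?thesis"
    have int: "integrable \<mu> (\<lambda>x. - (\<Sum>k<K. s k * G k x))" unfolding G_def using iF by simp
    have "expectation (\<lambda>x. - (\<Sum>k<K. s k * G k x)) < 0"
      using neg by (intro expectation_less[OF int]) (auto simp: not_le)
    moreover have "expectation (\<lambda>x. \<Sum>k<K. s k * G k x) = (\<Sum>k<K. expectation (\<lambda>x. s k * G k x))"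
      unfolding G_def using iF by (intro Bochner_Integration.integral_sum) simp
    moreover have "(\<Sum>k<K. expectation (\<lambda>x. s k * G k x)) = 0"
    proof (intro sum.neutral ballI)
      show "expectation (\<lambda>x. s k * G k x) = 0" for k
        unfolding G_def using iF by (simp add: prob_space)
    qed
    ultimately show False by simp
  qed
  then obtain next_pt where np: "\<And>s. (\<Sum>k<K. s k * G k (next_pt s)) \<le> 0" by metis
  define S where "S = rec_nat (\<lambda>_. 0) (\<lambda>_ s k. s k + G k (next_pt s))"
  have S0: "S 0 = (\<lambda>_. 0)" and SS: "S (Suc n) k = S n k + G k (next_pt (S n))" for n k
    by (simp_all add: S_def)
  define y where "y n = next_pt (S n)" for n
  have Seq: "S n k = (\<Sum>i<n. F k (y i)) - real n * (\<integral>x. F k x \<partial>\<mu>)" for n k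
    by (induction n) (auto simp: S0 SS G_def y_def algebra_simps)
  have V: "(\<Sum>k<K. (S n k)\<^sup>2) \<le> real n * (real K * C\<^sup>2)" for n
  proof (induction n)
    case (Suc n)
    have "(\<Sum>k<K. (S (Suc n) k)\<^sup>2) = (\<Sum>k<K. (S n k)\<^sup>2) + 2 * (\<Sum>k<K. S n k * G k (y n)) + (\<Sum>k<K. (G k (y n))\<^sup>2)"
      by (simp add: SS y_def power2_sum sum.distrib sum_distrib_left algebra_simps)
    moreover have "(\<Sum>k<K. S n k * G k (y n)) \<le> 0" unfolding y_def by (rule np)
    moreover have "(\<Sum>k<K. (G k (y n))\<^sup>2) \<le> (\<Sum>k<K. C\<^sup>2)"
    proof (rule sum_mono)
      fix k assume "k \<in> {..<K}"
      then have "\<bar>G k (y n)\<bar> \<le> C" using F(2) by (simp add: G_def)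
      then show "(G k (y n))\<^sup>2 \<le> C\<^sup>2" using power_mono[of "\<bar>G k (y n)\<bar>" C 2] by simp
    qed
    ultimately show ?case using Suc by (simp add: algebra_simps)
  qed (simp add: S0)
  have "\<forall>\<^sub>F n in sequentially. real n \<ge> real K * C\<^sup>2 / e\<^sup>2"
    using filterlim_real_sequentially unfolding filterlim_at_top by blast
  then have "\<forall>\<^sub>F n in sequentially. \<forall>k<K. \<bar>S n k\<bar> \<le> e * real n"
  proof eventually_elim
    case (elim n)
    have "real K * C\<^sup>2 \<le> e\<^sup>2 * real n" using elim \<open>e > 0\<close> by (simp add: field_simps)
    then have "real n * (real K * C\<^sup>2) \<le> real n * (e\<^sup>2 * real n)" by (intro mult_left_mono) auto
    also have "\<dots> = (e * real n)\<^sup>2" by (simp add: power2_eq_square)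
    finally have *: "(\<Sum>k<K. (S n k)\<^sup>2) \<le> (e * real n)\<^sup>2" using V[of n] by linarith
    have "\<bar>S n k\<bar> \<le> e * real n" if "k < K" for k
    proof -
      have "(S n k)\<^sup>2 \<le> (\<Sum>k<K. (S n k)\<^sup>2)" using that by (intro member_le_sum) auto
      then have "\<bar>S n k\<bar>\<^sup>2 \<le> (e * real n)\<^sup>2" using * by simp
      then show ?thesis by (rule power2_le_imp_le) (use \<open>e > 0\<close> in simp)
    qed
    then show ?case by blast
  qed
  then show ?thesis unfolding Seq by (rule exI[of _ y])
qed

section \<open>The approximate product property\<close>

context compact_system
begin

lemma birkhoff_average_shift_iter:
  assumes "\<And>x. \<bar>\<phi> x\<bar> \<le> B"
  shows "\<bar>avg \<phi> n ((T ^^ j) x) - avg \<phi> n x\<bar> \<le> real j * (2 * B / real n)"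
proof (induction j)
  case (Suc j)
  have "\<bar>avg \<phi> n (T ((T ^^ j) x)) - avg \<phi> n ((T ^^ j) x)\<bar> \<le> 2 * B / real n"
    by (rule birkhoff_average_shift[OF assms])
  then show ?case using Suc by (simp add: algebra_simps add_divide_distrib)
qed simp

lemma invariant_integral_avg:
  assumes \<mu>: "\<mu> \<in> invariant_measures T" and \<phi>: "continuous_on UNIV (\<phi> :: 'a \<Rightarrow> real)" and "n \<ge> 1"
  shows "(\<integral>x. avg \<phi> n x \<partial>\<mu>) = (\<integral>x. \<phi> x \<partial>\<mu>)"
proof -
  have bp: "\<mu> \<in> borel_probs" using \<mu> by (simp add: invariant_measures_def)
  have i: "integrable \<mu> (\<lambda>x. \<phi> ((T ^^ j) x))" for j
    by (rule integrable_cont[OF bp]) (rule continuous_on_compose2[OF \<phi> cont_iter], simp)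
  have "(\<integral>x. avg \<phi> n x \<partial>\<mu>) = (\<integral>x. (\<Sum>j<n. \<phi> ((T ^^ j) x)) \<partial>\<mu>) / real n"
    unfolding birkhoff_average_def by (rule integral_divide_zero)
  also have "(\<integral>x. (\<Sum>j<n. \<phi> ((T ^^ j) x)) \<partial>\<mu>) = (\<Sum>j<n. \<integral>x. \<phi> ((T ^^ j) x) \<partial>\<mu>)"
    by (intro Bochner_Integration.integral_sum i)
  also have "\<dots> = real n * (\<integral>x. \<phi> x \<partial>\<mu>)"
    by (simp add: invariant_integral_funpow[OF \<mu> measT borel_measurable_continuous_onI[OF \<phi>]])
  finally show ?thesis using \<open>n \<ge> 1\<close> by simp
qed

lemma measure_center_positive:
  assumes "measure_center T = UNIV" "open U" "U \<noteq> {}"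
  shows "\<exists>\<nu>\<in>invariant_measures T. measure \<nu> U > 0"
proof -
  have "(\<Union>\<nu>\<in>invariant_measures T. msupport \<nu>) \<inter> U \<noteq> {}"
    using assms unfolding measure_center_def closure_eq_UNIV_iff by blast
  then obtain \<nu> x where \<nu>: "\<nu> \<in> invariant_measures T" "x \<in> msupport \<nu>" "x \<in> U" by blast
  have "emeasure \<nu> U > 0" using \<nu> assms(2) unfolding msupport_def by blast
  interpret prob_space \<nu>
    using \<nu>(1) borel_probsD(1) by (auto simp: invariant_measures_def)
  show ?thesis using \<nu>(1) \<open>emeasure \<nu> U > 0\<close> by (auto simp: emeasure_eq_measure)
qed

lemma sum_lessThan_add:
  fixes a b :: nat
  shows "(\<Sum>i<a + b. g i) = (\<Sum>i<a. g i) + (\<Sum>i<b. g (a + i) :: real)"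
  by (induction b) simp_all

text \<open>The tracing orbit spends one block near \<open>w\<close>, outside few exceptional times and up to a short
  gap before the next block.\<close>

lemma traced_block_sum:
  fixes \<phi> :: "'a \<Rightarrow> real"
  assumes \<phi>: "\<And>x. \<bar>\<phi> x\<bar> \<le> 1" and uc: "\<And>a b. dist a b < \<epsilon> \<Longrightarrow> \<bar>\<phi> a - \<phi> b\<bar> \<le> \<omega>" and "\<omega> \<ge> 0" and n: "n \<ge> 1"
    and len: "real n \<le> real l" "real l \<le> real n * (1 + \<delta>2)"
    and bad: "real (card {j. j < n \<and> dist ((T ^^ j) x) ((T ^^ j) w) \<ge> \<epsilon>}) \<le> \<delta>1 * real n"
  shows "\<bar>(\<Sum>j<l. \<phi> ((T ^^ j) x)) - real n * avg \<phi> n w\<bar> \<le> real n * (\<omega> + 2 * \<delta>1 + \<delta>2)"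
proof -
  let ?b = "{j. j < n \<and> dist ((T ^^ j) x) ((T ^^ j) w) \<ge> \<epsilon>}"
  have "real n * avg \<phi> n w = (\<Sum>j<n. \<phi> ((T ^^ j) w))" using n by (simp add: birkhoff_average_def)
  moreover have "(\<Sum>j<l. \<phi> ((T ^^ j) x)) = (\<Sum>j<n. \<phi> ((T ^^ j) x)) + (\<Sum>j\<in>{n..<l}. \<phi> ((T ^^ j) x))"
    using len(1) by (subst sum.union_disjoint[symmetric]) (auto intro!: sum.cong)
  moreover have "\<bar>\<Sum>j\<in>{n..<l}. \<phi> ((T ^^ j) x)\<bar> \<le> real n * \<delta>2"
  proof -
    have "\<bar>\<Sum>j\<in>{n..<l}. \<phi> ((T ^^ j) x)\<bar> \<le> (\<Sum>j\<in>{n..<l}. 1)"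
      by (rule order_trans[OF sum_abs]) (intro sum_mono \<phi>)
    also have "\<dots> = real l - real n" using len(1) by simp
    also have "\<dots> \<le> real n * \<delta>2" using len(2) by (simp add: algebra_simps)
    finally show ?thesis .
  qed
  moreover have "\<bar>(\<Sum>j<n. \<phi> ((T ^^ j) x)) - (\<Sum>j<n. \<phi> ((T ^^ j) w))\<bar> \<le> real n * \<omega> + 2 * (\<delta>1 * real n)"
  proof -
    have "\<bar>(\<Sum>j<n. \<phi> ((T ^^ j) x)) - (\<Sum>j<n. \<phi> ((T ^^ j) w))\<bar> \<le> (\<Sum>j<n. \<bar>\<phi> ((T ^^ j) x) - \<phi> ((T ^^ j) w)\<bar>)"
      unfolding sum_subtractf[symmetric] by (rule sum_abs)
    also have "\<dots> \<le> (\<Sum>j<n. \<omega> + (if j \<in> ?b then 2 else 0))"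
    proof (rule sum_mono)
      fix j assume j: "j \<in> {..<n}"
      show "\<bar>\<phi> ((T ^^ j) x) - \<phi> ((T ^^ j) w)\<bar> \<le> \<omega> + (if j \<in> ?b then 2 else 0)"
      proof (cases "j \<in> ?b")
        case True
        then show ?thesis using \<phi>[of "(T ^^ j) x"] \<phi>[of "(T ^^ j) w"] \<open>\<omega> \<ge> 0\<close> by auto
      next
        case False
        then show ?thesis using uc[of "(T ^^ j) x" "(T ^^ j) w"] j by auto
      qed
    qed
    also have "\<dots> = real n * \<omega> + (\<Sum>j<n. (if j \<in> ?b then 2 else 0))" by (simp add: sum.distrib)
    also have "(\<Sum>j<n. (if j \<in> ?b then 2 else 0 :: real)) = 2 * real (card ?b)"
    proof -
      have "{..<n} \<inter> ?b = ?b" by auto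
      then show ?thesis by (simp only: sum.inter_restrict[symmetric] finite_lessThan sum_constant)
    qed
    finally show ?thesis using bad by simp
  qed
  ultimately show ?thesis by (simp add: algebra_simps)
qed

lemma uniformly_close_test_functions:
  assumes "\<omega> > 0"
  shows "\<exists>\<epsilon>>0. \<forall>i\<le>K. \<forall>a b. dist a b < \<epsilon> \<longrightarrow> \<bar>f i a - f i b\<bar> \<le> \<omega>"
proof (induction K)
  have one: "\<exists>\<epsilon>>0. \<forall>a b. dist a b < \<epsilon> \<longrightarrow> \<bar>f i a - f i b\<bar> \<le> \<omega>" for i
  proof -
    have "uniformly_continuous_on UNIV (\<lambda>x. f i x)" by (rule compact_uniformly_continuous[OF cont_f comp])
    then have "\<exists>\<epsilon>>0. \<forall>b a. dist a b < \<epsilon> \<longrightarrow> \<bar>f i a - f i b\<bar> < \<omega>"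
      using assms by (simp add: uniformly_continuous_on_def dist_real_def)
    then show ?thesis by (meson less_imp_le)
  qed
  {
    case 0
    then show ?case using one[of 0] by simp
  next
    case (Suc K)
    obtain \<epsilon> where "\<epsilon> > 0" "\<forall>i\<le>K. \<forall>a b. dist a b < \<epsilon> \<longrightarrow> \<bar>f i a - f i b\<bar> \<le> \<omega>"
      using Suc by auto
    moreover obtain \<epsilon>' where "\<epsilon>' > 0" "\<forall>a b. dist a b < \<epsilon>' \<longrightarrow> \<bar>f (Suc K) a - f (Suc K) b\<bar> \<le> \<omega>"
      using one[of "Suc K"] by auto
    ultimately show ?case by (intro exI[of _ "min \<epsilon> \<epsilon>'"]) (auto simp: le_Suc_eq)
  }
qed

text \<open>The first block leads into the given open set: by \<open>measure_center_positive\<close> some orbit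
  segment visits it with positive frequency, more often than tracing errors occur. All later
  blocks follow the greedy sequence, so the tracing point has averages close to \<open>\<mu>\<close>.\<close>

theorem approximate_product_all_dense:
  assumes ap: "approximate_product_property T" and center: "measure_center T = UNIV"
  shows "invariant_measures T \<subseteq> M_dense f T"
proof
  fix \<mu> assume \<mu>: "\<mu> \<in> invariant_measures T"
  then have bp: "\<mu> \<in> borel_probs" by (simp add: invariant_measures_def)
  define \<alpha> where "\<alpha> i = (\<integral>x. f i x \<partial>\<mu>)" for i
  have \<alpha>1: "\<bar>\<alpha> i\<bar> \<le> 1" if "i \<ge> 1" for i
    unfolding \<alpha>_def by (rule integral_abs_le[OF bp cont_f f_le1[OF that]])
  show "\<mu> \<in> M_dense f T"
  proof (rule M_denseI[OF \<mu>])
    fix \<epsilon> :: real and U :: "'a set" assume eps: "\<epsilon> > 0" and U: "open U" "U \<noteq> {}"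
    obtain K \<delta> where \<delta>: "\<delta> > 0" and ctl: "tests_control_rho K \<delta> \<epsilon>"
      using rho_small[OF eps] by blast
    note * = ctl[unfolded tests_control_rho_def]
    obtain u r where u: "r > 0" "ball u r \<subseteq> U" using U by (meson all_not_in_conv openE)
    define W where "W = ball u (r/2)"
    have "open W" "W \<noteq> {}" using u by (auto simp: W_def)
    then obtain \<nu> where \<nu>: "\<nu> \<in> invariant_measures T" "measure \<nu> W > 0"
      using measure_center_positive[OF center] by blast
    define c where "c = measure \<nu> W"
    have \<delta>8: "\<delta>/8 > 0" using \<delta> by simp
    obtain e1 where e1: "e1 > 0" "\<forall>i\<le>K. \<forall>a b. dist a b < e1 \<longrightarrow> \<bar>f i a - f i b\<bar> \<le> \<delta>/8"
      using uniformly_close_test_functions[OF \<delta>8] by blast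
    define e0 where "e0 = min e1 (r/2)"
    define \<delta>1 where "\<delta>1 = min (c/2) (\<delta>/8)"
    have pos: "e0 > 0" "\<delta>1 > 0" "\<delta>1 < c" "\<delta>1 \<le> \<delta>/8" using e1 u \<delta> \<nu>(2) by (auto simp: e0_def \<delta>1_def c_def)
    obtain n where n: "n \<ge> 1" and trace: "\<forall>xs :: nat \<Rightarrow> 'a. \<exists>(h :: nat \<Rightarrow> nat) x. h 1 = 0 \<and>
        (\<forall>i\<ge>1. real n \<le> real (h (i + 1)) - real (h i) \<and>
           real (h (i + 1)) - real (h i) \<le> real n * (1 + \<delta>/8) \<and>
           real (card {j. j < n \<and> dist ((T ^^ (h i + j)) x) ((T ^^ j) (xs i)) \<ge> e0}) \<le> \<delta>1 * real n)"
      using ap[unfolded approximate_product_property_def, rule_format, OF pos(1,2) \<delta>8] by blast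
    obtain y1 where y1: "c * real (card {..<n}) \<le> real (card {j\<in>{..<n}. (T ^^ j) y1 \<in> W})"
      using frequent_visits[OF \<nu>(1) measT, of W "{..<n}"] \<open>open W\<close> unfolding c_def by auto
    define F where "F k = avg (f (Suc k)) n" for k
    have Fi: "(\<integral>x. F k x \<partial>\<mu>) = \<alpha> (Suc k)" for k
      unfolding F_def \<alpha>_def by (rule invariant_integral_avg[OF \<mu> cont_f n])
    have F1: "\<bar>F k x\<bar> \<le> 1" for k x unfolding F_def by (rule birkhoff_average_bound[OF f_le1]) auto
    have F2: "\<bar>F k x - \<alpha> (Suc k)\<bar> \<le> 2" for k x using F1[of k x] \<alpha>1[of "Suc k"] by simp
    have Fc: "continuous_on UNIV (F k)" for k unfolding F_def by (rule cont_avg[OF cont_f])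
    have "\<delta>/16 > 0" using \<delta> by simp
    then obtain y where y: "\<forall>\<^sub>F L in sequentially. \<forall>k<K. \<bar>(\<Sum>i<L. F k (y i)) - real L * \<alpha> (Suc k)\<bar> \<le> \<delta>/16 * real L"
      using greedy_averaging_sequence[OF comp bp, of F K 2 "\<delta>/16"] Fc F2 unfolding Fi by blast
    define xs where "xs i = (if i \<le> 1 then y1 else y (i - 2))" for i :: nat
    obtain h :: "nat \<Rightarrow> nat" and x where hx: "h 1 = 0 \<and> (\<forall>i\<ge>1. real n \<le> real (h (i + 1)) - real (h i) \<and>
           real (h (i + 1)) - real (h i) \<le> real n * (1 + \<delta>/8) \<and>
           real (card {j. j < n \<and> dist ((T ^^ (h i + j)) x) ((T ^^ j) (xs i)) \<ge> e0}) \<le> \<delta>1 * real n)"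
      using spec[OF trace, of xs] by (elim exE)
    have h1: "h 1 = 0" using hx by blast
    note h = hx[THEN conjunct2, rule_format]
    \<comment> \<open>a visit of \<open>y1\<close> to \<open>W\<close> that is traced\<close>
    have "\<exists>j. (T ^^ j) x \<in> U"
    proof (rule ccontr)
      assume neg: "\<not> ?thesis"
      have "{j\<in>{..<n}. (T ^^ j) y1 \<in> W} \<subseteq> {j. j < n \<and> dist ((T ^^ (h 1 + j)) x) ((T ^^ j) (xs 1)) \<ge> e0}"
      proof
        fix j assume "j \<in> {j\<in>{..<n}. (T ^^ j) y1 \<in> W}"
        then have j: "j < n" "(T ^^ j) y1 \<in> W" by auto
        have "e0 \<le> dist ((T ^^ j) x) ((T ^^ j) y1)"
        proof (rule ccontr)
          assume "\<not> e0 \<le> dist ((T ^^ j) x) ((T ^^ j) y1)"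
          then have "dist u ((T ^^ j) x) < r"
            using j(2) dist_triangle_half_r[of "(T ^^ j) y1" u r "(T ^^ j) x"]
            by (auto simp: e0_def W_def dist_commute)
          then show False using neg u(2) by auto
        qed
        then show "j \<in> {j. j < n \<and> dist ((T ^^ (h 1 + j)) x) ((T ^^ j) (xs 1)) \<ge> e0}"
          using j(1) h1 by (simp add: xs_def)
      qed
      then have "card {j\<in>{..<n}. (T ^^ j) y1 \<in> W} \<le> card {j. j < n \<and> dist ((T ^^ (h 1 + j)) x) ((T ^^ j) (xs 1)) \<ge> e0}"
        by (intro card_mono) auto
      then have "c * real n \<le> \<delta>1 * real n" using y1 h[of 1] by simp
      then show False using pos(3) n by simp
    qed
    then obtain j where j: "(T ^^ j) x \<in> U" by blast
    have hlow: "real L * real n \<le> real (h (L + 1))" for L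
    proof (induction L)
      case (Suc L)
      then show ?case using h[of "Suc L"] by (simp add: algebra_simps)
    qed (simp add: h1)
    have hup: "real (h (L + 1)) \<le> real L * (real n * (1 + \<delta>/8))" for L
    proof (induction L)
      case (Suc L)
      then show ?case using h[of "Suc L"] by (simp add: algebra_simps add_divide_distrib)
    qed (use h1 in simp)
    have blocks: "\<bar>(\<Sum>s<h (L + 1). f i ((T ^^ s) x)) - (\<Sum>l\<in>{1..L}. real n * avg (f i) n (xs l))\<bar> \<le> real L * (real n * (\<delta>/8 + 2 * \<delta>1 + \<delta>/8))"
      if i: "1 \<le> i" "i \<le> K" for i L
    proof (induction L)
      case 0
      then show ?case using h1 by simp
    next
      case (Suc L)
      define l where "l = h (Suc L + 1) - h (Suc L)"
      have hl: "h (Suc L + 1) = h (Suc L) + l" and rl: "real l = real (h (Suc L + 1)) - real (h (Suc L))"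
        using h[of "Suc L"] unfolding l_def by auto
      define x' where "x' = (T ^^ h (Suc L)) x"
      have it: "(T ^^ (h (Suc L) + s)) x = (T ^^ s) x'" for s
        by (simp add: x'_def add.commute[of "h (Suc L)"] funpow_add)
      have "\<bar>(\<Sum>s<l. f i ((T ^^ s) x')) - real n * avg (f i) n (xs (Suc L))\<bar> \<le> real n * (\<delta>/8 + 2 * \<delta>1 + \<delta>/8)"
      proof (rule traced_block_sum[OF f_le1[OF i(1)] _ _ n])
        show "\<bar>f i a - f i b\<bar> \<le> \<delta>/8" if "dist a b < e0" for a b
          using e1(2) i(2) that by (simp add: e0_def)
        show "real (card {j. j < n \<and> e0 \<le> dist ((T ^^ j) x') ((T ^^ j) (xs (Suc L)))}) \<le> \<delta>1 * real n"
          using h[of "Suc L"] by (simp add: it)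
      qed (use h[of "Suc L"] rl \<delta> in auto)
      moreover have "(\<Sum>s<h (Suc L + 1). f i ((T ^^ s) x)) = (\<Sum>s<h (L + 1). f i ((T ^^ s) x)) + (\<Sum>s<l. f i ((T ^^ s) x'))"
      proof -
        have "(\<Sum>s<h (Suc L) + l. f i ((T ^^ s) x)) = (\<Sum>s<h (Suc L). f i ((T ^^ s) x)) + (\<Sum>s<l. f i ((T ^^ (h (Suc L) + s)) x))"
          by (rule sum_lessThan_add)
        then show ?thesis by (simp add: hl[simplified] it)
      qed
      ultimately show ?case using Suc by (simp add: algebra_simps add_divide_distrib)
    qed
    have "\<exists>\<^sub>F N in sequentially. N \<ge> 1 \<and> rho f \<mu> (emp ((T ^^ j) x) N) < \<epsilon>"
      unfolding frequently_sequentially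
    proof
      fix N0
      have "\<forall>\<^sub>F L in sequentially. real L \<ge> max (32/\<delta>) (8 * real j / \<delta>)"
        using filterlim_real_sequentially unfolding filterlim_at_top by blast
      with y eventually_ge_at_top[of "max 1 N0"]
      have "\<forall>\<^sub>F L in sequentially. L \<ge> max 1 N0 \<and> real L \<ge> max (32/\<delta>) (8 * real j / \<delta>) \<and>
         (\<forall>k<K. \<bar>(\<Sum>i<L. F k (y i)) - real L * \<alpha> (Suc k)\<bar> \<le> \<delta>/16 * real L)"
        by eventually_elim simp
      then obtain L where L: "L \<ge> max 1 N0" "real L \<ge> max (32/\<delta>) (8 * real j / \<delta>)"
         "\<And>k. k < K \<Longrightarrow> \<bar>(\<Sum>i<L. F k (y i)) - real L * \<alpha> (Suc k)\<bar> \<le> \<delta>/16 * real L"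
        by (auto simp: eventually_sequentially)
      \<comment> \<open>one extra block accounts for the first one, which does not follow the greedy sequence\<close>
      define L' where "L' = Suc L"
      define N where "N = h (L' + 1)"
      have Nlow: "real L' * real n \<le> real N" using hlow[of L'] by (simp add: N_def)
      have "real L' * 1 \<le> real L' * real n" using n by (intro mult_left_mono) auto
      then have NL: "real L' \<le> real N" using Nlow by linarith
      then have N0: "N \<ge> 1" "N \<ge> N0" using L(1) by (auto simp: L'_def)
      have "\<bar>(\<integral>x. f i x \<partial>\<mu>) - (\<integral>z. f i z \<partial>emp ((T ^^ j) x) N)\<bar> \<le> \<delta>" if i: "1 \<le> i \<and> i \<le> K" for i
      proof -
        obtain k where k: "i = Suc k" "k < K" using i by (cases i) auto
        define P where "P = (\<Sum>s<N. f i ((T ^^ s) x))"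
        define Q where "Q = (\<Sum>l\<in>{1..L'}. avg (f i) n (xs l))"
        have PQ: "\<bar>P - real n * Q\<bar> \<le> real L' * (real n * (\<delta>/8 + 2 * \<delta>1 + \<delta>/8))"
          using blocks[of i L'] i by (simp add: P_def Q_def N_def sum_distrib_left)
        have "Q = F k y1 + (\<Sum>l<L. F k (y l))"
        proof -
          have "Q = (\<Sum>l<L'. avg (f i) n (xs (Suc l)))"
            unfolding Q_def by (rule sum.reindex_bij_witness[of _ Suc "\<lambda>l. l - 1"]) auto
          also have "\<dots> = avg (f i) n (xs 1) + (\<Sum>l<L. avg (f i) n (xs (Suc (Suc l))))"
            unfolding L'_def by (subst sum.lessThan_Suc_shift) simp
          finally show ?thesis by (simp add: xs_def F_def k)
        qed
        then have "Q - real L' * \<alpha> i = (F k y1 - \<alpha> (Suc k)) + ((\<Sum>l<L. F k (y l)) - real L * \<alpha> (Suc k))"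
          by (simp add: k(1) L'_def algebra_simps)
        then have "\<bar>Q - real L' * \<alpha> i\<bar> \<le> 2 + \<delta>/16 * real L"
          using L(3)[OF k(2)] F2[of k y1] by linarith
        also have "\<dots> \<le> \<delta>/8 * real L'"
        proof -
          have "2 \<le> \<delta>/16 * real L" using L(2) \<delta> by (simp add: field_simps)
          then show ?thesis using \<delta> by (simp add: L'_def algebra_simps)
        qed
        finally have "real n * \<bar>Q - real L' * \<alpha> i\<bar> \<le> real n * (\<delta>/8 * real L')"
          by (rule mult_left_mono) simp
        then have QL: "\<bar>real n * Q - real n * (real L' * \<alpha> i)\<bar> \<le> real n * (\<delta>/8 * real L')"
          unfolding right_diff_distrib[symmetric] abs_mult by simp
        have gap: "\<bar>real L' * real n * \<alpha> i - real N * \<alpha> i\<bar> \<le> real L' * real n * (\<delta>/8)"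
        proof -
          have "\<bar>real L' * real n * \<alpha> i - real N * \<alpha> i\<bar> = (real N - real L' * real n) * \<bar>\<alpha> i\<bar>"
            using Nlow by (simp add: left_diff_distrib[symmetric] abs_mult)
          also have "\<dots> \<le> (real N - real L' * real n) * 1"
            using Nlow \<alpha>1 i by (intro mult_left_mono) auto
          also have "\<dots> \<le> real L' * real n * (\<delta>/8)"
            using hup[of L'] by (simp add: N_def algebra_simps)
          finally show ?thesis .
        qed
        have "real L' * (real n * (\<delta>/8 + 2 * \<delta>1 + \<delta>/8)) \<le> real L' * (real n * (\<delta>/2))"
          using pos(4) by (intro mult_left_mono) auto
        from order_trans[OF PQ this] have "\<bar>P - real n * Q\<bar> \<le> (real L' * real n * \<delta>) / 2"
          by simp
        moreover have "\<bar>real n * Q - real L' * real n * \<alpha> i\<bar> \<le> (real L' * real n * \<delta>) / 8"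
          using QL by (simp add: mult_ac)
        moreover have "\<bar>real L' * real n * \<alpha> i - real N * \<alpha> i\<bar> \<le> (real L' * real n * \<delta>) / 8"
          using gap by simp
        ultimately have "\<bar>P - real N * \<alpha> i\<bar> \<le> 3/4 * (real L' * real n * \<delta>)" by linarith
        then have "\<bar>P - real N * \<alpha> i\<bar> \<le> (real L' * real n) * (3/4 * \<delta>)" by simp
        also have "\<dots> \<le> real N * (3/4 * \<delta>)" using Nlow \<delta> by (intro mult_right_mono) auto
        finally have "\<bar>P - real N * \<alpha> i\<bar> / real N \<le> 3/4 * \<delta>"
          using N0(1) by (simp add: field_simps)
        moreover have "avg (f i) N x - \<alpha> i = (P - real N * \<alpha> i) / real N"
          using N0(1) by (simp add: birkhoff_average_def P_def field_simps)
        ultimately have a1: "\<bar>avg (f i) N x - \<alpha> i\<bar> \<le> 3/4 * \<delta>" by simp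
        have "\<bar>avg (f i) N ((T ^^ j) x) - avg (f i) N x\<bar> \<le> real j * (2 * 1 / real N)"
          using i by (intro birkhoff_average_shift_iter f_le1) auto
        also have "\<dots> \<le> \<delta>/4"
        proof -
          have "8 * real j / \<delta> \<le> real N" using L(2) NL by (simp add: L'_def)
          then show ?thesis using \<delta> N0(1) by (simp add: field_simps)
        qed
        finally have "\<bar>\<alpha> i - avg (f i) N ((T ^^ j) x)\<bar> \<le> \<delta>" using a1 by linarith
        then show ?thesis
          using integral_empirical[OF borel_measurable_continuous_onI[OF cont_f[of i]] N0(1)] by (simp add: \<alpha>_def)
      qed
      then have "rho f \<mu> (emp ((T ^^ j) x) N) < \<epsilon>" using * bp empirical_borel_prob[OF N0(1)] by simp
      then show "\<exists>N\<ge>N0. N \<ge> 1 \<and> rho f \<mu> (emp ((T ^^ j) x) N) < \<epsilon>" using N0 by blast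
    qed
    then show "\<exists>x\<in>U. \<exists>\<^sub>F n in sequentially. n \<ge> 1 \<and> rho f \<mu> (emp x n) < \<epsilon>" using j by blast
  qed
qed

end

context compact_system
begin

text \<open>The conclusion of the product property with one bound \<open>s\<close> for delay and number of errors.\<close>

definition delayed_tracing :: "real \<Rightarrow> 'a \<Rightarrow> 'a \<Rightarrow> nat \<Rightarrow> real \<Rightarrow> bool" where
  "delayed_tracing \<epsilon> x y n s \<longleftrightarrow> (\<exists>z p \<Lambda>. \<Lambda> \<subseteq> {..<n} \<and> real p \<le> s \<and> real (card ({..<n} - \<Lambda>)) \<le> s \<and>
    dist z x < \<epsilon> \<and> (\<forall>j\<in>\<Lambda>. dist ((T ^^ (p + j)) z) ((T ^^ j) y) < \<epsilon>))"

text \<open>The delay is made short by asking the first block to visit a neighbourhood of \<open>x1\<close> during a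
  final stretch whose length is a small fraction of \<open>n\<close>; by invariance, visits in that stretch can
  be as frequent as in the whole block.\<close>

lemma approximate_product_short_delay:
  assumes ap: "approximate_product_property T" and center: "measure_center T = UNIV"
    and "\<epsilon> > 0" "\<delta> > 0"
  shows "\<exists>N\<ge>1. \<forall>n\<ge>N. \<forall>y. delayed_tracing \<epsilon> x1 y n (\<delta> * real n)"
proof -
  define W where "W = ball x1 (\<epsilon>/2)"
  have W: "open W" "W \<noteq> {}" using \<open>\<epsilon> > 0\<close> by (auto simp: W_def)
  obtain \<nu> where \<nu>: "\<nu> \<in> invariant_measures T" "measure \<nu> W > 0"
    using measure_center_positive[OF center W] by blast
  define c where "c = measure \<nu> W"
  have c: "c > 0" "c \<le> 1"
    using \<nu> prob_space.prob_le_1 borel_probsD(1) by (auto simp: c_def invariant_measures_def)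
  define \<delta>' where "\<delta>' = min \<delta> 1"
  have \<delta>': "\<delta>' > 0" "\<delta>' \<le> 1" "\<delta>' \<le> \<delta>" using \<open>\<delta> > 0\<close> by (auto simp: \<delta>'_def)
  have pos: "\<epsilon>/2 > 0" "c * \<delta>' / 8 > 0" "\<delta>'/2 > 0" using \<open>\<epsilon> > 0\<close> c \<delta>' by auto
  obtain N0 where trace: "\<forall>n\<ge>N0. \<forall>xs :: nat \<Rightarrow> 'a. \<exists>(h :: nat \<Rightarrow> nat) x. h 1 = 0 \<and>
        (\<forall>i\<ge>1. real n \<le> real (h (i + 1)) - real (h i) \<and>
           real (h (i + 1)) - real (h i) \<le> real n * (1 + \<delta>'/2) \<and>
           real (card {j. j < n \<and> dist ((T ^^ (h i + j)) x) ((T ^^ j) (xs i)) \<ge> \<epsilon>/2}) \<le> c * \<delta>' / 8 * real n)"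
    using ap[unfolded approximate_product_property_def, rule_format, OF pos] by blast
  define N where "N = max N0 (nat \<lceil>4 / \<delta>'\<rceil> + 1)"
  have "delayed_tracing \<epsilon> x1 y n (\<delta> * real n)" if n: "n \<ge> N" for n y
  proof -
    have n0: "n \<ge> N0" "n \<ge> 1" and n4: "4 / \<delta>' \<le> real n" using n unfolding N_def by linarith+
    define l where "l = nat \<lfloor>\<delta>' * real n / 2\<rfloor>"
    have \<delta>n: "4 \<le> \<delta>' * real n" using n4 \<delta>' by (simp add: field_simps)
    have l_up: "real l \<le> \<delta>' * real n / 2" using \<delta>n unfolding l_def by linarith
    have l_low: "\<delta>' * real n / 4 \<le> real l" using \<delta>n unfolding l_def by linarith
    have "\<delta>' * real n \<le> 1 * real n" using \<delta>' by (intro mult_right_mono) auto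
    then have ln: "l \<le> n" using l_up by simp
    define J where "J = {n - l..<n}"
    obtain y1 where y1: "c * real (card J) \<le> real (card {j\<in>J. (T ^^ j) y1 \<in> W})"
      using frequent_visits[OF \<nu>(1) measT, of W J] W(1) unfolding c_def J_def by auto
    define xs where "xs i = (if i = 1 then y1 else y)" for i :: nat
    obtain h :: "nat \<Rightarrow> nat" and x where hx: "h 1 = 0 \<and>
        (\<forall>i\<ge>1. real n \<le> real (h (i + 1)) - real (h i) \<and>
           real (h (i + 1)) - real (h i) \<le> real n * (1 + \<delta>'/2) \<and>
           real (card {j. j < n \<and> dist ((T ^^ (h i + j)) x) ((T ^^ j) (xs i)) \<ge> \<epsilon>/2}) \<le> c * \<delta>' / 8 * real n)"
      using trace[rule_format, OF n0(1), of xs] by (elim exE)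
    have h1: "h 1 = 0" using hx by blast
    have h2: "real n \<le> real (h 2)" "real (h 2) \<le> real n * (1 + \<delta>'/2)"
      and bad1: "real (card {j. j < n \<and> dist ((T ^^ j) x) ((T ^^ j) y1) \<ge> \<epsilon>/2}) \<le> c * \<delta>' / 8 * real n"
      using hx[THEN conjunct2, rule_format, of 1] h1 by (simp_all add: xs_def numeral_2_eq_2)
    have bad2: "real (card {j. j < n \<and> dist ((T ^^ (h 2 + j)) x) ((T ^^ j) y) \<ge> \<epsilon>/2}) \<le> c * \<delta>' / 8 * real n"
      using hx[THEN conjunct2, rule_format, of 2] by (simp add: xs_def)
    have "\<exists>j\<in>J. (T ^^ j) y1 \<in> W \<and> dist ((T ^^ j) x) ((T ^^ j) y1) < \<epsilon>/2"
    proof (rule ccontr)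
      assume "\<not> ?thesis"
      then have "{j\<in>J. (T ^^ j) y1 \<in> W} \<subseteq> {j. j < n \<and> dist ((T ^^ j) x) ((T ^^ j) y1) \<ge> \<epsilon>/2}"
        by (auto simp: J_def not_less)
      then have "card {j\<in>J. (T ^^ j) y1 \<in> W} \<le> card {j. j < n \<and> dist ((T ^^ j) x) ((T ^^ j) y1) \<ge> \<epsilon>/2}"
        by (intro card_mono) auto
      then have "c * real l \<le> c * \<delta>' / 8 * real n" using y1 bad1 ln by (simp add: J_def)
      moreover have "c * (\<delta>' * real n / 4) \<le> c * real l" using l_low c by (intro mult_left_mono) auto
      moreover have "c * \<delta>' * real n > 0" using c \<delta>' n0 by simp
      ultimately show False by (simp add: field_simps)
    qed
    then obtain j1 where j1: "j1 \<in> J" "(T ^^ j1) y1 \<in> W" "dist ((T ^^ j1) x) ((T ^^ j1) y1) < \<epsilon>/2" by blast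
    define z where "z = (T ^^ j1) x"
    define p where "p = h 2 - j1"
    have j1n: "j1 < n" "n - l \<le> j1" using j1(1) by (auto simp: J_def)
    have hp: "h 2 = p + j1" and rp: "real p = real (h 2) - real j1" using j1n h2(1) by (auto simp: p_def)
    define \<Lambda> where "\<Lambda> = {j. j < n \<and> dist ((T ^^ (h 2 + j)) x) ((T ^^ j) y) < \<epsilon>/2}"
    have "real p \<le> \<delta> * real n"
    proof -
      have "real n - real l \<le> real j1" using j1n(2) ln by linarith
      then have "real p \<le> \<delta>' * real n" using rp h2(2) l_up by (simp add: algebra_simps)
      also have "\<dots> \<le> \<delta> * real n" using \<delta>' by (intro mult_right_mono) auto
      finally show ?thesis .
    qed
    moreover have "real (card ({..<n} - \<Lambda>)) \<le> \<delta> * real n"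
    proof -
      have "{..<n} - \<Lambda> = {j. j < n \<and> dist ((T ^^ (h 2 + j)) x) ((T ^^ j) y) \<ge> \<epsilon>/2}"
        by (auto simp: \<Lambda>_def)
      then have "real (card ({..<n} - \<Lambda>)) \<le> c * \<delta>' / 8 * real n" using bad2 by simp
      also have "\<dots> \<le> \<delta> * real n"
      proof (intro mult_right_mono)
        have "c * \<delta>' \<le> 1 * \<delta>'" using c \<delta>' by (intro mult_right_mono) auto
        then show "c * \<delta>' / 8 \<le> \<delta>" using \<delta>' by linarith
      qed simp
      finally show ?thesis .
    qed
    moreover have "dist z x1 < \<epsilon>"
      using j1(2,3) dist_triangle_half_r[of "(T ^^ j1) y1" z \<epsilon> x1] by (simp add: W_def z_def dist_commute)
    moreover have "\<forall>j\<in>\<Lambda>. dist ((T ^^ (p + j)) z) ((T ^^ j) y) < \<epsilon>"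
    proof
      fix j assume "j \<in> \<Lambda>"
      moreover have "(T ^^ (p + j)) z = (T ^^ (h 2 + j)) x"
      proof -
        have "h 2 + j = (p + j) + j1" using hp by simp
        then show ?thesis unfolding z_def by (simp only: funpow_add o_apply)
      qed
      ultimately show "dist ((T ^^ (p + j)) z) ((T ^^ j) y) < \<epsilon>" using \<open>\<epsilon> > 0\<close> by (auto simp: \<Lambda>_def)
    qed
    moreover have "\<Lambda> \<subseteq> {..<n}" by (auto simp: \<Lambda>_def)
    ultimately show ?thesis unfolding delayed_tracing_def by blast
  qed
  then show ?thesis by (intro exI[of _ N] conjI allI impI) (auto simp: N_def)
qed

text \<open>A tracing orbit that starts in \<open>U\<close> and follows a point visiting \<open>V\<close> more often than the number
  of tracing errors must itself enter \<open>V\<close>.\<close>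

lemma approximate_product_transitive:
  assumes ap: "approximate_product_property T" and center: "measure_center T = UNIV"
  shows "transitive T"
  unfolding transitive_def
proof (intro allI impI)
  fix U V :: "'a set" assume UV: "open U \<and> U \<noteq> {} \<and> open V \<and> V \<noteq> {}"
  obtain u r where u: "r > 0" "ball u r \<subseteq> U" using UV by (meson all_not_in_conv openE)
  obtain v s where v: "s > 0" "ball v s \<subseteq> V" using UV by (meson all_not_in_conv openE)
  define W where "W = ball v (s/2)"
  have W: "open W" "W \<noteq> {}" using v by (auto simp: W_def)
  obtain \<nu> where \<nu>: "\<nu> \<in> invariant_measures T" "measure \<nu> W > 0"
    using measure_center_positive[OF center W] by blast
  define c where "c = measure \<nu> W"
  have pos: "min r (s/2) > 0" "c/2 > 0" using u v \<nu> by (auto simp: c_def)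
  obtain n where n: "n \<ge> 1" and *: "\<forall>y. delayed_tracing (min r (s/2)) u y n (c/2 * real n)"
    using approximate_product_short_delay[OF ap center pos, of u] by blast
  obtain y where y: "c * real (card {..<n}) \<le> real (card {j\<in>{..<n}. (T ^^ j) y \<in> W})"
    using frequent_visits[OF \<nu>(1) measT, of W "{..<n}"] W(1) unfolding c_def by auto
  obtain z p \<Lambda> where z: "\<Lambda> \<subseteq> {..<n}" "real (card ({..<n} - \<Lambda>)) \<le> c/2 * real n" "dist z u < min r (s/2)"
    "\<forall>j\<in>\<Lambda>. dist ((T ^^ (p + j)) z) ((T ^^ j) y) < min r (s/2)"
    using spec[OF *, of y] unfolding delayed_tracing_def by blast
  have "\<exists>j\<in>\<Lambda>. (T ^^ j) y \<in> W"
  proof (rule ccontr)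
    assume "\<not> ?thesis"
    then have "{j\<in>{..<n}. (T ^^ j) y \<in> W} \<subseteq> {..<n} - \<Lambda>" by auto
    then have "card {j\<in>{..<n}. (T ^^ j) y \<in> W} \<le> card ({..<n} - \<Lambda>)" by (intro card_mono) auto
    then have "c * real n \<le> c/2 * real n" using y z(2) by simp
    then show False using pos n by simp
  qed
  then obtain j where j: "j \<in> \<Lambda>" "(T ^^ j) y \<in> W" by blast
  have "dist v ((T ^^ (p + j)) z) < s"
    using z(4) j dist_triangle_half_r[of "(T ^^ j) y" v s "(T ^^ (p + j)) z"] by (auto simp: W_def dist_commute)
  then have "(T ^^ (p + j)) z \<in> V" using v(2) by auto
  moreover have "z \<in> U" using z(3) u(2) by (auto simp: dist_commute subset_iff)
  ultimately show "\<exists>n. U \<inter> (T ^^ n) -` V \<noteq> {}" by (intro exI[of _ "p + j"]) auto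
qed

text \<open>The smallest admissible common bound on delay and number of errors is eventually below
  \<open>\<delta> n\<close> for every \<open>\<delta>\<close>, so it serves as both functions.\<close>

theorem approximate_product_mg_transitive:
  assumes ap: "approximate_product_property T" and center: "measure_center T = UNIV"
  shows "\<exists>m g. mg_transitive T m g \<and>
    (\<forall>\<epsilon>>0. \<forall>x y. (\<lambda>n. real (m \<epsilon> x y n + g \<epsilon> x y n) / real n) \<longlonglongrightarrow> 0)"
proof -
  define m where "m \<epsilon> x y n = (LEAST s. delayed_tracing \<epsilon> x y n (real s))" for \<epsilon> x y n
  define g where "g \<epsilon> x y n = min (m \<epsilon> x y n) n" for \<epsilon> x y n
  have key: "\<exists>N\<ge>1. \<forall>n\<ge>N. delayed_tracing \<epsilon> x y n (m \<epsilon> x y n) \<and> real (m \<epsilon> x y n) \<le> \<delta> * real n"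
    if pos: "\<epsilon> > 0" "\<delta> > 0" for \<epsilon> \<delta> x y
  proof -
    obtain N where N: "N \<ge> 1" "\<forall>n\<ge>N. \<forall>y. delayed_tracing \<epsilon> x y n (\<delta> * real n)"
      using approximate_product_short_delay[OF ap center pos, of x] by blast
    have "delayed_tracing \<epsilon> x y n (m \<epsilon> x y n) \<and> real (m \<epsilon> x y n) \<le> \<delta> * real n" if n: "n \<ge> N" for n
    proof -
      have fl: "real k \<le> \<delta> * real n \<Longrightarrow> real k \<le> real (nat \<lfloor>\<delta> * real n\<rfloor>)" for k
        using le_nat_floor[of k] of_nat_le_iff by blast
      have "delayed_tracing \<epsilon> x y n (\<delta> * real n)" using N(2) n by blast
      then have "delayed_tracing \<epsilon> x y n (real (nat \<lfloor>\<delta> * real n\<rfloor>))"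
        unfolding delayed_tracing_def using fl by blast
      then have "delayed_tracing \<epsilon> x y n (m \<epsilon> x y n)" "m \<epsilon> x y n \<le> nat \<lfloor>\<delta> * real n\<rfloor>"
        unfolding m_def by (rule LeastI, rule Least_le)
      moreover have "\<delta> * real n \<ge> 0" using pos by simp
      ultimately show ?thesis by linarith
    qed
    then show ?thesis using N(1) by blast
  qed
  have "mg_product_property T m g"
    unfolding mg_product_property_def
  proof (intro conjI allI impI)
    show "g \<epsilon> x y n \<le> n" for \<epsilon> x y n by (simp add: g_def)
    fix \<epsilon> :: real and x1 x2 :: 'a assume "\<epsilon> > 0"
    then obtain N where N: "N \<ge> 1" "\<forall>n\<ge>N. delayed_tracing \<epsilon> x1 x2 n (m \<epsilon> x1 x2 n) \<and> real (m \<epsilon> x1 x2 n) \<le> 1 * real n"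
      using key[of \<epsilon> 1 x1 x2] by auto
    have "\<exists>z p \<Lambda>. \<Lambda> \<subseteq> {..<n} \<and> p \<le> m \<epsilon> x1 x2 n \<and> card ({..<n} - \<Lambda>) \<le> g \<epsilon> x1 x2 n \<and>
        dist z x1 < \<epsilon> \<and> (\<forall>j\<in>\<Lambda>. dist ((T ^^ (p + j)) z) ((T ^^ j) x2) < \<epsilon>)" if n: "n \<ge> N" for n
    proof -
      obtain z p \<Lambda> where z: "\<Lambda> \<subseteq> {..<n}" "p \<le> m \<epsilon> x1 x2 n" "card ({..<n} - \<Lambda>) \<le> m \<epsilon> x1 x2 n" "dist z x1 < \<epsilon>"
        "\<forall>j\<in>\<Lambda>. dist ((T ^^ (p + j)) z) ((T ^^ j) x2) < \<epsilon>"
        using N(2)[rule_format, OF n] unfolding delayed_tracing_def by auto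
      have "card ({..<n} - \<Lambda>) \<le> card {..<n}" by (intro card_mono) auto
      then have "card ({..<n} - \<Lambda>) \<le> g \<epsilon> x1 x2 n" using z(3) by (simp add: g_def)
      then show ?thesis using z by blast
    qed
    then show "\<exists>N\<ge>1. \<forall>n\<ge>N. \<exists>z p \<Lambda>. \<Lambda> \<subseteq> {..<n} \<and> p \<le> m \<epsilon> x1 x2 n \<and> card ({..<n} - \<Lambda>) \<le> g \<epsilon> x1 x2 n \<and>
        dist z x1 < \<epsilon> \<and> (\<forall>j\<in>\<Lambda>. dist ((T ^^ (p + j)) z) ((T ^^ j) x2) < \<epsilon>)"
      using N(1) by blast
  qed
  moreover have "(\<lambda>n. real (m \<epsilon> x y n + g \<epsilon> x y n) / real n) \<longlonglongrightarrow> 0" if \<epsilon>: "\<epsilon> > 0" for \<epsilon> x y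
  proof (rule tendstoI)
    fix e :: real assume e: "e > 0"
    obtain N where N: "N \<ge> 1" "\<forall>n\<ge>N. delayed_tracing \<epsilon> x y n (m \<epsilon> x y n) \<and> real (m \<epsilon> x y n) \<le> e/3 * real n"
      using key[OF \<epsilon>, of "e/3" x y] e by auto
    have "dist (real (m \<epsilon> x y n + g \<epsilon> x y n) / real n) 0 < e" if n: "n \<ge> N" for n
    proof -
      have "real (m \<epsilon> x y n) \<le> e/3 * real n" using N n by blast
      then have "real (m \<epsilon> x y n + g \<epsilon> x y n) \<le> 2 * (e/3) * real n" by (simp add: g_def)
      moreover have "real n > 0" using n N(1) by simp
      moreover have "e * real n > 0" using e \<open>real n > 0\<close> by simp
      ultimately have "real (m \<epsilon> x y n + g \<epsilon> x y n) < e * real n" by linarith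
      then show ?thesis using \<open>real n > 0\<close> by (simp add: pos_divide_less_eq)
    qed
    then show "\<forall>\<^sub>F n in sequentially. dist (real (m \<epsilon> x y n + g \<epsilon> x y n) / real n) 0 < e"
      by (auto simp: eventually_sequentially)
  qed
  ultimately show ?thesis
    using approximate_product_transitive[OF ap center] unfolding mg_transitive_def by blast
qed

section \<open>Minimal systems\<close>

text \<open>The measure is an accumulation point for any of its generic points, whose orbits are dense
  like all others.\<close>

lemma minimal_ergodic_dense:
  assumes min: "minimal T"
  shows "ergodic_measures T \<subseteq> M_dense f T"
proof
  fix \<mu> assume \<mu>: "\<mu> \<in> ergodic_measures T"
  have bp: "\<mu> \<in> borel_probs" using \<mu> by (simp add: ergodic_measures_def invariant_measures_def)
  obtain y where y: "\<And>i. (\<lambda>n. avg (f i) n y) \<longlonglongrightarrow> (\<integral>x. f i x \<partial>\<mu>)"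
    using generic_point[OF \<mu>, of "\<lambda>i x. f i x", OF cont_f] by blast
  have e: "emp y (Suc n) \<in> borel_probs" for n by (rule empirical_borel_prob) simp
  have "\<exists>\<^sub>F n in sequentially. n \<ge> 1 \<and> rho f \<mu> (emp y n) < \<delta>" if \<delta>: "\<delta> > 0" for \<delta>
  proof -
    have "\<forall>\<^sub>F n in sequentially. rho f \<mu> (emp y (Suc n)) < \<delta>"
    proof (rule rho_tendsto_0[OF bp e _ \<delta>])
      fix i
      have "(\<integral>x. f i x \<partial>emp y (Suc n)) = avg (f i) (Suc n) y" for n
        by (rule integral_empirical[OF borel_measurable_continuous_onI[OF cont_f]]) simp
      then show "(\<lambda>n. \<integral>x. f i x \<partial>emp y (Suc n)) \<longlonglongrightarrow> (\<integral>x. f i x \<partial>\<mu>)"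
        using LIMSEQ_Suc[OF y[of i]] by simp
    qed
    then have "\<forall>\<^sub>F n in sequentially. n \<ge> 1 \<and> rho f \<mu> (emp y n) < \<delta>"
      using eventually_sequentially_Suc[of "\<lambda>n. n \<ge> 1 \<and> rho f \<mu> (emp y n) < \<delta>"] by simp
    then show ?thesis by (rule eventually_frequently[rotated]) simp
  qed
  then have "\<mu> \<in> limit_measures T y" using bp limit_measures_iff by blast
  then show "\<mu> \<in> M_dense f T"
    using dense_orbit_limit_measures[of y] min by (auto simp: minimal_def)
qed

text \<open>The image is compact and contains the dense orbit of \<open>T x\<close>.\<close>

lemma minimal_surj:
  assumes "minimal T"
  shows "surj T"
proof -
  have "closed (range T)"
    using compact_continuous_image[OF contT comp] by (rule compact_imp_closed)
  moreover have "range (\<lambda>n. (T ^^ n) (T x)) \<subseteq> range T" for x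
    by (auto simp: funpow_swap1[symmetric])
  ultimately have "closure (range (\<lambda>n. (T ^^ n) (T x))) \<subseteq> range T" for x
    by (rule closure_minimal[rotated])
  then show ?thesis using assms by (auto simp: minimal_def)
qed

text \<open>The hitting times of each ball of a finite net are bounded because the sets
  \<open>(T ^^ n) -` ball c (\<epsilon>/2)\<close> cover the compact space.\<close>

lemma minimal_uniform_return:
  assumes min: "minimal T" and "\<epsilon> > 0"
  shows "\<exists>m. \<forall>w x. \<exists>i\<le>m. dist ((T ^^ i) w) x < \<epsilon>"
proof -
  have e2: "\<epsilon>/2 > 0" using \<open>\<epsilon> > 0\<close> by simp
  obtain D :: "'a set" where D: "finite D" "UNIV \<subseteq> (\<Union>c\<in>D. ball c (\<epsilon>/2))"
    using comp e2 unfolding compact_eq_totally_bounded by blast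
  have "\<exists>m. \<forall>w. \<exists>i\<le>m. (T ^^ i) w \<in> ball c (\<epsilon>/2)" for c
  proof -
    have op: "open ((T ^^ n) -` ball c (\<epsilon>/2))" for n
      using cont_iter[of n] by (simp add: open_vimage)
    have "UNIV \<subseteq> (\<Union>n\<in>UNIV. (T ^^ n) -` ball c (\<epsilon>/2))"
    proof
      fix w
      have "range (\<lambda>n. (T ^^ n) w) \<inter> ball c (\<epsilon>/2) \<noteq> {}"
        using min e2 unfolding minimal_def closure_eq_UNIV_iff by (metis ball_eq_empty not_le open_ball)
      then show "w \<in> (\<Union>n\<in>UNIV. (T ^^ n) -` ball c (\<epsilon>/2))" by auto
    qed
    then obtain I where I: "finite I" "UNIV \<subseteq> (\<Union>n\<in>I. (T ^^ n) -` ball c (\<epsilon>/2))"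
      using compactE_image[OF comp, of UNIV "\<lambda>n. (T ^^ n) -` ball c (\<epsilon>/2)"] op by auto
    have "\<exists>i\<le>Max I. (T ^^ i) w \<in> ball c (\<epsilon>/2)" for w
    proof -
      obtain i where "i \<in> I" "(T ^^ i) w \<in> ball c (\<epsilon>/2)" using I(2) by blast
      then show ?thesis using Max_ge[OF I(1)] by blast
    qed
    then show ?thesis by blast
  qed
  then obtain M where M: "\<And>c w. \<exists>i\<le>M c. (T ^^ i) w \<in> ball c (\<epsilon>/2)" by metis
  have "\<exists>i\<le>Max (M ` D). dist ((T ^^ i) w) x < \<epsilon>" for w x
  proof -
    obtain c where c: "c \<in> D" "x \<in> ball c (\<epsilon>/2)" using D(2) by blast
    obtain i where i: "i \<le> M c" "(T ^^ i) w \<in> ball c (\<epsilon>/2)" using M by blast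
    have "M c \<le> Max (M ` D)" using D(1) c(1) by simp
    moreover have "dist ((T ^^ i) w) x < \<epsilon>"
      using c(2) i(2) dist_triangle_half_r[of c "(T ^^ i) w" \<epsilon> x] by (simp add: dist_commute)
    ultimately show ?thesis using i(1) order_trans by blast
  qed
  then show ?thesis by blast
qed

text \<open>Exact shadowing: pull \<open>x2\<close> back along a preimage orbit of length \<open>m\<close>; that segment comes
  \<open>\<epsilon>\<close>-close to \<open>x1\<close>, and from there the orbit runs into \<open>x2\<close> itself.\<close>

lemma minimal_exact_shadowing:
  assumes min: "minimal T"
  shows "\<exists>m :: real \<Rightarrow> nat. \<forall>\<epsilon>>0. \<forall>x1 x2. \<exists>p z. p \<le> m \<epsilon> \<and> dist z x1 < \<epsilon> \<and> (T ^^ p) z = x2"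
proof -
  have "\<forall>\<epsilon>. \<exists>m. \<epsilon> > 0 \<longrightarrow> (\<forall>w x. \<exists>i\<le>m. dist ((T ^^ i) w) x < \<epsilon>)"
    using minimal_uniform_return[OF min] by blast
  then obtain m where m: "\<And>\<epsilon> w x. \<epsilon> > 0 \<Longrightarrow> \<exists>i\<le>m \<epsilon>. dist ((T ^^ i) w) x < \<epsilon>" by metis
  have "\<exists>p z. p \<le> m \<epsilon> \<and> dist z x1 < \<epsilon> \<and> (T ^^ p) z = x2" if \<epsilon>: "\<epsilon> > 0" for \<epsilon> x1 x2
  proof -
    have "surj (T ^^ m \<epsilon>)" using minimal_surj[OF min] by (rule surj_fn)
    then obtain w where w: "(T ^^ m \<epsilon>) w = x2" by (metis surjD)
    obtain i where i: "i \<le> m \<epsilon>" "dist ((T ^^ i) w) x1 < \<epsilon>" using m[OF \<epsilon>] by blast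
    have "(T ^^ (m \<epsilon> - i)) ((T ^^ i) w) = x2"
      using i(1) w by (metis funpow_add le_add_diff_inverse2 o_apply)
    then show ?thesis using i(2) by (intro exI[of _ "m \<epsilon> - i"] exI[of _ "(T ^^ i) w"] conjI) simp_all
  qed
  then show ?thesis by blast
qed

lemma minimal_transitive:
  assumes "minimal T"
  shows "transitive T"
  unfolding transitive_def
proof (intro allI impI)
  fix U V :: "'a set" assume UV: "open U \<and> U \<noteq> {} \<and> open V \<and> V \<noteq> {}"
  then obtain x where "x \<in> U" by blast
  have "range (\<lambda>n. (T ^^ n) x) \<inter> V \<noteq> {}"
    using assms UV unfolding minimal_def closure_eq_UNIV_iff by blast
  then show "\<exists>n. U \<inter> (T ^^ n) -` V \<noteq> {}" using \<open>x \<in> U\<close> by blast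
qed

theorem minimal_m_transitive:
  assumes min: "minimal T"
  shows "\<exists>m :: real \<Rightarrow> nat.
     (\<forall>\<epsilon>>0. \<forall>x1 x2. \<forall>n\<ge>1. \<forall>\<epsilon>'>0. \<exists>p z. p \<le> m \<epsilon> \<and> dist z x1 < \<epsilon> \<and>
        (\<forall>j<n. dist ((T ^^ (p + j)) z) ((T ^^ j) x2) < \<epsilon>')) \<and>
     m_transitive T (\<lambda>\<epsilon> _ _ _. m \<epsilon>) \<and>
     (\<forall>\<epsilon>>0. (\<lambda>n. real (m \<epsilon>) / real n) \<longlonglongrightarrow> 0)"
proof -
  obtain m :: "real \<Rightarrow> nat" where
    m: "\<forall>\<epsilon>>0. \<forall>x1 x2. \<exists>p z. p \<le> m \<epsilon> \<and> dist z x1 < \<epsilon> \<and> (T ^^ p) z = x2"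
    using minimal_exact_shadowing[OF min] by blast
  have sh: "\<exists>p z. p \<le> m \<epsilon> \<and> dist z x1 < \<epsilon> \<and> (\<forall>j. (T ^^ (p + j)) z = (T ^^ j) x2)" if \<epsilon>: "\<epsilon> > 0" for \<epsilon> x1 x2
  proof -
    obtain p z where pz: "p \<le> m \<epsilon>" "dist z x1 < \<epsilon>" "(T ^^ p) z = x2" using m \<epsilon> by blast
    have "(T ^^ (p + j)) z = (T ^^ j) x2" for j
      using pz(3) by (metis add.commute funpow_add o_apply)
    then show ?thesis using pz by blast
  qed
  have "mg_product_property T (\<lambda>\<epsilon> _ _ _. m \<epsilon>) (\<lambda>_ _ _ _. 0)"
    unfolding mg_product_property_def
  proof (intro conjI allI impI)
    fix \<epsilon> :: real and x1 x2 :: 'a assume "\<epsilon> > 0"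
    then obtain p z where pz: "p \<le> m \<epsilon>" "dist z x1 < \<epsilon>" "\<forall>j. (T ^^ (p + j)) z = (T ^^ j) x2"
      using sh by blast
    show "\<exists>N\<ge>1. \<forall>n\<ge>N. \<exists>z p \<Lambda>. \<Lambda> \<subseteq> {..<n} \<and> p \<le> m \<epsilon> \<and> card ({..<n} - \<Lambda>) \<le> 0 \<and>
        dist z x1 < \<epsilon> \<and> (\<forall>j\<in>\<Lambda>. dist ((T ^^ (p + j)) z) ((T ^^ j) x2) < \<epsilon>)"
    proof (intro exI[of _ 1] conjI allI impI)
      fix n :: nat
      show "\<exists>z p \<Lambda>. \<Lambda> \<subseteq> {..<n} \<and> p \<le> m \<epsilon> \<and> card ({..<n} - \<Lambda>) \<le> 0 \<and>
        dist z x1 < \<epsilon> \<and> (\<forall>j\<in>\<Lambda>. dist ((T ^^ (p + j)) z) ((T ^^ j) x2) < \<epsilon>)"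
        using pz \<open>\<epsilon> > 0\<close> by (intro exI[of _ z] exI[of _ p] exI[of _ "{..<n}"]) simp
    qed simp
  qed simp
  then have "m_transitive T (\<lambda>\<epsilon> _ _ _. m \<epsilon>)"
    using minimal_transitive[OF min] by (simp add: m_transitive_def mg_transitive_def)
  moreover have "\<exists>p z. p \<le> m \<epsilon> \<and> dist z x1 < \<epsilon> \<and> (\<forall>j<n. dist ((T ^^ (p + j)) z) ((T ^^ j) x2) < \<epsilon>')"
    if \<epsilon>: "\<epsilon> > 0" "\<epsilon>' > 0" for \<epsilon> \<epsilon>' x1 x2 n
  proof -
    obtain p z where pz: "p \<le> m \<epsilon>" "dist z x1 < \<epsilon>" "\<forall>j. (T ^^ (p + j)) z = (T ^^ j) x2"
      using sh[OF \<epsilon>(1)] by blast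
    then show ?thesis using \<epsilon>(2) by (intro exI[of _ p] exI[of _ z]) simp
  qed
  moreover have "(\<lambda>n. real (m \<epsilon>) / real n) \<longlonglongrightarrow> 0" for \<epsilon> by (rule lim_const_over_n)
  ultimately show ?thesis by (intro exI[of _ m]) blast
qed

end

section \<open>Densely approximated measures under the four hypotheses\<close>

theorem theorem4:
  fixes T :: "'a::metric_space \<Rightarrow> 'a"
    and f :: "nat \<Rightarrow> 'a \<Rightarrow>\<^sub>C real"
  assumes "dynamical_system T"
    and "suitable f"
  shows
    "(\<forall>\<kappa>::real. \<forall>m g.
        0 < \<kappa> \<and> \<kappa> < 1 / 2 \<and> \<not> uniquely_ergodic T \<and> mg_transitive T m g \<and>
        (\<forall>\<epsilon>>0. \<forall>x y.
           liminf (\<lambda>n. ereal (real (m \<epsilon> x y n + g \<epsilon> x y n) / real (m \<epsilon> x y n + n))) < ereal \<kappa>)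
        \<longrightarrow> (\<exists>\<mu>\<in>M_dense f T. \<exists>\<nu>\<in>M_dense f T. \<mu> \<noteq> \<nu>))
     \<and>
     (\<forall>m g.
        \<not> uniquely_ergodic T \<and> mg_product_property T m g \<and>
        (\<forall>\<epsilon>>0. \<forall>x y.
           liminf (\<lambda>n. ereal (real (m \<epsilon> x y n + g \<epsilon> x y n) / real n)) = 0)
        \<longrightarrow> ergodic_measures T \<subseteq> M_dense f T \<and>
            (\<exists>\<mu>\<in>M_dense f T. \<exists>\<nu>\<in>M_dense f T. \<mu> \<noteq> \<nu>))
     \<and>
     (approximate_product_property T \<and> measure_center T = UNIV
        \<longrightarrow> M_dense f T = invariant_measures T \<and>
            (\<exists>m g. mg_transitive T m g \<and>
               (\<forall>\<epsilon>>0. \<forall>x y.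
                  (\<lambda>n. real (m \<epsilon> x y n + g \<epsilon> x y n) / real n) \<longlonglongrightarrow> 0)))
     \<and>
     (minimal T
        \<longrightarrow> ergodic_measures T \<subseteq> M_dense f T \<and>
            (\<exists>m :: real \<Rightarrow> nat.
               (\<forall>\<epsilon>>0. \<forall>x1 x2. \<forall>n\<ge>1. \<forall>\<epsilon>'>0. \<exists>p z.
                  p \<le> m \<epsilon> \<and> dist z x1 < \<epsilon> \<and>
                  (\<forall>j<n. dist ((T ^^ (p + j)) z) ((T ^^ j) x2) < \<epsilon>')) \<and>
               m_transitive T (\<lambda>\<epsilon> _ _ _. m \<epsilon>) \<and>
               (\<forall>\<epsilon>>0. (\<lambda>n. real (m \<epsilon>) / real n) \<longlonglongrightarrow> 0)))"
proof -
  interpret compact_system T f using assms by unfold_locales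
  have part1: "\<exists>\<mu>\<in>M_dense f T. \<exists>\<nu>\<in>M_dense f T. \<mu> \<noteq> \<nu>"
    if "\<kappa> < 1 / 2" "\<not> uniquely_ergodic T" "mg_transitive T m g"
      and lim: "\<forall>\<epsilon>>0. \<forall>x y. liminf (\<lambda>n. ereal (real (m \<epsilon> x y n + g \<epsilon> x y n) / real (m \<epsilon> x y n + n))) < ereal \<kappa>"
    for \<kappa> :: real and m g :: "real \<Rightarrow> 'a \<Rightarrow> 'a \<Rightarrow> nat \<Rightarrow> nat"
  proof (rule mg_transitive_two_dense[OF that(1,2)])
    show "mg_product_property T m g" "transitive T" using that(3) by (simp_all add: mg_transitive_def)
    show "\<exists>\<^sub>F n in sequentially. real (m \<epsilon> x y n + g \<epsilon> x y n) / real (m \<epsilon> x y n + n) < \<kappa>"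
      if "\<epsilon> > 0" for \<epsilon> x y
      by (rule frequently_less_of_liminf_less[OF lim[rule_format, OF that]])
  qed
  have part2: "ergodic_measures T \<subseteq> M_dense f T"
    if mg: "mg_product_property T m g"
      and lim: "\<forall>\<epsilon>>0. \<forall>x y. liminf (\<lambda>n. ereal (real (m \<epsilon> x y n + g \<epsilon> x y n) / real n)) = 0"
    for m g :: "real \<Rightarrow> 'a \<Rightarrow> 'a \<Rightarrow> nat \<Rightarrow> nat"
  proof (rule mg_product_ergodic_dense[OF mg])
    fix \<epsilon> \<kappa> :: real and x y :: 'a assume pos: "\<epsilon> > 0" "\<kappa> > 0"
    have "liminf (\<lambda>n. ereal (real (m \<epsilon> x y n + g \<epsilon> x y n) / real n)) < ereal \<kappa>"
      using lim pos by simp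
    then have "\<exists>\<^sub>F n in sequentially. real (m \<epsilon> x y n + g \<epsilon> x y n) / real n < \<kappa>"
      by (rule frequently_less_of_liminf_less)
    then have "\<exists>\<^sub>F n in sequentially. real (m \<epsilon> x y n + g \<epsilon> x y n) / real n < \<kappa> \<and> n \<ge> 1"
      using eventually_ge_at_top by (rule frequently_eventually_frequently)
    then show "\<exists>\<^sub>F n in sequentially. real (m \<epsilon> x y n + g \<epsilon> x y n) / real (m \<epsilon> x y n + n) < \<kappa>"
    proof (rule frequently_elim1)
      fix n assume n: "real (m \<epsilon> x y n + g \<epsilon> x y n) / real n < \<kappa> \<and> n \<ge> 1"
      have "real (m \<epsilon> x y n + g \<epsilon> x y n) / real (m \<epsilon> x y n + n) \<le> real (m \<epsilon> x y n + g \<epsilon> x y n) / real n"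
        using n by (intro divide_left_mono) auto
      then show "real (m \<epsilon> x y n + g \<epsilon> x y n) / real (m \<epsilon> x y n + n) < \<kappa>" using n by linarith
    qed
  qed
  have two: "\<exists>\<mu>\<in>M_dense f T. \<exists>\<nu>\<in>M_dense f T. \<mu> \<noteq> \<nu>"
    if "\<not> uniquely_ergodic T" "ergodic_measures T \<subseteq> M_dense f T"
    using not_uniquely_ergodic_two_ergodic[OF that(1)] that(2) by (metis less_irrefl subsetD)
  have part3: "M_dense f T = invariant_measures T"
    if "approximate_product_property T" "measure_center T = UNIV"
    using approximate_product_all_dense[OF that] by (auto simp: M_dense_def)
  show ?thesis
    by (intro conjI allI impI; (elim conjE)?)
      (rule part1 part2 two[OF _ part2] part3 approximate_product_mg_transitive
        minimal_ergodic_dense minimal_m_transitive; assumption)+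
qed

end
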